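(* The following problem is in $\mathsf{TC}^0$: given integers $a_1,\dots,a_n$ as unary numbers ($n$ is part of the input), compute $x_1,\dots,x_n\in\mathbb{Z}$ (either in unary or binary) such that $$x_1a_1+\cdots+x_na_n=\gcd(a_1,\dots,a_n)$$ with $|x_i|\le (n+1)\left(\max\{|a_1|,\dots,|a_n|\}\right)^2$ for all $i$.
   Context: $\mathsf{TC}^0$ is the class of functions computed by $\mathsf{Dlogtime}$-uniform families of Boolean circuits of constant depth and polynomial size with unbounded fan-in and-, or-, not- and majority-gates (alphabets are encoded in binary with a fixed number of bits per letter). A unary encoded integer $k$ is written as $1^{|k|}$ (possibly padded with zeros) together with its sign; the gcd is the non-negative greatest common divisor. *)

theory Defs
  imports Complex_Main "HOL-Library.Log_Nat"
begin

section \<open>Boolean circuits with majority gates\<close>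

datatype gate = Input nat | And_gate | Or_gate | Not_gate | Maj_gate

text \<open>
  Gates are named by natural numbers; \<open>label C g = None\<close> means that \<open>g\<close> is not a gate.
  A pair \<open>(h, g)\<close> in \<open>wires C\<close> feeds the value of \<open>h\<close> into \<open>g\<close>.
\<close>

record circuit =
  label :: "nat \<Rightarrow> gate option"
  wires :: "(nat \<times> nat) set"
  outputs :: "nat list"

definition preds :: "circuit \<Rightarrow> nat \<Rightarrow> nat set" where
  "preds C g = {h. (h, g) \<in> wires C}"

definition well_formed :: "nat \<Rightarrow> circuit \<Rightarrow> bool" where
  "well_formed n C \<longleftrightarrow>
     finite (dom (label C)) \<and>
     wires C \<subseteq> dom (label C) \<times> dom (label C) \<and>
     set (outputs C) \<subseteq> dom (label C) \<and>
     (\<forall>g i. label C g = Some (Input i) \<longrightarrow> i < n \<and> preds C g = {}) \<and>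
     (\<forall>g. label C g = Some Not_gate \<longrightarrow> card (preds C g) = 1)"

text \<open>No directed path has more than \<open>d\<close> wires; in particular the circuit is acyclic.\<close>

definition depth_at_most :: "nat \<Rightarrow> circuit \<Rightarrow> bool" where
  "depth_at_most d C \<longleftrightarrow> wires C ^^ Suc d = {}"

text \<open>
  A majority gate outputs 1 iff strictly more of its inputs are 1 than are 0.
  And- and or-gates without inputs are the constants 1 and 0.
\<close>

definition gate_value :: "circuit \<Rightarrow> bool list \<Rightarrow> (nat \<Rightarrow> bool) \<Rightarrow> nat \<Rightarrow> bool" where
  "gate_value C x v g =
     (case label C g of
        None \<Rightarrow> False
      | Some (Input i) \<Rightarrow> x ! i
      | Some And_gate \<Rightarrow> (\<forall>h\<in>preds C g. v h)
      | Some Or_gate \<Rightarrow> (\<exists>h\<in>preds C g. v h)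
      | Some Not_gate \<Rightarrow> \<not> v (the_elem (preds C g))
      | Some Maj_gate \<Rightarrow> card {h \<in> preds C g. v h} > card {h \<in> preds C g. \<not> v h})"

definition valuation :: "circuit \<Rightarrow> bool list \<Rightarrow> (nat \<Rightarrow> bool) \<Rightarrow> bool" where
  "valuation C x v \<longleftrightarrow> (\<forall>g. v g = gate_value C x v g)"

definition evaluates_to :: "circuit \<Rightarrow> bool list \<Rightarrow> bool list \<Rightarrow> bool" where
  "evaluates_to C x y \<longleftrightarrow> (\<exists>v. valuation C x v \<and> y = map v (outputs C))"

text \<open>Circuits of bounded depth have exactly one valuation, so they compute a function.\<close>

lemma gate_value_cong:
  assumes "well_formed n C" "\<And>h. h \<in> preds C g \<Longrightarrow> v h = v' h"
  shows "gate_value C x v g = gate_value C x v' g"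
proof -
  have "the_elem (preds C g) \<in> preds C g" if "label C g = Some Not_gate"
  proof -
    have "card (preds C g) = 1"
      using assms(1) that by (auto simp: well_formed_def)
    then obtain h where "preds C g = {h}" by (auto simp: card_1_singleton_iff)
    then show ?thesis by simp
  qed
  moreover have "{h \<in> preds C g. v h} = {h \<in> preds C g. v' h}"
    "{h \<in> preds C g. \<not> v h} = {h \<in> preds C g. \<not> v' h}"
    using assms(2) by auto
  ultimately show ?thesis
    using assms(2) by (simp add: gate_value_def split: option.split gate.split)
qed

lemma ex1_valuation:
  assumes wf: "well_formed n C" and depth: "depth_at_most d C"
  shows "\<exists>!v. valuation C x v"
proof
  define ev where "ev m = (gate_value C x ^^ m) (\<lambda>_. False)" for m
  have ev_Suc: "ev (Suc m) = gate_value C x (ev m)" for m by (simp add: ev_def)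
  have stable: "ev (Suc m) g = ev m g" if "\<And>h. (h, g) \<notin> wires C ^^ m" for m g
    using that
  proof (induction m arbitrary: g)
    case (Suc m)
    then have "ev (Suc m) h = ev m h" if "h \<in> preds C g" for h
      using that by (force simp: preds_def)
    then show ?case by (metis ev_Suc gate_value_cong[OF wf])
  qed auto
  have no_path: "(h, g) \<notin> wires C ^^ Suc d" for h g
    using depth unfolding depth_at_most_def by blast
  show "valuation C x (ev (Suc d))"
    unfolding valuation_def using stable[OF no_path] by (metis ev_Suc)
  fix v assume v: "valuation C x v"
  have "v g = ev m g" if "\<And>h. (h, g) \<notin> wires C ^^ m" for m g
    using that
  proof (induction m arbitrary: g)
    case (Suc m)
    then have "v h = ev m h" if "h \<in> preds C g" for h
      using that by (force simp: preds_def)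
    then show ?case by (metis ev_Suc gate_value_cong[OF wf] v valuation_def)
  qed auto
  then show "v = ev (Suc d)" using no_path by blast
qed


section \<open>Random-access Turing machines\<close>

text \<open>
  Deterministic multi-tape machines. States and tape symbols are initial segments of the
  natural numbers: state 0 is initial, 1 accepting, 2 rejecting; symbol 0 is blank and 1, 2
  represent the bits 0, 1. Tapes are infinite to the right only. Tape 0 is the address tape: its
  content, read as a binary number, selects the cell of the random-access input word
  whose symbol is visible in the current step.
\<close>

datatype move = Left | Stay | Right

record machine =
  n_states :: nat
  n_symbols :: nat
  n_tapes :: nat
  delta :: "nat \<Rightarrow> nat \<Rightarrow> nat list \<Rightarrow> nat \<times> (nat \<times> move) list"
    \<comment> \<open>state, visible input symbol and scanned tape symbols
        to new state, written symbols and head moves\<close>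

definition valid_machine :: "machine \<Rightarrow> bool" where
  "valid_machine M \<longleftrightarrow>
     3 \<le> n_states M \<and> 3 \<le> n_symbols M \<and> 3 \<le> n_tapes M \<and>
     (\<forall>q < n_states M. \<forall>a < 3. \<forall>ss. length ss = n_tapes M \<and> set ss \<subseteq> {..<n_symbols M} \<longrightarrow>
        (case delta M q a ss of (q', acts) \<Rightarrow>
           q' < n_states M \<and> length acts = n_tapes M \<and> fst ` set acts \<subseteq> {..<n_symbols M}))"

type_synonym tape = "nat \<times> (nat \<Rightarrow> nat)"  \<comment> \<open>head position and cell contents\<close>

type_synonym config = "nat \<times> tape list"

definition bit_symbol :: "bool \<Rightarrow> nat" where
  "bit_symbol b = (if b then 2 else 1)"

definition cell_of :: "bool list \<Rightarrow> nat \<Rightarrow> nat" where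
  "cell_of w i = (if i < length w then bit_symbol (w ! i) else 0)"

text \<open>On machine tapes numbers are written in binary with the least significant bit first.\<close>

definition binary_word :: "nat \<Rightarrow> bool list" where
  "binary_word x = map (bit x) [0..<floorlog 2 x]"

definition address :: "tape \<Rightarrow> nat" where
  "address t = horner_sum of_bool 2
     (map (\<lambda>i. snd t i = bit_symbol True) [0..<LEAST i. snd t i \<notin> range bit_symbol])"

fun move_head :: "move \<Rightarrow> nat \<Rightarrow> nat" where
  "move_head Left p = p - 1"
| "move_head Stay p = p"
| "move_head Right p = p + 1"

definition update_tape :: "tape \<Rightarrow> nat \<times> move \<Rightarrow> tape" where
  "update_tape t act = (move_head (snd act) (fst t), (snd t)(fst t := fst act))"

definition step :: "machine \<Rightarrow> bool list \<Rightarrow> config \<Rightarrow> config" where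
  "step M w = (\<lambda>(q, ts).
     if q \<in> {1, 2} then (q, ts)
     else (case delta M q (cell_of w (address (ts ! 0))) (map (\<lambda>t. snd t (fst t)) ts) of
       (q', acts) \<Rightarrow> (q', map2 update_tape ts acts)))"

definition initial_config :: "machine \<Rightarrow> nat \<Rightarrow> nat \<Rightarrow> config" where
  "initial_config M x y =
     (0, map (\<lambda>u. (0, cell_of u))
           ([[], binary_word x, binary_word y] @ replicate (n_tapes M - 3) []))"

text \<open>
  A family \<open>R n\<close> of binary relations is decided in time \<open>O(log n)\<close> by one machine that is given two
  numbers in binary and the random-access word \<open>1\<^sup>n\<close>. The numbers range over
  a polynomially large initial segment, so that they have \<open>O(log n)\<close> bits.
\<close>

definition dlogtime_decidable :: "nat \<Rightarrow> (nat \<Rightarrow> (nat \<times> nat) set) \<Rightarrow> bool" where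
  "dlogtime_decidable k R \<longleftrightarrow>
     (\<exists>M c. valid_machine M \<and>
       (\<forall>n. \<forall>x < n ^ k + k. \<forall>y < n ^ k + k.
          fst ((step M (replicate n True) ^^ (c * (floorlog 2 n + 1))) (initial_config M x y))
            = (if (x, y) \<in> R n then 1 else 2)))"


section \<open>Uniform circuit families and the class TC0\<close>

text \<open>
  The machines have to answer correctly for all numbers below \<open>n ^ k + k\<close>, not only
  for names of gates. Hence they also determine which numbers are gates and how many output bits
  there are, and no non-uniform information can be hidden in these data.
\<close>

definition dlogtime_uniform :: "nat \<Rightarrow> (nat \<Rightarrow> circuit) \<Rightarrow> bool" where
  "dlogtime_uniform k C \<longleftrightarrow>
     dlogtime_decidable k (\<lambda>n. wires (C n)) \<and>
     dlogtime_decidable k (\<lambda>n. {(g, i). label (C n) g = Some (Input i)}) \<and>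
     (\<forall>t \<in> {And_gate, Or_gate, Not_gate, Maj_gate}.
        dlogtime_decidable k (\<lambda>n. {(g, _). label (C n) g = Some t})) \<and>
     dlogtime_decidable k (\<lambda>n. {(g, j). j < length (outputs (C n)) \<and> outputs (C n) ! j = g})"

definition TC0 :: "(bool list \<Rightarrow> bool list) set" where
  "TC0 = {f. \<exists>C d k. 1 \<le> k \<and>
     (\<forall>n. well_formed n (C n) \<and> depth_at_most d (C n) \<and>
          dom (label (C n)) \<subseteq> {..<n ^ k + k} \<and> length (outputs (C n)) \<le> n ^ k + k) \<and>
     dlogtime_uniform k C \<and>
     (\<forall>x. evaluates_to (C (length x)) x (f x))}"


section \<open>Encodings of lists of integers\<close>

datatype letter = Plus | Minus | Digit0 | Digit1

fun letter_code :: "letter \<Rightarrow> bool list" where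
  "letter_code Plus = [False, False]"
| "letter_code Minus = [False, True]"
| "letter_code Digit0 = [True, False]"
| "letter_code Digit1 = [True, True]"

definition TC0_letters :: "(letter list \<Rightarrow> letter list) set" where
  "TC0_letters =
     {f. \<exists>F \<in> TC0. \<forall>w. F (concat (map letter_code w)) = concat (map letter_code (f w))}"

text \<open>Zero may carry either sign.\<close>

definition sign_of :: "int \<Rightarrow> letter \<Rightarrow> bool" where
  "sign_of z s \<longleftrightarrow> (s = Plus \<and> z \<ge> 0) \<or> (s = Minus \<and> z \<le> 0)"

definition unary_code :: "int \<Rightarrow> letter list \<Rightarrow> bool" where
  "unary_code z w \<longleftrightarrow>
     (\<exists>s p q. sign_of z s \<and>
        w = s # replicate p Digit0 @ replicate (nat \<bar>z\<bar>) Digit1 @ replicate q Digit0)"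

text \<open>Binary notation with the most significant bit first; leading zeros are permitted.\<close>

definition binary_code :: "int \<Rightarrow> letter list \<Rightarrow> bool" where
  "binary_code z w \<longleftrightarrow>
     (\<exists>s bs. sign_of z s \<and> bs \<noteq> [] \<and> \<bar>z\<bar> = horner_sum of_bool 2 (rev bs) \<and>
        w = s # map (\<lambda>b. if b then Digit1 else Digit0) bs)"

text \<open>The signs mark where the code of the next integer starts.\<close>

definition list_code :: "(int \<Rightarrow> letter list \<Rightarrow> bool) \<Rightarrow> int list \<Rightarrow> letter list \<Rightarrow> bool" where
  "list_code code zs w \<longleftrightarrow> (\<exists>ws. list_all2 code zs ws \<and> w = concat ws)"

end

theory Submission
  imports Defs "HOL-Number_Theory.Cong"
begin

text \<open>
  Divide the numbers \<open>\<bar>a\<^sub>i\<bar>\<close> by their gcd and let \<open>m\<close> be the first nonzero quotient. A prime \<open>p\<close> selects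
  the first index \<open>i\<close> whose quotient \<open>b\<^sub>i\<close> is not divisible by \<open>p\<close>. For every other index than that
  of \<open>m\<close>, the coefficient \<open>x\<^sub>i < m\<close> is the solution of the congruences \<open>b\<^sub>i x\<^sub>i = 1\<close> modulo the prime
  powers dividing \<open>m\<close> whose prime selects \<open>i\<close>, and \<open>x\<^sub>i = 0\<close> modulo the others. Then
  \<open>\<Sum> b\<^sub>i x\<^sub>i = 1\<close> modulo every prime power dividing \<open>m\<close>, hence modulo \<open>m\<close>, and the coefficient of
  \<open>m\<close> makes up the difference. This avoids iterated products: all numbers are polynomially
  bounded, and the description is first-order apart from addition, multiplication and one sum, which
  reduce to counting.

  First-order formulas with majority quantifiers over a universe of polynomial size translate into
  circuits. When the names of gates interleave the bits of the variables, wires and labels are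
  recognised by a finite automaton reading two names in lockstep; only the size of the universe and
  the comparison of one variable with the input length use random access.
\<close>

section \<open>Logarithmic-time scanning machines\<close>

text \<open>Uniformity is the obstacle in the circuit part: the machine sees the input length
  \<open>n\<close> only through probes of the word of \<open>n\<close> ones, and it has logarithmic
  time. Hence the universe is a power of two whose exponent is a multiple of
  \<open>lg n + 1\<close>, and names are only compared field by field. Arithmetic lives in the
  formulas instead, where it is expressed by counting.

  In the Bezout part a formula has to determine one solution. First indices and least residues turn
  every existence statement into a definable value. No prime divisor of \<open>m\<close> selects the
  index of \<open>m\<close>, so the congruences and the correction by the coefficient of
  \<open>m\<close> do not interfere. As the other coefficients are below \<open>m\<close>, their
  weighted sum is at most \<open>n * m * A\<close> for \<open>n\<close> numbers of size at most
  \<open>A\<close>; dividing by \<open>m\<close> leaves about \<open>n * A\<close>, which is where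
  the polynomial bound comes from.

  The number of output bits of a circuit is fixed by the input length, while coefficients vary in
  length. The zeros permitted by both codes fill this gap: every coefficient owns a block with more
  places than its absolute value.\<close>

type_synonym trans = "bool option \<Rightarrow> bool \<Rightarrow> bool \<Rightarrow> bool option"

text \<open>Bits arrive least significant first. Three states suffice for all automata used below:
  \<open>None\<close> means that nothing decisive has been seen, and \<open>Some\<close> carries a
  verdict that may still be revised.\<close>

primrec run :: "trans \<Rightarrow> (nat \<Rightarrow> bool) \<Rightarrow> (nat \<Rightarrow> bool) \<Rightarrow> nat \<Rightarrow> bool option" where
  "run \<delta> f g 0 = None"
| "run \<delta> f g (Suc t) = \<delta> (run \<delta> f g t) (f t) (g t)"

text \<open>
  The scan of a pair \<open>x\<close>, \<open>y\<close> runs all automata with three states on all pairs of bit streams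
  at once. This makes the relations that depend only on the results closed under Boolean operations.
\<close>

type_synonym results = "trans \<times> nat \<times> nat \<Rightarrow> bool option"

definition stream :: "nat \<Rightarrow> nat \<Rightarrow> nat \<Rightarrow> nat \<Rightarrow> nat \<Rightarrow> nat \<Rightarrow> bool" where
  "stream K K' x y i t = (if i < K then bit x (K * t + i) else bit y (K' * t + (i - K)))"

definition results :: "nat \<Rightarrow> nat \<Rightarrow> nat \<Rightarrow> nat \<Rightarrow> nat \<Rightarrow> results" where
  "results K K' x y L = (\<lambda>(\<delta>, i, j). if i < K + K' \<and> j < K + K'
     then run \<delta> (stream K K' x y i) (stream K K' x y j) L else None)"

definition fld :: "nat \<Rightarrow> nat \<Rightarrow> nat \<Rightarrow> nat \<Rightarrow> nat" where
  "fld K L x s = horner_sum of_bool 2 (map (\<lambda>t. bit x (K * t + s)) [0..<L])"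

text \<open>The rounded-up binary logarithm in the form in which probing yields it: the input cell
  with address \<open>2 ^ i\<close> is blank exactly if \<open>n \<le> 2 ^ i\<close>.\<close>

definition lg :: "nat \<Rightarrow> nat" where
  "lg n = (LEAST i. n \<le> 2 ^ i)"

definition upd :: "nat \<Rightarrow> results \<Rightarrow> bool list \<Rightarrow> results" where
  "upd B \<rho> bs = (\<lambda>(\<delta>, i, j). if i < B \<and> j < B then \<delta> (\<rho> (\<delta>, i, j)) (bs ! i) (bs ! j) else None)"

text \<open>
  \<open>Probe\<close> queries the addresses \<open>2 ^ i\<close> until \<open>n \<le> 2 ^ i\<close> and writes \<open>m\<close> marks per query on tape 3,
  the ruler; its first cell holds 2 as end marker. \<open>Back\<close> clears the address tape. For each mark,
  \<open>Scan\<close> reads \<open>K\<close> bits of \<open>x\<close> and \<open>K'\<close> bits of \<open>y\<close> and copies the first bit of \<open>x\<close> to the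
  address tape, so that finally the visible input symbol tells whether field 0 of \<open>x\<close> is less than \<open>n\<close>.
  For \<open>K' = 0\<close> the number \<open>y\<close> is ignored.
\<close>

datatype state = Start | Acc | Rej | Probe nat | Back | Scan results "bool list" "bool list"

fun tr :: "nat \<Rightarrow> nat \<Rightarrow> nat \<Rightarrow> (results \<Rightarrow> bool \<Rightarrow> bool) \<Rightarrow> state \<Rightarrow> nat \<Rightarrow> nat list
    \<Rightarrow> state \<times> (nat \<times> move) list" where
  "tr m K K' acc Start a ss =
     (Probe 0, [(ss ! 0, Stay), (ss ! 1, Stay), (ss ! 2, Stay), (2, Stay)])"
| "tr m K K' acc (Probe c) a ss =
     (if c < m then (Probe (Suc c),
        [(2, Stay), (ss ! 1, Stay), (ss ! 2, Stay), (if ss ! 3 = 2 then 2 else 1, Right)])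
      else if a \<noteq> 0 then (Probe 0,
        [(1, Right), (ss ! 1, Stay), (ss ! 2, Stay), (ss ! 3, Stay)])
      else (Back,
        [(ss ! 0, Stay), (ss ! 1, Stay), (ss ! 2, Stay), (ss ! 3, Stay)]))"
| "tr m K K' acc Back a ss =
     (if ss ! 3 = 2 then (Scan (\<lambda>_. None) [] [],
        [(0, Stay), (ss ! 1, Stay), (ss ! 2, Stay), (ss ! 3, Stay)])
      else (Back,
        [(0, Left), (ss ! 1, Stay), (ss ! 2, Stay), (ss ! 3, Left)]))"
| "tr m K K' acc (Scan \<rho> xs ys) a ss =
     (if xs = [] \<and> ys = [] \<and> ss ! 3 = 0 then
        (if ss ! 1 = 0 \<and> (K' = 0 \<or> ss ! 2 = 0) \<and> acc \<rho> (a \<noteq> 0) then Acc else Rej,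
         [(ss ! 0, Stay), (ss ! 1, Stay), (ss ! 2, Stay), (ss ! 3, Stay)])
      else if length xs < K then (Scan \<rho> (xs @ [ss ! 1 = 2]) ys,
        [(ss ! 0, Stay), (ss ! 1, Right), (ss ! 2, Stay), (ss ! 3, Stay)])
      else if length ys < K' then (Scan \<rho> xs (ys @ [ss ! 2 = 2]),
        [(ss ! 0, Stay), (ss ! 1, Stay), (ss ! 2, Right), (ss ! 3, Stay)])
      else (Scan (upd (K + K') \<rho> (xs @ ys)) [] [],
        [(bit_symbol (hd xs), Right), (ss ! 1, Stay), (ss ! 2, Stay), (ss ! 3, Right)]))"
| "tr m K K' acc q a ss =
     (q, [(ss ! 0, Stay), (ss ! 1, Stay), (ss ! 2, Stay), (ss ! 3, Stay)])"

text \<open>The type \<open>results\<close> is infinite, but \<open>trans\<close> is a finite type.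
  Bounding the two field indices therefore leaves finitely many tables, hence finitely many control
  states.\<close>

definition states :: "nat \<Rightarrow> nat \<Rightarrow> nat \<Rightarrow> state set" where
  "states m K K' = {Start, Acc, Rej, Back} \<union> Probe ` {..m} \<union>
     (\<lambda>(\<rho>, xs, ys). Scan \<rho> xs ys) `
       ({\<rho>. \<forall>\<delta> i j. \<rho> (\<delta>, i, j) \<noteq> None \<longrightarrow> i < K + K' \<and> j < K + K'} \<times>
        {xs. length xs \<le> K} \<times> {ys. length ys \<le> K'})"

lemma finite_lists_upto: "finite {xs :: bool list. length xs \<le> n}"
  using finite_lists_length_le[of "UNIV :: bool set" n] by simp

lemma finite_states: "finite (states m K K')"
proof -
  let ?A = "UNIV \<times> {..<K + K'} \<times> {..<K + K'} :: (trans \<times> nat \<times> nat) set"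
  have "finite ?A" by (intro finite_cartesian_product) auto
  then have "finite {\<rho> :: results. \<forall>x. (x \<in> ?A \<longrightarrow> \<rho> x \<in> UNIV) \<and> (x \<notin> ?A \<longrightarrow> \<rho> x = None)}"
    by (rule finite_set_of_finite_funs) auto
  then have "finite {\<rho> :: results. \<forall>\<delta> i j. \<rho> (\<delta>, i, j) \<noteq> None \<longrightarrow> i < K + K' \<and> j < K + K'}"
    by (rule rev_finite_subset) fastforce
  then show ?thesis
    unfolding states_def by (auto intro!: finite_imageI finite_cartesian_product finite_lists_upto)
qed

lemma tr_closed:
  assumes "q \<in> states m K K'"
  shows "fst (tr m K K' acc q a ss) \<in> states m K K'"
  using assms unfolding states_def
  by (cases "(m, K, K', acc, q, a, ss)" rule: tr.cases)
    (auto simp: upd_def image_iff split: if_splits)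

lemma length_tr: "length (snd (tr m K K' acc q a ss)) = 4"
  by (cases "(m, K, K', acc, q, a, ss)" rule: tr.cases) auto

lemma tr_symbols:
  assumes "length ss = 4" "set ss \<subseteq> {..<3}"
  shows "fst ` set (snd (tr m K K' acc q a ss)) \<subseteq> {..<3}"
proof -
  have "ss ! i < 3" if "i < 4" for i
    using assms that by (metis lessThan_iff nth_mem subsetD)
  from this[of 0] this[of 1] this[of 2] this[of 3] show ?thesis
    by (cases "(m, K, K', acc, q, a, ss)" rule: tr.cases; auto simp: bit_symbol_def)
qed

section \<open>Numbering the symbolic control states\<close>

definition astep :: "nat \<Rightarrow> nat \<Rightarrow> nat \<Rightarrow> (results \<Rightarrow> bool \<Rightarrow> bool) \<Rightarrow> bool list \<Rightarrow>
    state \<times> tape list \<Rightarrow> state \<times> tape list" where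
  "astep m K K' acc w = (\<lambda>(q, ts). if q \<in> {Acc, Rej} then (q, ts)
     else (case tr m K K' acc q (cell_of w (address (ts ! 0))) (map (\<lambda>t. snd t (fst t)) ts) of
       (q', acts) \<Rightarrow> (q', map2 update_tape ts acts)))"

text \<open>The machine model prescribes the numbers 0, 1, 2 of three states, so an arbitrary
  enumeration of the remaining ones is shifted by 3.\<close>

lemma ex_state_code:
  assumes "finite Q" "{Start, Acc, Rej} \<subseteq> Q"
  shows "\<exists>h. bij_betw h Q {..<card Q} \<and> h Start = 0 \<and> h Acc = 1 \<and> h Rej = (2::nat)"
proof -
  define Q' where "Q' = Q - {Start, Acc, Rej}"
  have fin: "finite Q'" using assms(1) by (simp add: Q'_def)
  obtain h0 where h0: "bij_betw h0 Q' {0..<card Q'}"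
    using ex_bij_betw_finite_nat[OF fin] by blast
  have Q: "Q = insert Start (insert Acc (insert Rej Q'))" using assms(2) by (auto simp: Q'_def)
  have card: "card Q = card Q' + 3"
    unfolding Q using fin by (simp add: Q'_def)
  define h where "h q = (if q = Start then 0 else if q = Acc then 1 else if q = Rej then 2
    else h0 q + 3)" for q
  have "bij_betw h Q {..<card Q}"
    unfolding bij_betw_def
  proof
    have h0': "inj_on h0 Q'" "\<And>q. q \<in> Q' \<Longrightarrow> h0 q < card Q'"
      using h0 bij_betw_imp_inj_on bij_betwE by (blast, force)
    show inj: "inj_on h Q"
    proof (rule inj_onI)
      fix q r assume "q \<in> Q" "r \<in> Q" "h q = h r"
      then show "q = r"
        using inj_onD[OF h0'(1), of q r] by (simp add: h_def Q'_def split: if_splits)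
    qed
    have "h q < card Q" if "q \<in> Q" for q
      using h0'(2)[of q] that by (simp add: h_def Q'_def card)
    then have "h ` Q \<subseteq> {..<card Q}" by blast
    moreover have "card (h ` Q) = card {..<card Q}" using inj by (simp add: card_image)
    ultimately show "h ` Q = {..<card Q}" by (simp add: card_subset_eq)
  qed
  then show ?thesis by (auto simp: h_def)
qed

text \<open>In the default case both sides coincide: nothing is claimed about runs that have not
  halted, and halted runs are compared by their final states.\<close>

definition implements ::
  "machine \<Rightarrow> nat \<Rightarrow> nat \<Rightarrow> nat \<Rightarrow> (results \<Rightarrow> bool \<Rightarrow> bool) \<Rightarrow> bool list \<Rightarrow> nat \<Rightarrow> nat \<Rightarrow> nat \<Rightarrow> bool"
where
  "implements M m K K' acc w x y T \<longleftrightarrow> fst ((step M w ^^ T) (initial_config M x y)) =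
     (case fst ((astep m K K' acc w ^^ T)
        (Start, map (\<lambda>u. (0, cell_of u)) [[], binary_word x, binary_word y, []])) of
        Acc \<Rightarrow> 1 | Rej \<Rightarrow> 2 | q \<Rightarrow> fst ((step M w ^^ T) (initial_config M x y)))"

lemma ex_machine: "\<exists>M. valid_machine M \<and> (\<forall>w x y T. implements M m K K' acc w x y T)"
proof -
  let ?Q = "states m K K'"
  have sub: "{Start, Acc, Rej} \<subseteq> ?Q" by (auto simp: states_def)
  obtain h where h: "bij_betw h ?Q {..<card ?Q}" "h Start = 0" "h Acc = 1" "h Rej = (2::nat)"
    using ex_state_code[OF finite_states sub] by blast
  define g where "g = inv_into ?Q h"
  have gh: "g (h q) = q" if "q \<in> ?Q" for q
    using h(1) that by (simp add: g_def bij_betw_def)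
  have gQ: "g q \<in> ?Q" if "q < card ?Q" for q
    using h(1) that by (metis bij_betw_def g_def inv_into_into lessThan_iff)
  have hQ: "h q < card ?Q" if "q \<in> ?Q" for q
    using h(1) that by (metis bij_betwE lessThan_iff)
  define M where "M = \<lparr>n_states = card ?Q, n_symbols = 3, n_tapes = 4,
    delta = (\<lambda>q a ss. map_prod h id (tr m K K' acc (g q) a ss))\<rparr>"
  have "card {Start, Acc, Rej} \<le> card ?Q"
    by (rule card_mono[OF finite_states sub])
  then have valid: "valid_machine M"
    unfolding valid_machine_def M_def
    using tr_closed[OF gQ] hQ tr_symbols length_tr by (auto simp: map_prod_def split: prod.splits)
      (metis fst_conv, metis length_tr snd_conv,
       (metis (no_types, lifting) image_eqI fst_conv lessThan_iff snd_conv subsetD))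
  \<comment> \<open>Invariance of \<open>?Q\<close> is part of the claim because \<open>g\<close>
    inverts \<open>h\<close> only on \<open>?Q\<close>, so that the next step can be simulated
    again.\<close>
  have sim: "step M w (h q, ts) = map_prod h id (astep m K K' acc w (q, ts)) \<and>
     fst (astep m K K' acc w (q, ts)) \<in> ?Q" if "q \<in> ?Q" for w q ts
  proof -
    have "h q = 1 \<longleftrightarrow> q = Acc" "h q = 2 \<longleftrightarrow> q = Rej"
      using h gh that sub by (metis insert_subset)+
    then show ?thesis
      using tr_closed[OF that] gh[OF that] that
      by (auto simp: step_def astep_def M_def map_prod_def split: prod.splits) (metis fst_conv)+
  qed
  have simT: "(step M w ^^ T) (h q, ts) = map_prod h id ((astep m K K' acc w ^^ T) (q, ts)) \<and>
     fst ((astep m K K' acc w ^^ T) (q, ts)) \<in> ?Q" if "q \<in> ?Q" for w q ts T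
  proof (induction T)
    case (Suc T)
    obtain q' ts' where "(astep m K K' acc w ^^ T) (q, ts) = (q', ts')" by fastforce
    then show ?case using Suc sim[of q' w ts'] by (simp add: id_def)
  qed (use that in simp)
  have init: "initial_config M x y =
    (h Start, map (\<lambda>u. (0, cell_of u)) [[], binary_word x, binary_word y, []])" for x y
    by (simp add: initial_config_def M_def h)
  have "implements M m K K' acc w x y T" for w x y T
    using simT[where q = Start and w = w and T = T and ts = "map (\<lambda>u. (0, cell_of u)) [[], binary_word x, binary_word y, []]"] sub h
    unfolding implements_def init[symmetric] by (simp add: fst_map_prod split: state.split)
  then show ?thesis using valid by blast
qed

section \<open>Logarithms, binary words and addresses\<close>

lemma le_power_lg: "n \<le> 2 ^ lg n"
  unfolding lg_def by (rule LeastI[of _ n]) (simp add: less_imp_le)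

lemma power_lt_of_lt_lg: "i < lg n \<Longrightarrow> 2 ^ i < n"
  unfolding lg_def using not_less_Least[of i "\<lambda>i. n \<le> 2 ^ i"] by simp

lemma lg_le: "n \<le> 2 ^ i \<Longrightarrow> lg n \<le> i"
  unfolding lg_def by (rule Least_le)

lemma lg_le_floorlog: "lg n \<le> floorlog 2 n"
proof (rule lg_le)
  show "n \<le> 2 ^ floorlog 2 n"
    using floorlog_bounds[of n 2] by (cases "n = 0") auto
qed

lemma cell_of_binary_word:
  "cell_of (binary_word x) p = (if p < floorlog 2 x then bit_symbol (bit x p) else 0)"
  by (simp add: cell_of_def binary_word_def)

lemma bit_floorlog: "floorlog 2 x \<le> p \<Longrightarrow> \<not> bit (x :: nat) p"
proof -
  assume "floorlog 2 x \<le> p"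
  then have "x < 2 ^ p" by (simp add: floorlog_leD)
  then show ?thesis by (simp add: bit_iff_odd)
qed

lemma cell_of_binary_word_eq_2: "cell_of (binary_word x) p = 2 \<longleftrightarrow> bit x p"
  using bit_floorlog[of x p] by (auto simp: cell_of_binary_word bit_symbol_def)

text \<open>This is how a scan notices numbers that are too long: a blank under the head after
  \<open>p\<close> bits means that no higher bit remains.\<close>

lemma cell_of_binary_word_eq_0: "cell_of (binary_word x) p = 0 \<longleftrightarrow> x < 2 ^ p"
proof -
  have "x < 2 ^ p \<longleftrightarrow> floorlog 2 x \<le> p"
    using floorlog_leD[of 2 x p] floorlog_le_iff[of 2 x p] by (auto simp: floorlog_leD)
  then show ?thesis by (auto simp: cell_of_binary_word bit_symbol_def)
qed

lemma address_bits:
  assumes "\<And>p. p < i \<Longrightarrow> snd t p = bit_symbol (\<beta> p)" "snd t i = 0"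
  shows "address t = horner_sum of_bool 2 (map \<beta> [0..<i])"
proof -
  have "(LEAST j. snd t j \<notin> range bit_symbol) = i"
    using assms by (intro Least_equality) (auto simp: bit_symbol_def not_le[symmetric] split: if_splits intro: leI)
  moreover have "map (\<lambda>p. snd t p = bit_symbol True) [0..<i] = map \<beta> [0..<i]"
    using assms(1) by (auto simp: bit_symbol_def)
  ultimately show ?thesis
    unfolding address_def by (simp only:)
qed

lemma horner_sum_unit: "horner_sum of_bool 2 (map (\<lambda>p. p = i) [0..<Suc i]) = (2 ^ i :: nat)"
proof -
  have "map (\<lambda>p. p = i) [0..<i] = replicate i False"
    by (intro nth_equalityI) auto
  moreover have "horner_sum of_bool 2 (replicate i False) = (0 :: nat)"
    by (induction i) auto
  ultimately show ?thesis by (simp add: horner_sum_append)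
qed

section \<open>The timed run of the scanning machine\<close>

locale scan =
  fixes m K K' :: nat and acc :: "results \<Rightarrow> bool \<Rightarrow> bool" and n x y :: nat
  assumes m: "0 < m" and K: "0 < K"
begin

abbreviation "S \<equiv> astep m K K' acc (replicate n True)"

abbreviation "conf q a b c d \<equiv>
  (q, [a, (b, cell_of (binary_word x)), (c, cell_of (binary_word y)), d])"

text \<open>\<open>ruler 0\<close> equals \<open>ruler 1\<close>: the end marker in cell 0 is
  present from the start and later counts as the first mark. For positive \<open>j\<close> exactly
  the cells below \<open>j\<close> are nonblank.\<close>

definition ruler :: "nat \<Rightarrow> nat \<Rightarrow> nat" where
  "ruler j = (\<lambda>p. if p = 0 then 2 else if p < j then 1 else 0)"

lemma S_simp:
  "S (q, ts) = (if q \<in> {Acc, Rej} then (q, ts)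
     else (case tr m K K' acc q (cell_of (replicate n True) (address (ts ! 0)))
         (map (\<lambda>t. snd t (fst t)) ts) of
       (q', acts) \<Rightarrow> (q', map2 update_tape ts acts)))"
  by (simp add: astep_def)

lemma visible: "cell_of (replicate n True) k = (if k < n then 2 else 0)"
  by (simp add: cell_of_def bit_symbol_def)

lemma ruler_Suc: "(ruler j)(j := if ruler j j = 2 then 2 else 1) = ruler (Suc j)"
  by (auto simp: ruler_def)

lemma probe_write:
  assumes "c < m"
  shows "S (conf (Probe c) (i, \<alpha>) 0 0 (j, ruler j)) =
    conf (Probe (Suc c)) (i, \<alpha>(i := 2)) 0 0 (Suc j, ruler (Suc j))"
  using assms unfolding ruler_Suc[symmetric] by (simp add: S_simp update_tape_def)

lemma probe_inner:
  "0 < c \<Longrightarrow> c \<le> m \<Longrightarrow>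
    (S ^^ c) (conf (Probe 0) (i, \<alpha>) 0 0 (j, ruler j)) =
      conf (Probe c) (i, \<alpha>(i := 2)) 0 0 (j + c, ruler (j + c))"
proof (induction c)
  case (Suc c)
  have "(S ^^ c) (conf (Probe 0) (i, \<alpha>) 0 0 (j, ruler j)) =
      conf (Probe c) (i, if c = 0 then \<alpha> else \<alpha>(i := 2)) 0 0 (j + c, ruler (j + c))"
    using Suc by (cases "c = 0") auto
  then have "(S ^^ Suc c) (conf (Probe 0) (i, \<alpha>) 0 0 (j, ruler j)) =
      S (conf (Probe c) (i, if c = 0 then \<alpha> else \<alpha>(i := 2)) 0 0 (j + c, ruler (j + c)))"
    by simp
  also have "\<dots> = conf (Probe (Suc c)) (i, (if c = 0 then \<alpha> else \<alpha>(i := 2))(i := 2)) 0 0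
      (Suc (j + c), ruler (Suc (j + c)))"
    using Suc.prems by (intro probe_write) simp
  also have "(if c = 0 then \<alpha> else \<alpha>(i := 2))(i := 2) = \<alpha>(i := 2)"
    by (rule ext) simp
  finally show ?case by (simp only: add_Suc_right)
qed simp

text \<open>Tape symbol 1 is the bit 0. Writing a one behind \<open>i\<close> zeros gives the
  address \<open>2 ^ i\<close>; turning it into a zero and moving right prepares the next
  power.\<close>

definition zeros :: "nat \<Rightarrow> nat \<Rightarrow> nat" where
  "zeros i = (\<lambda>p. if p < i then 1 else 0)"

lemma address_zeros: "address (i, (zeros i)(i := 2)) = 2 ^ i"
  by (subst address_bits[of "Suc i" _ "\<lambda>p. p = i"])
    (auto simp: zeros_def bit_symbol_def horner_sum_unit simp del: upt_Suc)

text \<open>The query is evaluated in state \<open>Probe m\<close>. As \<open>m\<close> is positive,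
  the one that completes the address has been written by then, and the same \<open>m\<close> steps
  have laid \<open>m\<close> marks.\<close>

lemma probe_step:
  "(S ^^ Suc m) (conf (Probe 0) (i, zeros i) 0 0 (j, ruler j)) =
     (if 2 ^ i < n then conf (Probe 0) (Suc i, zeros (Suc i)) 0 0 (j + m, ruler (j + m))
      else conf Back (i, (zeros i)(i := 2)) 0 0 (j + m, ruler (j + m)))"
proof -
  have "(zeros i)(i := 1) = zeros (Suc i)" by (auto simp: zeros_def)
  then show ?thesis
    using probe_inner[OF m order.refl, of i "zeros i" j]
    by (simp add: S_simp update_tape_def address_zeros visible)
qed

lemma probe_outer:
  "i \<le> lg n \<Longrightarrow> (S ^^ (i * Suc m)) (conf (Probe 0) (0, zeros 0) 0 0 (0, ruler 0)) =
     conf (Probe 0) (i, zeros i) 0 0 (i * m, ruler (i * m))"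
proof (induction i)
  case (Suc i)
  have "(S ^^ (Suc i * Suc m)) c = (S ^^ Suc m) ((S ^^ (i * Suc m)) c)" for c
    by (metis funpow_add comp_apply mult_Suc)
  then show ?case
    using Suc power_lt_of_lt_lg[of i n] probe_step[of i "i * m"] by (simp add: add.commute)
qed simp

abbreviation "L \<equiv> m * (lg n + 1)"

lemma probe:
  "(S ^^ (Suc (lg n) * Suc m)) (conf (Probe 0) (0, zeros 0) 0 0 (0, ruler 0)) =
     conf Back (lg n, (zeros (lg n))(lg n := 2)) 0 0 (L, ruler L)"
proof -
  have "(S ^^ (Suc (lg n) * Suc m)) c = (S ^^ Suc m) ((S ^^ (lg n * Suc m)) c)" for c
    by (metis funpow_add comp_apply mult_Suc)
  then show ?thesis
    using probe_outer[OF order.refl] probe_step[of "lg n" "lg n * m"] le_power_lg[of n]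
    by (simp add: algebra_simps)
qed

lemma back_loop:
  assumes \<beta>: "\<And>p. l < p \<Longrightarrow> \<beta> p = 0"
  shows "k \<le> j \<Longrightarrow> (S ^^ k) (conf Back (l, \<beta>) 0 0 (j, ruler j)) =
     conf Back (l - k, \<lambda>p. if p + k \<le> l then \<beta> p else 0) 0 0 (j - k, ruler j)"
proof (induction k)
  case 0
  then show ?case using \<beta> by (auto simp: fun_eq_iff)
next
  case (Suc k)
  have "ruler j (j - k) \<noteq> 2" using Suc.prems by (simp add: ruler_def)
  moreover have "(\<lambda>p. if p + k \<le> l then \<beta> p else 0)(l - k := 0) =
    (\<lambda>p. if p + Suc k \<le> l then \<beta> p else 0)"
    by (auto simp: fun_eq_iff)
  ultimately show ?case
    using Suc by (simp add: S_simp update_tape_def)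
qed

text \<open>The marks outnumber the address cells, so the address tape is blank when the ruler head
  meets its end marker; surplus left moves stay in cell 0.\<close>

lemma rewind:
  assumes "\<And>p. l < p \<Longrightarrow> \<beta> p = 0" "l < j"
  shows "(S ^^ Suc j) (conf Back (l, \<beta>) 0 0 (j, ruler j)) =
     conf (Scan (\<lambda>_. None) [] []) (0, \<lambda>_. 0) 0 0 (0, ruler j)"
proof -
  have "(\<lambda>p. if p + j \<le> l then \<beta> p else 0) = (\<lambda>_. 0)" using assms(2) by auto
  then show ?thesis
    using back_loop[where l = l and \<beta> = \<beta> and k = j and j = j, OF assms(1) order.refl] assms(2)
    by (simp add: S_simp update_tape_def ruler_def fun_eq_iff)
qed

definition written :: "nat \<Rightarrow> nat \<Rightarrow> nat" where
  "written t = (\<lambda>p. if p < t then bit_symbol (bit x (K * p)) else 0)"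

lemma read_x:
  assumes "r h \<noteq> 0"
  shows "k \<le> K \<Longrightarrow> (S ^^ k) (conf (Scan \<rho> [] []) a b c (h, r)) =
    conf (Scan \<rho> (map (bit x) [b..<b + k]) []) a (b + k) c (h, r)"
proof (induction k)
  case (Suc k)
  then show ?case using assms
    by (simp add: S_simp update_tape_def cell_of_binary_word_eq_2)
qed simp

lemma read_y:
  assumes "r h \<noteq> 0" "xs \<noteq> []" "length xs = K"
  shows "k \<le> K' \<Longrightarrow> (S ^^ k) (conf (Scan \<rho> xs []) a b c (h, r)) =
    conf (Scan \<rho> xs (map (bit y) [c..<c + k])) a b (c + k) (h, r)"
proof (induction k)
  case (Suc k)
  then show ?case using assms
    by (simp add: S_simp update_tape_def cell_of_binary_word_eq_2)
qed simp

lemma upd_results: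
  "upd (K + K') (results K K' x y t)
     (map (bit x) [K * t..<K * t + K] @ map (bit y) [K' * t..<K' * t + K']) =
   results K K' x y (Suc t)"
proof -
  have "(map (bit x) [K * t..<K * t + K] @ map (bit y) [K' * t..<K' * t + K']) ! i =
    stream K K' x y i t" if "i < K + K'" for i
    using that by (auto simp: nth_append stream_def)
  then show ?thesis by (auto simp: upd_def results_def fun_eq_iff)
qed

lemma scan_step:
  assumes "t < j"
  shows "(S ^^ (K + K' + 1))
    (conf (Scan (results K K' x y t) [] []) (t, written t) (K * t) (K' * t) (t, ruler j)) =
    conf (Scan (results K K' x y (Suc t)) [] [])
      (Suc t, written (Suc t)) (K * Suc t) (K' * Suc t) (Suc t, ruler j)"
proof -
  have r: "ruler j t \<noteq> 0" using assms by (auto simp: ruler_def)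
  let ?xs = "map (bit x) [K * t..<K * t + K]" and ?ys = "map (bit y) [K' * t..<K' * t + K']"
  have xs: "?xs \<noteq> []" "length ?xs = K" "hd ?xs = bit x (K * t)" using K by (auto simp: hd_map upt_conv_Cons)
  have w: "(written t)(t := bit_symbol (bit x (K * t))) = written (Suc t)"
    by (auto simp: written_def)
  have "(S ^^ (K + K' + 1)) c = S ((S ^^ K') ((S ^^ K) c))" for c
    by (simp add: funpow_add add.commute[of K])
  then show ?thesis
    using read_x[where h = t and r = "ruler j" and k = K, OF r order.refl]
      read_y[where h = t and r = "ruler j" and k = K', OF r xs(1,2) order.refl]
      xs w K upd_results[of t] r
    by (simp add: S_simp update_tape_def algebra_simps)
qed

lemma scan_loop:
  "t \<le> j \<Longrightarrow> (S ^^ (t * (K + K' + 1)))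
    (conf (Scan (\<lambda>_. None) [] []) (0, \<lambda>_. 0) 0 0 (0, ruler j)) =
    conf (Scan (results K K' x y t) [] []) (t, written t) (K * t) (K' * t) (t, ruler j)"
proof (induction t)
  case 0
  have "results K K' x y 0 = (\<lambda>_. None)" by (auto simp: results_def)
  then show ?case by (simp add: written_def)
next
  case (Suc t)
  have "(S ^^ (Suc t * (K + K' + 1))) c = (S ^^ (K + K' + 1)) ((S ^^ (t * (K + K' + 1))) c)" for c
    by (metis funpow_add comp_apply mult_Suc)
  then show ?case using Suc scan_step[of t j] by simp
qed

definition accepted :: bool where
  "accepted \<longleftrightarrow> x < 2 ^ (K * L) \<and> (K' = 0 \<or> y < 2 ^ (K' * L)) \<and>
     acc (results K K' x y L) (fld K L x 0 < n)"

lemma final: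
  "fst (S (conf (Scan (results K K' x y L) [] [])
     (L, written L) (K * L) (K' * L) (L, ruler L))) = (if accepted then Acc else Rej)"
proof -
  have "address (L, written L) = fld K L x 0"
    by (subst address_bits[of L _ "\<lambda>t. bit x (K * t)"]) (auto simp: written_def fld_def)
  moreover have "ruler L L = 0" using m by (simp add: ruler_def)
  ultimately show ?thesis
    by (simp add: S_simp accepted_def visible cell_of_binary_word_eq_0)
qed

text \<open>The summands are the start step, \<open>Suc (lg n)\<close> probes of
  \<open>Suc m\<close> steps, the rewinding, \<open>L\<close> rounds of reading and the verdict.
  Halting states are absorbing, so every later time shows the same state.\<close>

lemma total:
  assumes "T \<ge> 1 + (Suc (lg n) * Suc m) + Suc L + L * (K + K' + 1) + 1"
  shows "fst ((S ^^ T) (Start, map (\<lambda>u. (0, cell_of u)) [[], binary_word x, binary_word y, []])) =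
    (if accepted then Acc else Rej)"
proof -
  let ?c0 = "(Start, map (\<lambda>u. (0, cell_of u)) [[], binary_word x, binary_word y, []])"
  obtain T' where "T = 1 + (Suc (lg n) * Suc m) + Suc L + L * (K + K' + 1) + 1 + T'"
    using assms le_Suc_ex by blast
  then have T: "T = T' + (1 + (L * (K + K' + 1) + (Suc L + ((Suc (lg n) * Suc m) + 1))))"
    by (simp only: ac_simps)
  have start: "S ?c0 = conf (Probe 0) (0, zeros 0) 0 0 (0, ruler 0)"
    by (simp add: S_simp update_tape_def zeros_def ruler_def cell_of_def fun_eq_iff)
  have "lg n < L" using m by (cases m) auto
  then have rewind': "(S ^^ Suc L) (conf Back (lg n, (zeros (lg n))(lg n := 2)) 0 0 (L, ruler L)) =
     conf (Scan (\<lambda>_. None) [] []) (0, \<lambda>_. 0) 0 0 (0, ruler L)"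
    by (intro rewind) (auto simp: zeros_def)
  define c where "c = S (conf (Scan (results K K' x y L) [] [])
     (L, written L) (K * L) (K' * L) (L, ruler L))"
  have S1: "(S ^^ 1) z = S z" for z by simp
  have "(S ^^ T) ?c0 = (S ^^ T') c"
    unfolding T funpow_add comp_apply S1 start probe rewind' scan_loop[OF order.refl] c_def ..
  moreover have "S c = c" using final
    unfolding c_def[symmetric] by (cases c) (auto simp: S_simp split: if_splits)
  then have "(S ^^ T') c = c" by (induction T') auto
  ultimately show ?thesis using final c_def by simp
qed

end

lemma scan_decidable:
  assumes "0 < m" "0 < K"
    and R: "\<And>n x y. (x, y) \<in> R n \<longleftrightarrow> x < 2 ^ (K * (m * (lg n + 1))) \<and>
      (K' = 0 \<or> y < 2 ^ (K' * (m * (lg n + 1)))) \<and>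
      acc (results K K' x y (m * (lg n + 1))) (fld K (m * (lg n + 1)) x 0 < n)"
  shows "dlogtime_decidable k R"
proof -
  obtain M where M: "valid_machine M" "\<And>w x y T. implements M m K K' acc w x y T"
    using ex_machine[of m K K' acc] by blast
  \<comment> \<open>One summand per phase of \<open>total\<close>; the 3 pays for the start step,
    the last step of the rewinding and the verdict.\<close>
  define c where "c = 3 + Suc m + m + m * (K + K' + 1)"
  have "fst ((step M (replicate n True) ^^ (c * (floorlog 2 n + 1))) (initial_config M x y))
            = (if (x, y) \<in> R n then 1 else 2)" for n x y
  proof -
    interpret scan m K K' acc n x y by standard (use assms in auto)
    have "c * (lg n + 1) \<le> c * (floorlog 2 n + 1)"
      using lg_le_floorlog[of n] by simp
    then have eq: "fst ((S ^^ (c * (floorlog 2 n + 1)))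
        (Start, map (\<lambda>u. (0, cell_of u)) [[], binary_word x, binary_word y, []])) =
      (if accepted then Acc else Rej)"
      by (intro total) (simp add: c_def algebra_simps)
    show ?thesis
      by (rule trans[OF M(2)[unfolded implements_def]], unfold eq) (simp add: R accepted_def)
  qed
  then show ?thesis unfolding dlogtime_decidable_def using M(1) by blast
qed

section \<open>First-order formulas with majority quantifiers\<close>

datatype form = Atom trans nat nat | Inp | Rng | Neg form | Conj form form | Maj form form

text \<open>De Bruijn indices: a quantifier binds index 0. The atoms \<open>Inp\<close> and \<open>Rng\<close> refer to index 0 only,
  because a scan compares only field 0 with the input length.\<close>

primrec eval :: "form \<Rightarrow> bool list \<Rightarrow> nat \<Rightarrow> (nat \<Rightarrow> nat) \<Rightarrow> bool" where
  "eval (Atom \<delta> i j) w L e \<longleftrightarrow> run \<delta> (bit (e i)) (bit (e j)) L = Some True"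
| "eval Inp w L e \<longleftrightarrow> e 0 < length w \<and> w ! e 0"
| "eval Rng w L e \<longleftrightarrow> e 0 < length w"
| "eval (Neg \<phi>) w L e \<longleftrightarrow> \<not> eval \<phi> w L e"
| "eval (Conj \<phi> \<psi>) w L e \<longleftrightarrow> eval \<phi> w L e \<and> eval \<psi> w L e"
| "eval (Maj \<phi> \<psi>) w L e \<longleftrightarrow>
     card {v. v < 2 ^ L \<and> eval \<phi> w L (case_nat v e)} +
     card {v. v < 2 ^ L \<and> eval \<psi> w L (case_nat v e)} > 2 ^ L"

primrec indices_below :: "nat \<Rightarrow> form \<Rightarrow> bool" where
  "indices_below r (Atom \<delta> i j) \<longleftrightarrow> i < r \<and> j < r"
| "indices_below r Inp \<longleftrightarrow> 0 < r"
| "indices_below r Rng \<longleftrightarrow> 0 < r"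
| "indices_below r (Neg \<phi>) \<longleftrightarrow> indices_below r \<phi>"
| "indices_below r (Conj \<phi> \<psi>) \<longleftrightarrow> indices_below r \<phi> \<and> indices_below r \<psi>"
| "indices_below r (Maj \<phi> \<psi>) \<longleftrightarrow> indices_below r \<phi> \<and> indices_below r \<psi>"

lemma indices_below_mono: "indices_below r \<phi> \<Longrightarrow> r \<le> r' \<Longrightarrow> indices_below r' \<phi>"
  by (induction \<phi>) auto

lemma ex_indices_below: "\<exists>r. 0 < r \<and> indices_below r \<phi>"
proof (induction \<phi>)
  case (Atom \<delta> i j)
  then show ?case by (intro exI[of _ "Suc (max i j)"]) auto
next
  case (Conj \<phi> \<psi>)
  then obtain a b where "0 < a" "indices_below a \<phi>" "indices_below b \<psi>" by blast
  then show ?case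
    by (intro exI[of _ "max a b"]) (auto intro: indices_below_mono)
next
  case (Maj \<phi> \<psi>)
  then obtain a b where "0 < a" "indices_below a \<phi>" "indices_below b \<psi>" by blast
  then show ?case
    by (intro exI[of _ "max a b"]) (auto intro: indices_below_mono)
qed auto

lemma eval_cong:
  "indices_below r \<phi> \<Longrightarrow> (\<And>s. s < r \<Longrightarrow> e s = e' s) \<Longrightarrow> eval \<phi> w L e = eval \<phi> w L e'"
proof (induction \<phi> arbitrary: e e')
  case (Maj \<phi> \<psi>)
  have "case_nat v e s = case_nat v e' s" if "s < r" for v s
    using Maj.prems(2) that by (cases s) auto
  then have "eval \<phi> w L (case_nat v e) = eval \<phi> w L (case_nat v e')"
    "eval \<psi> w L (case_nat v e) = eval \<psi> w L (case_nat v e')" for v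
    using Maj.IH[of "case_nat v e" "case_nat v e'"] Maj.prems(1) by simp_all
  then show ?case by simp
next
  case (Neg \<phi>)
  show ?case using Neg.IH[of e e'] Neg.prems by simp
next
  case (Conj \<phi> \<psi>)
  show ?case using Conj.IH[of e e'] Conj.prems by simp
qed auto

primrec kids :: "form \<Rightarrow> form set" where
  "kids (Atom \<delta> i j) = {}"
| "kids Inp = {}"
| "kids Rng = {}"
| "kids (Neg \<phi>) = {\<phi>}"
| "kids (Conj \<phi> \<psi>) = {\<phi>, \<psi>}"
| "kids (Maj \<phi> \<psi>) = {\<phi>, \<psi>}"

primrec subforms :: "form \<Rightarrow> form list" where
  "subforms (Atom \<delta> i j) = [Atom \<delta> i j]"
| "subforms Inp = [Inp]"
| "subforms Rng = [Rng]"
| "subforms (Neg \<phi>) = Neg \<phi> # subforms \<phi>"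
| "subforms (Conj \<phi> \<psi>) = Conj \<phi> \<psi> # subforms \<phi> @ subforms \<psi>"
| "subforms (Maj \<phi> \<psi>) = Maj \<phi> \<psi> # subforms \<phi> @ subforms \<psi>"

lemma self_in_subforms: "\<phi> \<in> set (subforms \<phi>)"
  by (cases \<phi>) auto

lemma kids_subforms: "\<psi> \<in> set (subforms \<phi>) \<Longrightarrow> \<chi> \<in> kids \<psi> \<Longrightarrow> \<chi> \<in> set (subforms \<phi>)"
  using self_in_subforms by (induction \<phi>) auto

lemma indices_below_subforms:
  "indices_below r \<phi> \<Longrightarrow> \<psi> \<in> set (subforms \<phi>) \<Longrightarrow> indices_below r \<psi>"
  by (induction \<phi>) auto

lemma size_subforms: "\<psi> \<in> set (subforms \<phi>) \<Longrightarrow> size \<psi> \<le> size \<phi>"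
  by (induction \<phi>) auto

lemma size_kids: "\<chi> \<in> kids \<psi> \<Longrightarrow> size \<chi> < size \<psi>"
  by (cases \<psi>) auto


section \<open>Interleaving\<close>

lemma bit_fld: "bit (fld K L x s) t \<longleftrightarrow> t < L \<and> bit x (K * t + s)"
  by (auto simp: fld_def bit_horner_sum_bit_iff)

lemma horner_sum_less: "horner_sum of_bool 2 bs < (2 ^ length bs :: nat)"
  by (induction bs) auto

lemma fld_less: "fld K L x s < 2 ^ L"
  using horner_sum_less[of "map (\<lambda>t. bit x (K * t + s)) [0..<L]"] by (simp add: fld_def)

lemma not_bit_ge: "x < 2 ^ L \<Longrightarrow> L \<le> t \<Longrightarrow> \<not> bit (x :: nat) t"
proof -
  assume "x < 2 ^ L" "L \<le> t"
  then have "x < 2 ^ t" by (meson less_le_trans one_le_numeral power_increasing)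
  then show ?thesis by (simp add: bit_iff_odd)
qed

lemma eq_if_bits: 
  assumes "x < 2 ^ L" "y < 2 ^ L" "\<And>t. t < L \<Longrightarrow> bit x t = bit y t"
  shows "x = (y :: nat)"
proof (rule bit_eqI)
  fix t
  show "bit x t = bit y t"
    using assms not_bit_ge[of x L t] not_bit_ge[of y L t] by (cases "t < L") auto
qed

lemma fld_1: "x < 2 ^ L \<Longrightarrow> fld 1 L x 0 = x"
  by (rule eq_if_bits[of _ L]) (auto simp: fld_less bit_fld)

definition pack :: "nat \<Rightarrow> nat \<Rightarrow> (nat \<Rightarrow> nat) \<Rightarrow> nat" where
  "pack K L f = horner_sum of_bool 2 (map (\<lambda>p. bit (f (p mod K)) (p div K)) [0..<K * L])"

lemma pack_less: "pack K L f < 2 ^ (K * L)"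
  using horner_sum_less[of "map (\<lambda>p. bit (f (p mod K)) (p div K)) [0..<K * L]"]
  by (simp add: pack_def)

lemma interleave_less: "t < L \<Longrightarrow> s < K \<Longrightarrow> K * t + s < K * (L :: nat)"
proof -
  assume "t < L" "s < K"
  then have "K * t + s < K * Suc t" by simp
  also have "\<dots> \<le> K * L" using \<open>t < L\<close> by (intro mult_le_mono) auto
  finally show ?thesis .
qed

lemma fld_pack:
  assumes "s < K" "f s < 2 ^ L"
  shows "fld K L (pack K L f) s = f s"
proof (rule eq_if_bits)
  fix t assume "t < L"
  then show "bit (fld K L (pack K L f) s) t = bit (f s) t"
    using assms interleave_less[of t L s K]
    by (simp add: bit_fld pack_def bit_horner_sum_bit_iff)
qed (use assms in \<open>auto simp: fld_less\<close>)

lemma fld_inject: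
  assumes "x < 2 ^ (K * L)" "y < 2 ^ (K * L)" "\<And>s. s < K \<Longrightarrow> fld K L x s = fld K L y s"
  shows "x = y"
proof (rule eq_if_bits[OF assms(1,2)])
  fix p assume p: "p < K * L"
  then have "0 < K" by (cases K) auto
  with p have "p div K < L" "p mod K < K" 
    by (simp_all add: less_mult_imp_div_less mult.commute)
  then show "bit x p = bit y p"
    using assms(3)[of "p mod K"] bit_fld[of K L x "p mod K" "p div K"]
      bit_fld[of K L y "p mod K" "p div K"] by simp
qed


section \<open>Relations recognised by a single scan\<close>

text \<open>One acceptance condition has to serve all lengths; \<open>b\<close> is the outcome of
  the single random-access query. Length 0 is left out since the automaton of
  \<open>scannable_of_bool\<close> decides only after its first bit.\<close>

definition scannable ::
  "nat \<Rightarrow> nat \<Rightarrow> (nat \<Rightarrow> nat \<Rightarrow> nat \<Rightarrow> bool \<Rightarrow> bool) \<Rightarrow> bool" where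
  "scannable K K' P \<longleftrightarrow>
     (\<exists>acc. \<forall>L x y b. 0 < L \<longrightarrow> P L x y b = acc (results K K' x y L) b)"

lemma scannable_const: "scannable K K' (\<lambda>L x y b. c)"
  unfolding scannable_def by (intro exI[of _ "\<lambda>_ _. c"]) auto

lemma scannable_flag: "scannable K K' (\<lambda>L x y b. b)"
  unfolding scannable_def by (intro exI[of _ "\<lambda>_ b. b"]) auto

lemma scannable_not: "scannable K K' P \<Longrightarrow> scannable K K' (\<lambda>L x y b. \<not> P L x y b)"
  unfolding scannable_def by (elim exE, rule_tac x = "\<lambda>\<rho> b. \<not> acc \<rho> b" in exI) auto

lemma scannable_conj:
  "scannable K K' P \<Longrightarrow> scannable K K' Q \<Longrightarrow> scannable K K' (\<lambda>L x y b. P L x y b \<and> Q L x y b)"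
  unfolding scannable_def by (elim exE, rule_tac x = "\<lambda>\<rho> b. acc \<rho> b \<and> acca \<rho> b" in exI) auto

lemma scannable_ball:
  assumes "\<And>c. c \<in> A \<Longrightarrow> scannable K K' (P c)"
  shows "scannable K K' (\<lambda>L x y b. \<forall>c\<in>A. P c L x y b)"
proof -
  obtain acc where "\<And>c. c \<in> A \<Longrightarrow> \<forall>L x y b. 0 < L \<longrightarrow> P c L x y b = acc c (results K K' x y L) b"
    using assms unfolding scannable_def by metis
  then show ?thesis unfolding scannable_def
    by (intro exI[of _ "\<lambda>\<rho> b. \<forall>c\<in>A. acc c \<rho> b"]) auto
qed

lemma scannable_bex:
  assumes "\<And>c. c \<in> A \<Longrightarrow> scannable K K' (P c)"
  shows "scannable K K' (\<lambda>L x y b. \<exists>c\<in>A. P c L x y b)"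
proof -
  have "scannable K K' (\<lambda>L x y b. \<not> (\<forall>c\<in>A. \<not> P c L x y b))"
    by (intro scannable_not scannable_ball assms)
  then show ?thesis by simp
qed

definition field :: "nat \<Rightarrow> nat \<Rightarrow> nat \<Rightarrow> nat \<Rightarrow> nat \<Rightarrow> nat \<Rightarrow> nat" where
  "field K K' L x y i = (if i < K then fld K L x i else fld K' L y (i - K))"

lemma run_cong: "(\<And>t. t < L \<Longrightarrow> f t = f' t \<and> g t = g' t) \<Longrightarrow> run \<delta> f g L = run \<delta> f' g' L"
  by (induction L) auto

lemma results_field:
  "i < K + K' \<Longrightarrow> j < K + K' \<Longrightarrow> results K K' x y L (\<delta>, i, j) =
     run \<delta> (bit (field K K' L x y i)) (bit (field K K' L x y j)) L"
  by (auto simp: results_def field_def stream_def bit_fld intro!: run_cong)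

lemma scannable_run:
  assumes "i < K + K'" "j < K + K'"
  shows "scannable K K' (\<lambda>L x y b.
    run \<delta> (bit (field K K' L x y i)) (bit (field K K' L x y j)) L = q)"
  unfolding scannable_def
  by (intro exI[of _ "\<lambda>\<rho> b. \<rho> (\<delta>, i, j) = q"]) (simp add: results_field[OF assms])

lemma field_less: "field K K' L x y i < 2 ^ L"
  by (simp add: field_def fld_less)

lemma scannable_eq:
  assumes "i < K + K'" "j < K + K'"
  shows "scannable K K' (\<lambda>L x y b. field K K' L x y i = field K K' L x y j)"
proof -
  define \<delta> :: trans where "\<delta> = (\<lambda>s a b. if a = b then s else Some False)"
  have *: "run \<delta> f g t = None \<longleftrightarrow> (\<forall>u<t. f u = g u)" for f g t
    by (induction t) (auto simp: \<delta>_def less_Suc_eq)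
  have "run \<delta> (bit (field K K' L x y i)) (bit (field K K' L x y j)) L = None
    \<longleftrightarrow> field K K' L x y i = field K K' L x y j" for L x y
    unfolding * using eq_if_bits[OF field_less field_less] by metis
  then show ?thesis using scannable_run[OF assms, of \<delta> None] by simp
qed

lemma of_bool_less: "0 < L \<Longrightarrow> of_bool b < (2 :: nat) ^ L"
  using one_less_power[of "2 :: nat" L] by (cases b) auto

lemma scannable_of_bool:
  assumes "i < K + K'"
  shows "scannable K K' (\<lambda>L x y b. field K K' L x y i = of_bool c)"
proof -
  \<comment> \<open>The first bit has to be \<open>c\<close>, and every later bit 0.\<close>
  define \<delta> :: trans where "\<delta> = (\<lambda>s a b. case s of None \<Rightarrow> Some (a = c) | Some d \<Rightarrow> Some (d \<and> \<not> a))"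
  have "run \<delta> f g (Suc t) = Some (\<forall>u<Suc t. f u = (u = 0 \<and> c))" for f g t
  proof (induction t)
    case 0
    show ?case by (simp add: \<delta>_def)
  next
    case (Suc t)
    have "run \<delta> f g (Suc (Suc t)) = Some ((\<forall>u<Suc t. f u = (u = 0 \<and> c)) \<and> \<not> f (Suc t))"
      using Suc by (simp add: \<delta>_def)
    then show ?case by (simp only: All_less_Suc[of "Suc t"] option.inject) auto
  qed
  then have *: "run \<delta> f g (Suc t) = Some True \<longleftrightarrow> (\<forall>u<Suc t. f u = (u = 0 \<and> c))" for f g t
    by simp
  have "run \<delta> (bit (field K K' L x y i)) (bit (field K K' L x y i)) L = Some True
    \<longleftrightarrow> field K K' L x y i = of_bool c" if "0 < L" for L x y
  proof -
    obtain t where L: "L = Suc t" using \<open>0 < L\<close> gr0_implies_Suc by blast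
    have "of_bool c < (2 :: nat) ^ L" using \<open>0 < L\<close> by (rule of_bool_less)
    moreover have "bit (of_bool c :: nat) u = (u = 0 \<and> c)" for u by (cases c) (auto simp: bit_Suc_0_iff)
    ultimately show ?thesis
      unfolding L * using eq_if_bits[OF field_less, of "of_bool c" L] L by metis
  qed
  then show ?thesis using scannable_run[OF assms assms, of \<delta> "Some True"]
    unfolding scannable_def by simp
qed

section \<open>Circuits of formulas\<close>

text \<open>A subformula that occurs several times marks all its positions, so a code depends on the
  formula and not on the occurrence.\<close>

definition forces :: "nat \<Rightarrow> nat \<Rightarrow> nat \<Rightarrow> form \<Rightarrow> form \<Rightarrow> nat \<Rightarrow> bool" where
  "forces r K L \<phi> \<chi> x \<longleftrightarrow> (\<forall>c < length (subforms \<phi>). fld K L x (r + c) = of_bool (subforms \<phi> ! c = \<chi>))"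

lemma card_less_complement:
  "card {v. v < U \<and> P v} + card {v. v < U \<and> \<not> P v} = (U :: nat)"
proof -
  have "card ({v. v < U \<and> P v} \<union> {v. v < U \<and> \<not> P v}) = card {v. v < U \<and> P v} + card {v. v < U \<and> \<not> P v}"
    by (rule card_Un_disjoint) auto
  moreover have "{v. v < U \<and> P v} \<union> {v. v < U \<and> \<not> P v} = {..<U}" by auto
  ultimately show ?thesis by simp
qed

lemma card_filter_majority:
  fixes f :: "'a \<Rightarrow> nat \<Rightarrow> 'b" and U :: nat
  assumes inj: "inj_on (\<lambda>(\<chi>, v). f \<chi> v) ({a, b} \<times> {..<U})"
    and V: "\<And>\<chi> v. \<chi> \<in> {a, b} \<Longrightarrow> v < U \<Longrightarrow> V (f \<chi> v) = P \<chi> v"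
  defines "A \<equiv> (\<lambda>(\<chi>, v). f \<chi> v) ` ({a, b} \<times> {..<U})"
  shows "card {h \<in> A. V h} > card {h \<in> A. \<not> V h} \<longleftrightarrow>
    card {v. v < U \<and> P a v} + card {v. v < U \<and> P b v} > U"
proof -
  have card: "card {h \<in> A. V h \<longleftrightarrow> t} = (\<Sum>\<chi>\<in>{a, b}. card {v. v < U \<and> (P \<chi> v \<longleftrightarrow> t)})" for t
  proof -
    have "{h \<in> A. V h \<longleftrightarrow> t} = (\<lambda>(\<chi>, v). f \<chi> v) ` (SIGMA \<chi>:{a, b}. {v. v < U \<and> (P \<chi> v \<longleftrightarrow> t)})"
      using V by (fastforce simp: A_def)
    moreover have "inj_on (\<lambda>(\<chi>, v). f \<chi> v) (SIGMA \<chi>:{a, b}. {v. v < U \<and> (P \<chi> v \<longleftrightarrow> t)})"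
      by (rule inj_on_subset[OF inj]) auto
    ultimately have "card {h \<in> A. V h \<longleftrightarrow> t} = card (SIGMA \<chi>:{a, b}. {v. v < U \<and> (P \<chi> v \<longleftrightarrow> t)})"
      by (simp add: card_image)
    then show ?thesis by (subst (asm) card_SigmaI) auto
  qed
  \<comment> \<open>For \<open>a = b\<close> the inputs form a single family of \<open>U\<close>
    gates; its strict majority is the same condition with the count taken twice.\<close>
  show ?thesis
    using card[of True] card[of False] card_less_complement[of U "P a"] card_less_complement[of U "P b"] by (cases "a = b") auto
qed

locale formula_circuit =
  fixes \<phi> :: form and r m :: nat
  assumes r: "0 < r" and m: "0 < m" and indices: "indices_below r \<phi>"
begin

definition "K = r + length (subforms \<phi>)"

text \<open>The number of marks on the ruler: \<open>m\<close> for each of the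
  \<open>lg n + 1\<close> probes.\<close>

definition "len n = m * (lg n + 1)"

lemma len_pos: "0 < len n"
  using m by (simp add: len_def)

lemma K_pos: "0 < K"
  using r by (simp add: K_def)

text \<open>A gate stands for a subformula and an assignment. Its name interleaves \<open>r\<close> fields for the
  values of the variables with a one-hot code of the subformula.\<close>

definition gate_for :: "nat \<Rightarrow> nat \<Rightarrow> form \<Rightarrow> bool" where
  "gate_for L x \<chi> \<longleftrightarrow> x < 2 ^ (K * L) \<and> \<chi> \<in> set (subforms \<phi>) \<and> forces r K L \<phi> \<chi> x"

lemma gate_for_unique: "gate_for L x \<chi> \<Longrightarrow> gate_for L x \<chi>' \<Longrightarrow> \<chi> = \<chi>'"
proof -
  assume a: "gate_for L x \<chi>" "gate_for L x \<chi>'"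
  then obtain c where c: "c < length (subforms \<phi>)" "subforms \<phi> ! c = \<chi>"
    unfolding gate_for_def in_set_conv_nth by blast
  have "fld K L x (r + c) = of_bool (subforms \<phi> ! c = \<chi>)"
    using a(1) c(1) unfolding gate_for_def forces_def by blast
  moreover have "fld K L x (r + c) = of_bool (subforms \<phi> ! c = \<chi>')"
    using a(2) c(1) unfolding gate_for_def forces_def by blast
  ultimately show "\<chi> = \<chi>'" using c(2) by (metis of_bool_eq_iff)
qed

definition form_of :: "nat \<Rightarrow> nat \<Rightarrow> form option" where
  "form_of L x = (if \<exists>\<chi>. gate_for L x \<chi> then Some (THE \<chi>. gate_for L x \<chi>) else None)"

lemma form_of_eq: "form_of L x = Some \<chi> \<longleftrightarrow> gate_for L x \<chi>"
  using gate_for_unique by (auto simp: form_of_def intro: theI the_equality)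

text \<open>The default 0 keeps all values below \<open>2 ^ L\<close>, so \<open>env\<close> is an
  assignment over the universe at every index.\<close>

definition env :: "nat \<Rightarrow> nat \<Rightarrow> nat \<Rightarrow> nat" where
  "env L x s = (if s < r then fld K L x s else 0)"

definition gate :: "nat \<Rightarrow> form \<Rightarrow> (nat \<Rightarrow> nat) \<Rightarrow> nat" where
  "gate L \<chi> e = pack K L (\<lambda>s. if s < r then e s else of_bool (subforms \<phi> ! (s - r) = \<chi>))"

lemma fld_gate:
  assumes "0 < L" "\<And>s. s < r \<Longrightarrow> e s < 2 ^ L"
  shows "s < r \<Longrightarrow> fld K L (gate L \<chi> e) s = e s"
    "s < length (subforms \<phi>) \<Longrightarrow> fld K L (gate L \<chi> e) (r + s) = of_bool (subforms \<phi> ! s = \<chi>)"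
  unfolding gate_def using assms of_bool_less[OF assms(1)]
  by (subst fld_pack; simp add: K_def)+

lemma gate_for_gate:
  assumes "0 < L" "\<And>s. s < r \<Longrightarrow> e s < 2 ^ L" "\<chi> \<in> set (subforms \<phi>)"
  shows "gate_for L (gate L \<chi> e) \<chi>"
  using assms fld_gate(2)[OF assms(1,2)] pack_less
  by (auto simp: gate_for_def forces_def gate_def)

text \<open>Names are canonical. This converts conditions on single fields, which an automaton can
  check, into explicit sets of predecessors.\<close>

lemma eq_gate_iff:
  assumes "0 < L" "\<And>s. s < r \<Longrightarrow> e s < 2 ^ L" "\<chi> \<in> set (subforms \<phi>)"
  shows "h = gate L \<chi> e \<longleftrightarrow> gate_for L h \<chi> \<and> (\<forall>s<r. fld K L h s = e s)"
proof
  assume h: "gate_for L h \<chi> \<and> (\<forall>s<r. fld K L h s = e s)"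
  show "h = gate L \<chi> e"
  proof (rule fld_inject)
    show "h < 2 ^ (K * L)" using h by (simp add: gate_for_def)
    show "gate L \<chi> e < 2 ^ (K * L)" by (simp add: gate_def pack_less)
    fix s assume s: "s < K"
    show "fld K L h s = fld K L (gate L \<chi> e) s"
    proof (cases "s < r")
      case True
      then show ?thesis using h fld_gate(1)[OF assms(1,2)] by simp
    next
      case False
      then obtain c where "s = r + c" "c < length (subforms \<phi>)"
        using s by (metis K_def le_Suc_ex nat_add_left_cancel_less not_less)
      then show ?thesis using h fld_gate(2)[OF assms(1,2)]
        by (simp add: gate_for_def forces_def)
    qed
  qed
qed (use gate_for_gate[OF assms] fld_gate(1)[OF assms(1,2)] in auto)

text \<open>The truth value of an atom is settled in its label: and- and or-gates without inputs are
  the constants, and the uniformity machine can compute the atom by the same scan.\<close>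

fun kind :: "nat \<Rightarrow> nat \<Rightarrow> nat \<Rightarrow> form \<Rightarrow> gate" where
  "kind n L x (Atom \<delta> i j) =
     (if run \<delta> (bit (fld K L x i)) (bit (fld K L x j)) L = Some True then And_gate else Or_gate)"
| "kind n L x Inp = (if fld K L x 0 < n then Input (fld K L x 0) else Or_gate)"
| "kind n L x Rng = (if fld K L x 0 < n then And_gate else Or_gate)"
| "kind n L x (Neg _) = Not_gate"
| "kind n L x (Conj _ _) = And_gate"
| "kind n L x (Maj _ _) = Maj_gate"

text \<open>The child of a majority gate has a fresh variable with index 0, which shifts the others.\<close>

fun compatible :: "nat \<Rightarrow> form \<Rightarrow> nat \<Rightarrow> nat \<Rightarrow> bool" where
  "compatible L (Maj _ _) h g \<longleftrightarrow> (\<forall>s<r - 1. fld K L h (Suc s) = fld K L g s)"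
| "compatible L _ h g \<longleftrightarrow> (\<forall>s<r. fld K L h s = fld K L g s)"

definition circ :: "nat \<Rightarrow> circuit" where
  "circ n = \<lparr>label = (\<lambda>x. map_option (kind n (len n) x) (form_of (len n) x)),
     wires = {(h, g). \<exists>\<psi> \<chi>. gate_for (len n) g \<psi> \<and> gate_for (len n) h \<chi> \<and> \<chi> \<in> kids \<psi> \<and>
       compatible (len n) \<psi> h g},
     outputs = map (\<lambda>j. gate (len n) \<phi> (\<lambda>s. if s = 0 then j else 0)) [0..<2 ^ len n]\<rparr>"

lemma gate_for_fact: "gate_for L x \<chi> \<Longrightarrow> \<chi> \<in> set (subforms \<phi>)"
  by (simp add: gate_for_def)

lemma label_eq: "label (circ n) x = Some t \<longleftrightarrow>
    (\<exists>\<psi>. gate_for (len n) x \<psi> \<and> kind n (len n) x \<psi> = t)"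
  by (auto simp: circ_def form_of_eq)

lemma label_gate: "gate_for (len n) x \<psi> \<Longrightarrow> label (circ n) x = Some (kind n (len n) x \<psi>)"
  by (auto simp: label_eq)

lemma env_less: "env L x s < 2 ^ L"
  by (simp add: env_def fld_less)

lemma preds_circ:
  assumes "gate_for (len n) g \<psi>"
  shows "preds (circ n) g =
    (case \<psi> of Maj \<chi> \<chi>' \<Rightarrow> (\<lambda>(\<chi>, v). gate (len n) \<chi> (case_nat v (env (len n) g))) ` ({\<chi>, \<chi>'} \<times> {..<2 ^ len n})
     | _ \<Rightarrow> (\<lambda>\<chi>. gate (len n) \<chi> (env (len n) g)) ` kids \<psi>)"
proof -
  have preds: "preds (circ n) g = {h. \<exists>\<chi>. gate_for (len n) h \<chi> \<and> \<chi> \<in> kids \<psi> \<and> compatible (len n) \<psi> h g}"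
  proof -
    have "(h, g) \<in> wires (circ n) \<longleftrightarrow>
        (\<exists>\<chi>. gate_for (len n) h \<chi> \<and> \<chi> \<in> kids \<psi> \<and> compatible (len n) \<psi> h g)" for h
    proof
      assume "(h, g) \<in> wires (circ n)"
      then obtain \<psi>' \<chi> where "gate_for (len n) g \<psi>'" "gate_for (len n) h \<chi>" "\<chi> \<in> kids \<psi>'"
        "compatible (len n) \<psi>' h g" by (auto simp: circ_def)
      then show "\<exists>\<chi>. gate_for (len n) h \<chi> \<and> \<chi> \<in> kids \<psi> \<and> compatible (len n) \<psi> h g"
        using gate_for_unique[OF assms] by blast
    next
      assume "\<exists>\<chi>. gate_for (len n) h \<chi> \<and> \<chi> \<in> kids \<psi> \<and> compatible (len n) \<psi> h g"
      then show "(h, g) \<in> wires (circ n)" using assms by (auto simp: circ_def)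
    qed
    then show ?thesis by (simp add: preds_def)
  qed
  have sub: "\<chi> \<in> set (subforms \<phi>)" if "\<chi> \<in> kids \<psi>" for \<chi>
    using kids_subforms[OF gate_for_fact[OF assms] that] .
  have plain: "h = gate (len n) \<chi> (env (len n) g) \<longleftrightarrow>
      gate_for (len n) h \<chi> \<and> (\<forall>s<r. fld K (len n) h s = fld K (len n) g s)"
    if "\<chi> \<in> kids \<psi>" for h \<chi>
    using eq_gate_iff[where e = "env (len n) g", OF len_pos env_less sub[OF that]] by (simp add: env_def)
  show ?thesis
  proof (cases \<psi>)
    case (Maj \<chi>1 \<chi>2)
    have eq: "gate_for (len n) h \<chi> \<and> compatible (len n) \<psi> h g \<longleftrightarrow>
        (\<exists>v<2 ^ len n. h = gate (len n) \<chi> (case_nat v (env (len n) g)))" if "\<chi> \<in> kids \<psi>" for h \<chi>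
    proof -
      have 1: "h = gate (len n) \<chi> (case_nat v (env (len n) g)) \<longleftrightarrow>
        gate_for (len n) h \<chi> \<and> (\<forall>s<r. fld K (len n) h s = case_nat v (env (len n) g) s)"
        if "v < 2 ^ len n" for v
        by (rule eq_gate_iff[OF len_pos _ sub[OF \<open>\<chi> \<in> kids \<psi>\<close>]])
          (use that env_less in \<open>auto split: nat.split\<close>)
      have "(\<forall>s<r. P s) \<longleftrightarrow> P 0 \<and> (\<forall>s<r - 1. P (Suc s))" for P
        using r All_less_Suc2[of "r - 1" P] by simp
      then have 2: "(\<forall>s<r. fld K (len n) h s = case_nat v (env (len n) g) s) \<longleftrightarrow>
        fld K (len n) h 0 = v \<and> compatible (len n) \<psi> h g" for v
      proof -
        have "env (len n) g s = fld K (len n) g s" if "s < r - 1" for s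
        proof -
          have "s < r" using that by linarith
          then show ?thesis by (simp add: env_def)
        qed
        then show ?thesis using Maj \<open>\<And>P. (\<forall>s<r. P s) \<longleftrightarrow> P 0 \<and> (\<forall>s<r - 1. P (Suc s))\<close> by simp
      qed
      show ?thesis
      proof
        assume "gate_for (len n) h \<chi> \<and> compatible (len n) \<psi> h g"
        \<comment> \<open>The value of the bound variable is read off field 0 of the child.\<close>
        then have "h = gate (len n) \<chi> (case_nat (fld K (len n) h 0) (env (len n) g))"
          unfolding 1[OF fld_less] 2 by simp
        then show "\<exists>v<2 ^ len n. h = gate (len n) \<chi> (case_nat v (env (len n) g))"
          using fld_less by blast
      next
        assume "\<exists>v<2 ^ len n. h = gate (len n) \<chi> (case_nat v (env (len n) g))"
        then show "gate_for (len n) h \<chi> \<and> compatible (len n) \<psi> h g" using 1 2 by blast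
      qed
    qed
    have "preds (circ n) g = {h. \<exists>\<chi>\<in>kids \<psi>. \<exists>v<2 ^ len n.
        h = gate (len n) \<chi> (case_nat v (env (len n) g))}"
      unfolding preds using eq by blast
    then show ?thesis using Maj by auto 
  qed (use plain in \<open>auto simp: preds\<close>)
qed

definition val :: "bool list \<Rightarrow> nat \<Rightarrow> bool" where
  "val w x = (case form_of (len (length w)) x of None \<Rightarrow> False
     | Some \<psi> \<Rightarrow> eval \<psi> w (len (length w)) (env (len (length w)) x))"

lemma val_gate:
  assumes "\<chi> \<in> set (subforms \<phi>)" "\<And>s. s < r \<Longrightarrow> e s < 2 ^ len (length w)"
  shows "val w (gate (len (length w)) \<chi> e) = eval \<chi> w (len (length w)) e"
proof -
  have "gate_for (len (length w)) (gate (len (length w)) \<chi> e) \<chi>"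
    by (rule gate_for_gate[OF len_pos assms(2,1)])
  then have "val w (gate (len (length w)) \<chi> e) =
      eval \<chi> w (len (length w)) (env (len (length w)) (gate (len (length w)) \<chi> e))"
    by (simp add: val_def form_of_eq[THEN iffD2])
  also have "\<dots> = eval \<chi> w (len (length w)) e"
    by (rule eval_cong[OF indices_below_subforms[OF indices assms(1)]])
      (use fld_gate(1)[OF len_pos assms(2)] in \<open>simp add: env_def\<close>)
  finally show ?thesis .
qed

lemma gate_inject:
  assumes "gate L \<chi> e = gate L \<chi>' e'" "0 < L" "\<chi> \<in> set (subforms \<phi>)" "\<chi>' \<in> set (subforms \<phi>)"
    "\<And>s. s < r \<Longrightarrow> e s < 2 ^ L" "\<And>s. s < r \<Longrightarrow> e' s < 2 ^ L"
  shows "\<chi> = \<chi>' \<and> (\<forall>s<r. e s = e' s)"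
proof
  have "gate_for L (gate L \<chi> e) \<chi>" "gate_for L (gate L \<chi>' e') \<chi>'"
    using assms by (intro gate_for_gate; simp)+
  then show "\<chi> = \<chi>'" using assms(1) gate_for_unique by metis
  have "fld K L (gate L \<chi> e) s = e s" "fld K L (gate L \<chi>' e') s = e' s" if "s < r" for s
    using assms that by (intro fld_gate(1); simp)+
  then show "\<forall>s<r. e s = e' s" using assms(1) by metis
qed

lemma valuation_val: "valuation (circ (length w)) w (val w)"
  unfolding valuation_def
proof
  fix x
  let ?n = "length w"
  let ?L = "len ?n"
  show "val w x = gate_value (circ ?n) w (val w) x"
  proof (cases "form_of ?L x")
    case None
    then show ?thesis by (simp add: val_def gate_value_def circ_def)
  next
    case (Some \<psi>)
    then have g: "gate_for ?L x \<psi>" by (simp add: form_of_eq)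
    have ind: "indices_below r \<psi>"
      by (rule indices_below_subforms[OF indices gate_for_fact[OF g]])
    have v: "val w x = eval \<psi> w ?L (env ?L x)" by (simp add: val_def Some)
    have sub: "\<chi> \<in> set (subforms \<phi>)" if "\<chi> \<in> kids \<psi>" for \<chi>
      using kids_subforms[OF gate_for_fact[OF g] that] .
    have kid: "val w (gate ?L \<chi> (env ?L x)) = eval \<chi> w ?L (env ?L x)" if "\<chi> \<in> kids \<psi>" for \<chi>
      by (rule val_gate[OF sub[OF that]]) (rule env_less)
    note gv = gate_value_def label_gate[OF g] preds_circ[OF g]
    show ?thesis
    proof (cases \<psi>)
      case (Atom \<delta> i j)
      then show ?thesis using ind by (simp add: v gv env_def)
    next
      case Inp
      then show ?thesis using r by (simp add: v gv env_def)
    next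
      case Rng
      then show ?thesis using r by (simp add: v gv env_def)
    next
      case (Neg \<chi>)
      then show ?thesis using kid by (simp add: v gv)
    next
      case (Conj \<chi>1 \<chi>2)
      then show ?thesis using kid by (simp add: v gv)
    next
      case (Maj \<chi>1 \<chi>2)
      let ?f = "\<lambda>\<chi> v. gate ?L \<chi> (case_nat v (env ?L x))"
      have less: "case_nat v (env ?L x) s < 2 ^ ?L" if "v < 2 ^ ?L" for v s
        using that env_less by (auto split: nat.split)
      \<comment> \<open>Wires form a set, so a majority gate counts correctly only if different
        pairs of a child and a value name different gates.\<close>
      have inj: "inj_on (\<lambda>(\<chi>, v). ?f \<chi> v) ({\<chi>1, \<chi>2} \<times> {..<2 ^ ?L})"
      proof (rule inj_onI)
        fix p q
        assume pq: "p \<in> {\<chi>1, \<chi>2} \<times> {..<2 ^ ?L}" "q \<in> {\<chi>1, \<chi>2} \<times> {..<2 ^ ?L}"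
          "(\<lambda>(\<chi>, v). ?f \<chi> v) p = (\<lambda>(\<chi>, v). ?f \<chi> v) q"
        obtain \<chi> v \<chi>' v' where eqs: "p = (\<chi>, v)" "q = (\<chi>', v')" by fastforce
        have "\<chi> = \<chi>' \<and> (\<forall>s<r. case_nat v (env ?L x) s = case_nat v' (env ?L x) s)"
          by (rule gate_inject[OF _ len_pos]) (use pq eqs sub Maj less in auto)
        then have "\<chi> = \<chi>'" "case_nat v (env ?L x) 0 = case_nat v' (env ?L x) 0" using r by blast+
        then show "p = q" by (simp add: eqs)
      qed
      have V: "val w (?f \<chi> v) = eval \<chi> w ?L (case_nat v (env ?L x))"
        if "\<chi> \<in> {\<chi>1, \<chi>2}" "v < 2 ^ ?L" for \<chi> v
        by (rule val_gate) (use that sub Maj less in auto)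
      show ?thesis
        using card_filter_majority[where f = ?f and V = "val w", OF inj V] Maj by (simp add: v gv)
    qed
  qed
qed

lemma well_formed_circ: "well_formed n (circ n)"
proof -
  have dom: "dom (label (circ n)) = {x. \<exists>\<chi>. gate_for (len n) x \<chi>}"
    by (auto simp: label_eq dom_def)
  have "dom (label (circ n)) \<subseteq> {..<2 ^ (K * len n)}"
    unfolding dom by (auto simp: gate_for_def)
  then have fin: "finite (dom (label (circ n)))" by (rule finite_subset) simp
  have wires: "wires (circ n) \<subseteq> dom (label (circ n)) \<times> dom (label (circ n))"
    unfolding dom by (auto simp: circ_def)
  have "gate_for (len n) (gate (len n) \<phi> (\<lambda>s. if s = 0 then j else 0)) \<phi>" if "j < 2 ^ len n" for j
    by (rule gate_for_gate[OF len_pos]) (use that self_in_subforms in auto)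
  then have outputs: "set (outputs (circ n)) \<subseteq> dom (label (circ n))"
    unfolding dom by (auto simp: circ_def intro!: exI[of _ \<phi>])
  have inp: "i < n \<and> preds (circ n) g = {}" if i: "label (circ n) g = Some (Input i)" for g i
  proof -
    obtain \<psi> where g: "gate_for (len n) g \<psi>" "kind n (len n) g \<psi> = Input i"
      using i by (auto simp: label_eq)
    then have "\<psi> = Inp" by (cases \<psi>) (auto split: if_splits)
    with g show ?thesis by (auto simp: preds_circ split: if_splits)
  qed
  have nt: "card (preds (circ n) g) = 1" if i: "label (circ n) g = Some Not_gate" for g
  proof -
    obtain \<psi> where g: "gate_for (len n) g \<psi>" "kind n (len n) g \<psi> = Not_gate"
      using i by (auto simp: label_eq)
    then have "\<exists>\<chi>. \<psi> = Neg \<chi>" by (cases \<psi>) (auto split: if_splits)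
    then obtain \<chi> where "\<psi> = Neg \<chi>" by blast
    with g show ?thesis by (auto simp: preds_circ)
  qed
  show ?thesis unfolding well_formed_def using fin wires outputs inp nt by blast
qed

text \<open>Every wire leads from a formula to a strictly larger one, and formula sizes do not
  depend on the input length.\<close>

lemma depth_circ: "depth_at_most (size \<phi>) (circ n)"
proof -
  have path: "\<exists>\<chi> \<psi>. gate_for (len n) h \<chi> \<and> gate_for (len n) g \<psi> \<and> size \<chi> + Suc k \<le> size \<psi>"
    if "(h, g) \<in> wires (circ n) ^^ Suc k" for h g k
    using that
  proof (induction k arbitrary: g)
    case 0
    then show ?case using size_kids by (fastforce simp: circ_def)
  next
    case (Suc k)
    then obtain g' where g': "(h, g') \<in> wires (circ n) ^^ Suc k" "(g', g) \<in> wires (circ n)" by auto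
    obtain \<chi> \<psi> where 1: "gate_for (len n) h \<chi>" "gate_for (len n) g' \<psi>" "size \<chi> + Suc k \<le> size \<psi>"
      using Suc.IH[OF g'(1)] by blast
    obtain \<psi>' \<chi>' where 2: "gate_for (len n) g \<chi>'" "gate_for (len n) g' \<psi>'" "\<psi>' \<in> kids \<chi>'"
      using g'(2) by (auto simp: circ_def)
    have "\<psi>' = \<psi>" by (rule gate_for_unique[OF 2(2) 1(2)])
    then have "size \<psi> < size \<chi>'" using size_kids[OF 2(3)] by simp
    then show ?case using 1 2 by (intro exI[of _ \<chi>] exI[of _ \<chi>']) auto
  qed
  have "(h, g) \<notin> wires (circ n) ^^ Suc (size \<phi>)" for h g
  proof
    assume "(h, g) \<in> wires (circ n) ^^ Suc (size \<phi>)"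
    from path[OF this] obtain \<chi> \<psi> :: form where "gate_for (len n) g \<psi>" "size \<chi> + Suc (size \<phi>) \<le> size \<psi>"
      by blast
    with size_subforms[OF gate_for_fact[OF this(1)]] show False by simp
  qed
  then show ?thesis unfolding depth_at_most_def by fastforce
qed

lemma evaluates_circ:
  "evaluates_to (circ (length w)) w (map (\<lambda>j. eval \<phi> w (len (length w)) (\<lambda>s. if s = 0 then j else 0))
     [0..<2 ^ len (length w)])"
  unfolding evaluates_to_def
proof (intro exI[of _ "val w"] conjI valuation_val)
  have "val w (gate (len (length w)) \<phi> (\<lambda>s. if s = 0 then j else 0)) =
      eval \<phi> w (len (length w)) (\<lambda>s. if s = 0 then j else 0)" if "j < 2 ^ len (length w)" for j
    by (rule val_gate) (use self_in_subforms that in auto)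
  then show "map (\<lambda>j. eval \<phi> w (len (length w)) (\<lambda>s. if s = 0 then j else 0)) [0..<2 ^ len (length w)]
      = map (val w) (outputs (circ (length w)))"
    by (simp add: circ_def)
qed

section \<open>Uniformity and size of the circuits\<close>

lemma scannable_forces:
  "scannable K K' (\<lambda>L x y b. forces r K L \<phi> \<chi> x)"
  "scannable K K (\<lambda>L x y b. forces r K L \<phi> \<chi> y)"
proof -
  have "scannable K K' (\<lambda>L x y b. \<forall>c\<in>{..<length (subforms \<phi>)}.
      field K K' L x y (r + c) = of_bool (subforms \<phi> ! c = \<chi>))"
    by (intro scannable_ball scannable_of_bool) (simp add: K_def)
  then show "scannable K K' (\<lambda>L x y b. forces r K L \<phi> \<chi> x)"
    by (simp add: forces_def field_def K_def lessThan_def)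
  have "scannable K K (\<lambda>L x y b. \<forall>c\<in>{..<length (subforms \<phi>)}.
      field K K L x y (K + (r + c)) = of_bool (subforms \<phi> ! c = \<chi>))"
    by (intro scannable_ball scannable_of_bool) (simp add: K_def)
  then show "scannable K K (\<lambda>L x y b. forces r K L \<phi> \<chi> y)"
    by (simp add: forces_def field_def K_def lessThan_def)
qed

lemma decidable_if_scannable:
  assumes "scannable K K' P"
    and "\<And>n x y. (x, y) \<in> R n \<longleftrightarrow> x < 2 ^ (K * len n) \<and> (K' = 0 \<or> y < 2 ^ (K' * len n)) \<and>
      P (len n) x y (fld K (len n) x 0 < n)"
  shows "dlogtime_decidable k R"
proof -
  obtain acc where acc: "\<And>L x y b. 0 < L \<Longrightarrow> P L x y b = acc (results K K' x y L) b"
    using assms(1) unfolding scannable_def by blast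
  show ?thesis
    by (rule scan_decidable[OF m K_pos, where acc = acc])
      (use acc[OF len_pos] assms(2) in \<open>simp add: len_def\<close>)
qed

lemma decidable_wires: "dlogtime_decidable k (\<lambda>n. wires (circ n))"
proof (rule decidable_if_scannable)
  let ?P = "\<lambda>L x y b. \<exists>\<psi>\<in>set (subforms \<phi>). \<exists>\<chi>\<in>kids \<psi> \<inter> set (subforms \<phi>).
    (forces r K L \<phi> \<psi> y \<and> forces r K L \<phi> \<chi> x) \<and> compatible L \<psi> x y"
  have comp: "scannable K K (\<lambda>L x y b. compatible L \<psi> x y)" for \<psi>
  proof -
    have "scannable K K (\<lambda>L x y b. \<forall>s\<in>{..<r - 1}. field K K L x y (Suc s) = field K K L x y (K + s))"
      "scannable K K (\<lambda>L x y b. \<forall>s\<in>{..<r}. field K K L x y s = field K K L x y (K + s))"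
      by (intro scannable_ball scannable_eq; simp add: K_def)+
    moreover have "Suc s < K" if "s < r - 1" for s using that by (simp add: K_def)
    ultimately show ?thesis
      by (cases \<psi>) (simp_all add: field_def K_def lessThan_def)
  qed
  show "scannable K K ?P"
    by (intro scannable_bex scannable_conj scannable_forces comp)
  show "(x, y) \<in> wires (circ n) \<longleftrightarrow> x < 2 ^ (K * (len n)) \<and>
      (K = 0 \<or> y < 2 ^ (K * (len n))) \<and> ?P (len n) x y (fld K (len n) x 0 < n)"
    for n x y
    using K_pos by (auto simp: circ_def gate_for_def len_def)
qed

text \<open>With \<open>K' = 1\<close> the second number is taken as it stands, without
  interleaving, and compared with field 0 of the gate name while both are read in lockstep.\<close>

lemma decidable_inputs: "dlogtime_decidable k (\<lambda>n. {(g, i). label (circ n) g = Some (Input i)})"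
proof (rule decidable_if_scannable[where K' = 1])
  let ?P = "\<lambda>L x y b. (Inp \<in> set (subforms \<phi>) \<and> forces r K L \<phi> Inp x) \<and> b \<and>
    field K 1 L x y 0 = field K 1 L x y K"
  show "scannable K 1 ?P"
    by (intro scannable_conj scannable_forces scannable_flag scannable_const scannable_eq)
      (use K_pos in auto)
  show "(x, y) \<in> {(g, i). label (circ n) g = Some (Input i)} \<longleftrightarrow> x < 2 ^ (K * (len n)) \<and>
      ((1 :: nat) = 0 \<or> y < 2 ^ (1 * (len n))) \<and> ?P (len n) x y (fld K (len n) x 0 < n)"
    for n x y
  proof -
    have "label (circ n) x = Some (Input y) \<longleftrightarrow>
      gate_for (len n) x Inp \<and> fld K (len n) x 0 < n \<and> y = fld K (len n) x 0"
    proof -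
      have "kind n (len n) x \<psi> = Input y \<longleftrightarrow> \<psi> = Inp \<and> fld K (len n) x 0 < n \<and> y = fld K (len n) x 0"
        for \<psi> by (cases \<psi>) auto
      then show ?thesis by (auto simp: label_eq)
    qed
    also have "\<dots> \<longleftrightarrow> x < 2 ^ (K * len n) \<and> y < 2 ^ len n \<and> ?P (len n) x y (fld K (len n) x 0 < n)"
    proof (cases "y < 2 ^ len n")
      case True
      have "fld (Suc 0) (len n) y 0 = y" using fld_1[OF True] by simp
      then show ?thesis using K_pos True by (auto simp: gate_for_def field_def)
    next
      case False
      then show ?thesis using fld_less[of K "len n" x 0] by auto
    qed
    finally show ?thesis by (simp add: len_def)
  qed
qed

text \<open>The second component is arbitrary and may have more bits than a scan covers;
  \<open>K' = 0\<close> exempts it from the length check.\<close>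

lemma decidable_labels:
  assumes "t \<in> {And_gate, Or_gate, Not_gate, Maj_gate}"
  shows "dlogtime_decidable k (\<lambda>n. {(g, _). label (circ n) g = Some t})"
proof (rule decidable_if_scannable[where K' = 0])
  define Q where "Q L x b \<psi> = (case \<psi> of
      Atom \<delta> i j \<Rightarrow> t = (if run \<delta> (bit (fld K L x i)) (bit (fld K L x j)) L = Some True then And_gate else Or_gate)
    | Inp \<Rightarrow> t = Or_gate \<and> \<not> b
    | Rng \<Rightarrow> t = (if b then And_gate else Or_gate)
    | Neg _ \<Rightarrow> t = Not_gate | Conj _ _ \<Rightarrow> t = And_gate | Maj _ _ \<Rightarrow> t = Maj_gate)" for L x b \<psi>
  let ?P = "\<lambda>L x y b. \<exists>\<psi>\<in>set (subforms \<phi>). forces r K L \<phi> \<psi> x \<and> Q L x b \<psi>"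
  have Q: "scannable K 0 (\<lambda>L x y b. Q L x b \<psi>)" if sub: "\<psi> \<in> set (subforms \<phi>)" for \<psi>
  proof (cases \<psi>)
    case (Atom \<delta> i j)
    then have ij: "i < K" "j < K"
      using indices_below_subforms[OF indices sub] by (auto simp: K_def)
    have "scannable K 0 (\<lambda>L x y b. run \<delta> (bit (field K 0 L x y i)) (bit (field K 0 L x y j)) L = Some True)"
      by (rule scannable_run) (use ij in auto)
    then have s: "scannable K 0 (\<lambda>L x y b. run \<delta> (bit (fld K L x i)) (bit (fld K L x j)) L = Some True)"
      using ij by (simp add: field_def)
    show ?thesis
    proof (cases "t = And_gate")
      case True
      then have "Q L x b \<psi> = (run \<delta> (bit (fld K L x i)) (bit (fld K L x j)) L = Some True)" for L x b
        using Atom by (auto simp: Q_def)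
      then show ?thesis using s by simp
    next
      case False
      then have "Q L x b \<psi> = (t = Or_gate \<and>
          \<not> run \<delta> (bit (fld K L x i)) (bit (fld K L x j)) L = Some True)" for L x b
        using Atom by (auto simp: Q_def)
      then show ?thesis using scannable_conj[OF scannable_const scannable_not[OF s]] by simp
    qed
  next
    case Rng
    have "Q L x b \<psi> = ((t = And_gate \<and> b) \<or> (t = Or_gate \<and> \<not> b))" for L x b
      using Rng by (auto simp: Q_def)
    then have "Q L x b \<psi> = (\<not> (\<not> (t = And_gate \<and> b) \<and> \<not> (t = Or_gate \<and> \<not> b)))" for L x b by simp
    moreover have "scannable K 0 (\<lambda>L x y b. (\<not> (\<not> (t = And_gate \<and> b) \<and> \<not> (t = Or_gate \<and> \<not> b))))"
      by (intro scannable_not scannable_conj scannable_const scannable_flag)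
    ultimately show ?thesis by simp
  next
    case Inp
    have "scannable K 0 (\<lambda>L x y b. t = Or_gate \<and> \<not> b)"
      by (intro scannable_not scannable_conj scannable_const scannable_flag)
    then show ?thesis using Inp by (simp add: Q_def)
  qed (simp_all add: Q_def scannable_const)
  show "scannable K 0 ?P"
    by (intro scannable_bex scannable_conj scannable_forces Q)
  show "(x, y) \<in> {(g, _). label (circ n) g = Some t} \<longleftrightarrow> x < 2 ^ (K * (len n)) \<and>
      (0 = 0 \<or> y < 2 ^ (0 * (len n))) \<and> ?P (len n) x y (fld K (len n) x 0 < n)"
    for n x y :: nat
  proof -
    have "kind n (len n) x \<psi> = t \<longleftrightarrow> Q (len n) x (fld K (len n) x 0 < n) \<psi>" for \<psi>
      using assms by (cases \<psi>) (auto simp: Q_def)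
    then show ?thesis
      by (auto simp: label_eq gate_for_def len_def)
  qed
qed

lemma decidable_outputs:
  "dlogtime_decidable k (\<lambda>n. {(g, j). j < length (outputs (circ n)) \<and> outputs (circ n) ! j = g})"
proof (rule decidable_if_scannable[where K' = 1])
  let ?P = "\<lambda>L x y b. forces r K L \<phi> \<phi> x \<and> field K 1 L x y 0 = field K 1 L x y K \<and>
    (\<forall>s\<in>{1..<r}. field K 1 L x y s = of_bool False)"
  show "scannable K 1 ?P"
    by (intro scannable_conj scannable_forces scannable_flag scannable_ball scannable_eq scannable_of_bool)
      (use K_pos in \<open>auto simp: K_def\<close>)
  show "(x, y) \<in> {(g, j). j < length (outputs (circ n)) \<and> outputs (circ n) ! j = g} \<longleftrightarrow>
      x < 2 ^ (K * (len n)) \<and>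
      ((1 :: nat) = 0 \<or> y < 2 ^ (1 * (len n))) \<and> ?P (len n) x y (fld K (len n) x 0 < n)"
    for n x y
  proof (cases "y < 2 ^ len n")
    case True
    have "(x, y) \<in> {(g, j). j < length (outputs (circ n)) \<and> outputs (circ n) ! j = g} \<longleftrightarrow>
      x = gate (len n) \<phi> (\<lambda>s. if s = 0 then y else 0)"
      using True by (auto simp: circ_def cong: if_cong)
    also have "\<dots> \<longleftrightarrow> gate_for (len n) x \<phi> \<and> (\<forall>s<r. fld K (len n) x s = (if s = 0 then y else 0))"
      by (rule eq_gate_iff[OF len_pos]) (use True self_in_subforms in auto)
    also have "(\<forall>s<r. fld K (len n) x s = (if s = 0 then y else 0)) \<longleftrightarrow>
        fld K (len n) x 0 = y \<and> (\<forall>s\<in>{1..<r}. fld K (len n) x s = 0)"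
      using r by force
    also have "\<dots> \<longleftrightarrow> field K 1 (len n) x y 0 = field K 1 (len n) x y K \<and>
      (\<forall>s\<in>{1..<r}. field K 1 (len n) x y s = of_bool False)"
      using K_pos fld_1[OF True] by (simp add: field_def K_def)
    finally show ?thesis
      using True self_in_subforms[of \<phi>] by (simp add: gate_for_def len_def)
  qed (simp add: circ_def len_def)
qed

text \<open>The left side is \<open>(2 ^ (lg n + 1)) ^ (K * m)\<close>. For \<open>n \<ge> 2\<close>
  its base is at most \<open>4 * n \<le> n ^ 3\<close>, which gives the exponent
  \<open>3 * (K * m)\<close>; for \<open>n \<le> 1\<close> the value is the constant
  \<open>2 ^ (K * m)\<close>, absorbed by the added constant.\<close>

lemma power_len_bound: "2 ^ (K * len n) \<le> n ^ (2 ^ (K * m) + 3 * (K * m)) + (2 ^ (K * m) + 3 * (K * m))"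
proof (cases "n \<le> 1")
  case True
  then have "lg n = 0" using lg_le[of n 0] by simp
  then show ?thesis by (simp add: len_def)
next
  case False
  then have n: "2 \<le> n" by simp
  have "0 < lg n"
    using n le_power_lg[of n] by (intro gr0I) simp
  then have "2 ^ (lg n - 1) < n" by (intro power_lt_of_lt_lg) simp
  moreover have "(2 :: nat) ^ lg n = 2 * 2 ^ (lg n - 1)" using \<open>0 < lg n\<close> by (cases "lg n") auto
  ultimately have "2 ^ lg n \<le> 2 * n" by linarith
  then have "2 ^ (lg n + 1) \<le> 4 * n" by simp
  also have "\<dots> \<le> n ^ 3"
    using mult_le_mono[OF mult_le_mono[OF n n] order.refl, of n] by (simp add: power3_eq_cube)
  finally have "(2 ^ (lg n + 1)) ^ (K * m) \<le> (n ^ 3) ^ (K * m)" by (rule power_mono) simp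
  also have "\<dots> \<le> n ^ (2 ^ (K * m) + 3 * (K * m))"
    unfolding power_mult[symmetric] using n by (intro power_increasing) auto
  finally have "(2 ^ (lg n + 1)) ^ (K * m) \<le> n ^ (2 ^ (K * m) + 3 * (K * m))" .
  moreover have "(2 ^ (lg n + 1)) ^ (K * m) = (2 :: nat) ^ (K * len n)"
    unfolding power_mult[symmetric] len_def by (simp add: algebra_simps)
  ultimately show ?thesis by simp
qed

lemma in_TC0:
  "(\<lambda>w. map (\<lambda>j. eval \<phi> w (len (length w)) (\<lambda>s. if s = 0 then j else 0)) [0..<2 ^ len (length w)]) \<in> TC0"
proof -
  let ?k = "2 ^ (K * m) + 3 * (K * m)"
  have dom: "dom (label (circ n)) \<subseteq> {..<n ^ ?k + ?k}" for n
  proof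
    fix x assume "x \<in> dom (label (circ n))"
    then have "x < 2 ^ (K * len n)" by (auto simp: label_eq gate_for_def dom_def)
    then show "x \<in> {..<n ^ ?k + ?k}" using power_len_bound[of n] by simp
  qed
  have out: "length (outputs (circ n)) \<le> n ^ ?k + ?k" for n
  proof -
    have "(2 :: nat) ^ len n \<le> 2 ^ (K * len n)" using K_pos by (intro power_increasing) auto
    then show ?thesis using order.trans[OF _ power_len_bound[of n]] by (simp add: circ_def)
  qed
  have k: "1 \<le> ?k"
    using one_le_power[of "2 :: nat" "K * m"] by linarith
  have "dlogtime_uniform ?k circ"
    unfolding dlogtime_uniform_def
    using decidable_wires decidable_inputs decidable_labels decidable_outputs by blast
  then show ?thesis
    unfolding TC0_def mem_Collect_eq
    using well_formed_circ depth_circ dom out evaluates_circ k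
    by (rule_tac x = circ in exI, rule_tac x = "size \<phi>" in exI, rule_tac x = ?k in exI) blast
qed

end

section \<open>Definable relations\<close>

text \<open>It implies \<open>(2 * length w) ^ 8 \<le> 2 ^ L\<close>, which leaves room for the
  output positions, of order \<open>length w ^ 5\<close>, and for the products formed on the
  way.\<close>

definition large :: "bool list \<Rightarrow> nat \<Rightarrow> bool" where
  "large w L \<longleftrightarrow> 8 * (lg (length w) + 1) \<le> L"

text \<open>The relations are expected to be correct only on universes \<open>{..<2 ^ L}\<close> of a
  sufficiently large polynomial size.\<close>

definition definable :: "(bool list \<Rightarrow> nat \<Rightarrow> (nat \<Rightarrow> nat) \<Rightarrow> bool) \<Rightarrow> bool" where
  "definable P \<longleftrightarrow> (\<exists>\<phi>. \<forall>w L e. large w L \<and> (\<forall>i. e i < 2 ^ L) \<longrightarrow> eval \<phi> w L e = P w L e)"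

lemma definable_cong:
  assumes "definable Q"
    and "\<And>w L e. large w L \<Longrightarrow> (\<And>i. e i < 2 ^ L) \<Longrightarrow> P w L e = Q w L e"
  shows "definable P"
  using assms unfolding definable_def by metis

lemma definable_not: "definable P \<Longrightarrow> definable (\<lambda>w L e. \<not> P w L e)"
  unfolding definable_def by (elim exE, rule_tac x = "Neg \<phi>" in exI) simp

lemma definable_conj:
  "definable P \<Longrightarrow> definable Q \<Longrightarrow> definable (\<lambda>w L e. P w L e \<and> Q w L e)"
  unfolding definable_def by (elim exE, rule_tac x = "Conj \<phi> \<phi>'" in exI) simp

lemma definable_disj:
  "definable P \<Longrightarrow> definable Q \<Longrightarrow> definable (\<lambda>w L e. P w L e \<or> Q w L e)"
  using definable_not[OF definable_conj[OF definable_not definable_not], of P Q] by simp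

lemma definable_imp:
  assumes "definable P" "definable Q"
  shows "definable (\<lambda>w L e. P w L e \<longrightarrow> Q w L e)"
  by (rule definable_cong[OF definable_disj[OF definable_not[OF assms(1)] assms(2)]]) blast

lemma definable_iff:
  "definable P \<Longrightarrow> definable Q \<Longrightarrow> definable (\<lambda>w L e. P w L e \<longleftrightarrow> Q w L e)"
  using definable_conj[OF definable_imp[of P Q] definable_imp[of Q P]]
  by (simp add: iff_conv_conj_imp)

lemma definable_if:
  "definable C \<Longrightarrow> definable P \<Longrightarrow> definable Q \<Longrightarrow>
    definable (\<lambda>w L e. if C w L e then P w L e else Q w L e)"
  using definable_conj[OF definable_imp[of C P] definable_imp[OF definable_not, of C Q]]
  by (simp add: if_bool_eq_conj)

text \<open>The shape of the premises performs the de Bruijn shift. Relations written with named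
  bound variables can then be shown definable by resolution alone.\<close>

lemma definable_majority:
  assumes "definable (\<lambda>w L e. P w L (e 0) (\<lambda>i. e (Suc i)))"
    and "definable (\<lambda>w L e. Q w L (e 0) (\<lambda>i. e (Suc i)))"
  shows "definable (\<lambda>w L e.
    card {v. v < 2 ^ L \<and> P w L v e} + card {v. v < 2 ^ L \<and> Q w L v e} > 2 ^ L)"
proof -
  obtain \<phi> \<psi> where
    \<phi>: "\<And>w L e. large w L \<Longrightarrow> (\<forall>i. e i < 2 ^ L) \<Longrightarrow> eval \<phi> w L e = P w L (e 0) (\<lambda>i. e (Suc i))" and
    \<psi>: "\<And>w L e. large w L \<Longrightarrow> (\<forall>i. e i < 2 ^ L) \<Longrightarrow> eval \<psi> w L e = Q w L (e 0) (\<lambda>i. e (Suc i))"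
    using assms unfolding definable_def by metis
  have "eval (Maj \<phi> \<psi>) w L e =
      (card {v. v < 2 ^ L \<and> P w L v e} + card {v. v < 2 ^ L \<and> Q w L v e} > 2 ^ L)"
    if "large w L" "\<forall>i. e i < 2 ^ L" for w L e
  proof -
    have "\<forall>i. case_nat v e i < 2 ^ L" if "v < 2 ^ L" for v
      using that \<open>\<forall>i. e i < 2 ^ L\<close> by (auto split: nat.split)
    then have "v < 2 ^ L \<and> eval \<phi> w L (case_nat v e) \<longleftrightarrow> v < 2 ^ L \<and> P w L v e"
      "v < 2 ^ L \<and> eval \<psi> w L (case_nat v e) \<longleftrightarrow> v < 2 ^ L \<and> Q w L v e" for v
      using \<phi>[OF that(1), of "case_nat v e"] \<psi>[OF that(1), of "case_nat v e"] by auto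
    then show ?thesis by simp
  qed
  then show ?thesis unfolding definable_def by blast
qed

text \<open>This is why \<open>Maj\<close> takes two formulas: replacing one of two sets by its
  complement turns the comparison of their cardinalities into a majority over both.\<close>

lemma definable_card_less:
  assumes "definable (\<lambda>w L e. P w L (e 0) (\<lambda>i. e (Suc i)))"
    and "definable (\<lambda>w L e. Q w L (e 0) (\<lambda>i. e (Suc i)))"
  shows "definable (\<lambda>w L e. card {v. v < 2 ^ L \<and> Q w L v e} < card {v. v < 2 ^ L \<and> P w L v e})"
proof (rule definable_cong)
  show "definable (\<lambda>w L e.
    card {v. v < 2 ^ L \<and> P w L v e} + card {v. v < 2 ^ L \<and> \<not> Q w L v e} > 2 ^ L)"
    by (intro definable_majority definable_not assms)
  fix w L e
  show "(card {v. v < 2 ^ L \<and> Q w L v e} < card {v. v < 2 ^ L \<and> P w L v e}) =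
    (card {v. v < 2 ^ L \<and> P w L v e} + card {v. v < 2 ^ L \<and> \<not> Q w L v e} > 2 ^ L)"
    using card_less_complement[of "2 ^ L" "\<lambda>v. Q w L v e"] by linarith
qed

lemma definable_card_eq:
  assumes "definable (\<lambda>w L e. P w L (e 0) (\<lambda>i. e (Suc i)))"
    and "definable (\<lambda>w L e. Q w L (e 0) (\<lambda>i. e (Suc i)))"
  shows "definable (\<lambda>w L e. card {v. v < 2 ^ L \<and> P w L v e} = card {v. v < 2 ^ L \<and> Q w L v e})"
  by (rule definable_cong[OF definable_conj[OF
    definable_not[OF definable_card_less[OF assms(1,2)]]
    definable_not[OF definable_card_less[OF assms(2,1)]]]]) auto

section \<open>Order, quantifiers and counting\<close>

lemma definable_Atom: "definable (\<lambda>w L e. run \<delta> (bit (e i)) (bit (e j)) L = Some True)"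
  unfolding definable_def by (rule exI[of _ "Atom \<delta> i j"]) simp

lemma definable_less: "definable (\<lambda>w L e. e i < e j)"
proof (rule definable_cong)
  \<comment> \<open>The last difference seen is the most significant one, so each difference
    overrides the previous verdict.\<close>
  define \<delta> :: trans where "\<delta> = (\<lambda>s a b. if a = b then s else Some b)"
  have run: "run \<delta> (bit x) (bit y) t =
    (if take_bit t x = take_bit t y then None else Some (take_bit t x < take_bit t y))" for t and x y :: nat
  proof (induction t)
    case (Suc t)
    define a b where ab: "a = take_bit t x" "b = take_bit t y"
    then have less: "a < 2 ^ t" "b < 2 ^ t" by (simp_all add: take_bit_nat_less_exp)
    have most: "take_bit (Suc t) x = a + (if bit x t then 2 ^ t else 0)"
      "take_bit (Suc t) y = b + (if bit y t then 2 ^ t else 0)"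
      by (simp_all add: take_bit_Suc_from_most ab)
    have IH: "run \<delta> (bit x) (bit y) t = (if a = b then None else Some (a < b))"
      using Suc by (simp only: ab)
    show ?case
      unfolding run.simps IH most using less
      by (cases "bit x t"; cases "bit y t") (auto simp: \<delta>_def)
  qed simp
  show "definable (\<lambda>w L e. run \<delta> (bit (e i)) (bit (e j)) L = Some True)" (is "definable ?Q")
    by (rule definable_Atom)
  fix w L and e :: "nat \<Rightarrow> nat" assume "\<And>i. e i < 2 ^ L"
  then show "(e i < e j) = ?Q w L e"
    by (auto simp: run take_bit_nat_eq_self)
qed

lemma definable_True: "definable (\<lambda>w L e. True)"
  by (rule definable_cong[OF definable_not[OF definable_less[of 0 0]]]) simp

lemma definable_ex:
  assumes "definable (\<lambda>w L e. P w L (e 0) (\<lambda>i. e (Suc i)))"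
  shows "definable (\<lambda>w L e. \<exists>v<2 ^ L. P w L v e)"
proof (rule definable_cong)
  show "definable (\<lambda>w L e. card {v. v < (2 :: nat) ^ L \<and> \<not> True} < card {v. v < 2 ^ L \<and> P w L v e})" (is "definable ?Q")
    by (intro definable_card_less definable_not definable_True assms)
  fix w L e
  show "(\<exists>v<2 ^ L. P w L v e) = ?Q w L e"
    by (auto simp: card_gt_0_iff)
qed

lemma definable_all:
  assumes "definable (\<lambda>w L e. P w L (e 0) (\<lambda>i. e (Suc i)))"
  shows "definable (\<lambda>w L e. \<forall>v<2 ^ L. P w L v e)"
  using definable_not[OF definable_ex[OF definable_not[OF assms]]] by simp

lemma definable_le: "definable (\<lambda>w L e. e i \<le> e j)"
  using definable_not[OF definable_less[of j i]] by (simp add: not_less)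

lemma definable_eq: "definable (\<lambda>w L e. e i = e j)"
  using definable_conj[OF definable_le[of i j] definable_le[of j i]] by (simp add: eq_iff)

lemma card_less_less: "x \<le> (U :: nat) \<Longrightarrow> card {v. v < U \<and> v < x} = x"
proof -
  assume "x \<le> U"
  then have "{v. v < U \<and> v < x} = {..<x}" by auto
  then show ?thesis by simp
qed

text \<open>A number is the count of its predecessors, so counts can be compared with variables.
  Addition, multiplication and the final sum rest on this.\<close>

lemma definable_card:
  assumes "definable (\<lambda>w L e. P w L (e 0) (\<lambda>i. e (Suc i)))"
  shows "definable (\<lambda>w L e. card {v. v < 2 ^ L \<and> P w L v e} = e i)"
proof (rule definable_cong)
  show "definable (\<lambda>w L e. card {v. v < 2 ^ L \<and> P w L v e} = card {v. v < 2 ^ L \<and> v < e i})"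
    by (intro definable_card_eq assms definable_less)
qed (simp add: card_less_less less_imp_le)

text \<open>The atom sees index 0 only; a fresh variable equal to \<open>e i\<close> brings any
  index there.\<close>

lemma definable_in_range: "definable (\<lambda>w L e. e i < length w)"
proof (rule definable_cong)
  have "definable (\<lambda>w L e. e 0 < length w)"
    unfolding definable_def by (rule exI[of _ Rng]) simp
  then show "definable (\<lambda>w L e. \<exists>v<2 ^ L. v = e i \<and> v < length w)"
    by (intro definable_ex definable_conj definable_eq)
qed auto

lemma definable_bit: "definable (\<lambda>w L e. e i < length w \<and> w ! (e i))"
proof (rule definable_cong)
  have "definable (\<lambda>w L e. e 0 < length w \<and> w ! (e 0))"
    unfolding definable_def by (rule exI[of _ Inp]) simp
  then show "definable (\<lambda>w L e. \<exists>v<2 ^ L. v = e i \<and> (v < length w \<and> w ! v))"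
    by (intro definable_ex definable_conj[of "\<lambda>w L e. e _ = e _"] definable_eq)
qed auto

section \<open>Powers of two and bits\<close>

definition pow2_dvd :: "nat \<Rightarrow> nat \<Rightarrow> bool" where
  "pow2_dvd p d \<longleftrightarrow> (\<exists>k. p = 2 ^ k \<and> p dvd d)"

definition pow2_bit :: "nat \<Rightarrow> nat \<Rightarrow> bool" where
  "pow2_bit p d \<longleftrightarrow> (\<exists>k. p = 2 ^ k \<and> bit d k)"

lemma eq_power_2_iff:
  fixes p :: nat
  assumes "p < 2 ^ L"
  shows "p = 2 ^ k \<longleftrightarrow> k < L \<and> (\<forall>u<L. bit p u = (u = k))"
proof
  assume p: "p = 2 ^ k"
  then show "k < L \<and> (\<forall>u<L. bit p u = (u = k))"
    using assms by (auto simp: bit_exp_iff)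
next
  assume k: "k < L \<and> (\<forall>u<L. bit p u = (u = k))"
  show "p = 2 ^ k"
    by (rule eq_if_bits[OF assms]) (use k in \<open>auto simp: bit_exp_iff\<close>)
qed

lemma power_2_dvd_iff: "2 ^ k dvd d \<longleftrightarrow> (\<forall>u<k. \<not> bit (d :: nat) u)"
proof -
  have "2 ^ k dvd d \<longleftrightarrow> take_bit k d = 0" by (simp add: take_bit_eq_0_iff)
  also have "\<dots> \<longleftrightarrow> (\<forall>u<k. \<not> bit d u)" by (auto simp: bit_eq_iff bit_take_bit_iff)
  finally show ?thesis .
qed

lemma definable_pow2_bit: "definable (\<lambda>w L e. pow2_bit (e i) (e j))"
proof (rule definable_cong)
  \<comment> \<open>\<open>None\<close>: no one has occurred in \<open>e i\<close>.
    \<open>Some c\<close>: its first one stood over the bit \<open>c\<close> of \<open>e j\<close>;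
    a further one rejects.\<close>
  define \<delta> :: trans where "\<delta> = (\<lambda>s a b. case s of
     None \<Rightarrow> if a then Some b else None | Some c \<Rightarrow> Some (c \<and> \<not> a))"
  have run: "(run \<delta> f g t = None \<longleftrightarrow> (\<forall>u<t. \<not> f u)) \<and>
    (run \<delta> f g t = Some True \<longleftrightarrow> (\<exists>k<t. (\<forall>u<t. f u = (u = k)) \<and> g k))" for f g t
  proof (induction t)
    case (Suc t)
    show ?case
    proof (cases "run \<delta> f g t")
      case None
      then have no: "\<forall>u<t. \<not> f u" using Suc by blast
      have 1: "run \<delta> f g (Suc t) = None \<longleftrightarrow> (\<forall>u<Suc t. \<not> f u)"
        using no unfolding run.simps None by (simp add: \<delta>_def All_less_Suc)
      have "(\<exists>k<Suc t. (\<forall>u<Suc t. f u = (u = k)) \<and> g k) \<longleftrightarrow> f t \<and> g t"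
        using no by (metis less_Suc_eq)
      then show ?thesis using 1 unfolding run.simps None by (simp add: \<delta>_def)
    next
      case (Some c)
      then have "\<not> (\<forall>u<t. \<not> f u)" using Suc by (metis option.distinct(1))
      then have 1: "\<not> (\<forall>u<Suc t. \<not> f u)" "\<not> (\<forall>u<Suc t. f u = (u = t))"
        using less_Suc_eq by auto
      have "c \<longleftrightarrow> (\<exists>k<t. (\<forall>u<t. f u = (u = k)) \<and> g k)"
        using Suc Some by simp
      then have "c \<and> \<not> f t \<longleftrightarrow> (\<exists>k<Suc t. (\<forall>u<Suc t. f u = (u = k)) \<and> g k)"
        using 1(2) by (metis less_Suc_eq less_irrefl)
      then show ?thesis using 1(1) unfolding run.simps Some by (simp add: \<delta>_def)
    qed
  qed simp
  show "definable (\<lambda>w L e. run \<delta> (bit (e i)) (bit (e j)) L = Some True)" (is "definable ?Q")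
    by (rule definable_Atom)
  fix w L and e :: "nat \<Rightarrow> nat" assume "\<And>i. e i < 2 ^ L"
  then have *: "e i = 2 ^ k \<longleftrightarrow> k < L \<and> (\<forall>u<L. bit (e i) u = (u = k))" for k
    by (rule eq_power_2_iff)
  show "pow2_bit (e i) (e j) = ?Q w L e"
    unfolding run[THEN conjunct2] pow2_bit_def * by blast
qed

text \<open>\<open>pow2_bit p p\<close> says that \<open>p\<close> is a power of two, and
  \<open>2 ^ k\<close> divides a number exactly if all its bits below \<open>k\<close>
  vanish.\<close>

lemma definable_pow2_dvd: "definable (\<lambda>w L e. pow2_dvd (e i) (e j))"
proof (rule definable_cong)
  show "definable (\<lambda>w L e. pow2_bit (e i) (e i) \<and>
      (\<forall>q<2 ^ L. q < e i \<longrightarrow> \<not> pow2_bit q (e j)))" (is "definable ?Q")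
    by (intro definable_conj definable_all definable_imp definable_not definable_less
      definable_pow2_bit)
  fix w L and e :: "nat \<Rightarrow> nat" assume e: "\<And>i. e i < 2 ^ L"
  have "(\<forall>q<2 ^ L. q < 2 ^ k \<longrightarrow> \<not> pow2_bit q (e j)) \<longleftrightarrow> 2 ^ k dvd e j" if k: "e i = 2 ^ k" for k
    unfolding power_2_dvd_iff
  proof (intro iffI allI impI)
    fix u assume q: "\<forall>q<2 ^ L. q < 2 ^ k \<longrightarrow> \<not> pow2_bit q (e j)" and "u < k"
    then have "(2 :: nat) ^ u < 2 ^ k" by simp
    moreover from this have "(2 :: nat) ^ u < 2 ^ L" using e[of i] k by simp
    ultimately have "\<not> pow2_bit (2 ^ u) (e j)" using q by blast
    then show "\<not> bit (e j) u" by (auto simp: pow2_bit_def)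
  qed (auto simp: pow2_bit_def)
  moreover have "pow2_bit (e i) (e i) \<longleftrightarrow> (\<exists>k. e i = 2 ^ k)"
    by (auto simp: pow2_bit_def bit_exp_iff)
  ultimately show "pow2_dvd (e i) (e j) = ?Q w L e"
    unfolding pow2_dvd_def by metis
qed

lemmas definable_basic = definable_not definable_disj definable_imp
  definable_ex definable_all definable_less definable_le definable_eq definable_card
  definable_in_range definable_bit definable_pow2_dvd definable_pow2_bit definable_if
  definable_iff definable_conj

section \<open>Arithmetic by counting\<close>

lemma definable_plus: "definable (\<lambda>w L e. e i + e j = e k)"
proof (rule definable_cong)
  show "definable (\<lambda>w L e. e j \<le> e k \<and>
      card {v. v < 2 ^ L \<and> (e j \<le> v \<and> v < e k)} = e i)" (is "definable ?Q")
    by (intro definable_basic)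
  fix w L and e :: "nat \<Rightarrow> nat" assume e: "\<And>i. e i < 2 ^ L"
  have "{v. v < 2 ^ L \<and> e j \<le> v \<and> v < e k} = {e j..<e k}"
    using e[of k] by auto
  then have c: "card {v. v < 2 ^ L \<and> (e j \<le> v \<and> v < e k)} = e k - e j" by simp
  show "(e i + e j = e k) = ?Q w L e"
    unfolding c by linarith
qed

lemma definable_0: "definable (\<lambda>w L e. e i = 0)"
  by (rule definable_cong[of "\<lambda>w L e. \<not> (\<exists>v<2 ^ L. v < e i)"])
    (intro definable_basic, metis gr_zeroI less_trans not_less_zero)

lemma definable_Suc: "definable (\<lambda>w L e. e i = Suc (e j))"
proof (rule definable_cong)
  show "definable (\<lambda>w L e. e j < e i \<and> \<not> (\<exists>v<2 ^ L. e j < v \<and> v < e i))" (is "definable ?Q")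
    by (intro definable_basic)
  fix w L and e :: "nat \<Rightarrow> nat" assume e: "\<And>i. e i < 2 ^ L"
  show "(e i = Suc (e j)) = ?Q w L e"
  proof
    assume *: "e j < e i \<and> \<not> (\<exists>v<2 ^ L. e j < v \<and> v < e i)"
    then have "\<not> Suc (e j) < e i" using less_trans[OF _ e[of i], of "Suc (e j)"] by auto
    then show "e i = Suc (e j)" using * by simp
  qed auto
qed

lemma definable_1: "definable (\<lambda>w L e. e i = 1)"
proof (rule definable_cong)
  show "definable (\<lambda>w L e. \<exists>v<2 ^ L. v = 0 \<and> e i = Suc v)"
    by (intro definable_basic definable_0 definable_Suc)
qed auto

lemma card_multiples_less:
  assumes "0 < p"
  shows "card {u. u < x * p \<and> p dvd u} = (x :: nat)"
proof -
  have "{u. u < x * p \<and> p dvd u} = (\<lambda>c. c * p) ` {..<x}"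
    using assms by (auto simp: dvd_def mult.commute)
  moreover have "inj_on (\<lambda>c. c * p) {..<x}" using assms by (auto simp: inj_on_def)
  ultimately show ?thesis by (simp add: card_image)
qed

lemma card_low_residues:
  assumes "y' \<le> (p :: nat)"
  shows "card {u. u < x * p \<and> u mod p < y'} = x * y'"
proof (induction x)
  case (Suc x)
  have "{u. u < Suc x * p \<and> u mod p < y'} =
    {u. u < x * p \<and> u mod p < y'} \<union> {x * p..<x * p + y'}"
  proof (intro set_eqI iffI)
    fix u assume u: "u \<in> {u. u < Suc x * p \<and> u mod p < y'}"
    show "u \<in> {u. u < x * p \<and> u mod p < y'} \<union> {x * p..<x * p + y'}"
    proof (cases "u < x * p")
      case False
      then obtain r where r: "u = x * p + r" by (metis le_Suc_ex not_less)
      then have "r < p" using u by simp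
      then show ?thesis using u r by simp
    qed (use u in simp)
  next
    fix u assume "u \<in> {u. u < x * p \<and> u mod p < y'} \<union> {x * p..<x * p + y'}"
    then consider "u < x * p \<and> u mod p < y'" | r where "u = x * p + r" "r < y'"
      by (auto simp: le_iff_add)
    then show "u \<in> {u. u < Suc x * p \<and> u mod p < y'}"
      using assms by cases auto
  qed
  moreover have "card ({u. u < x * p \<and> u mod p < y'} \<union> {x * p..<x * p + y'}) =
    card {u. u < x * p \<and> u mod p < y'} + card {x * p..<x * p + y'}"
    by (rule card_Un_disjoint) auto
  ultimately show ?case using Suc by simp
qed simp

text \<open>With the largest power of two \<open>p = 2 ^ k \<le> y\<close> and \<open>y = p + y'\<close> we have
  \<open>x * y = x * p + x * y'\<close>. Both products count numbers below the universe:
  \<open>x\<close> is the number of multiples of \<open>p\<close> below \<open>x * p\<close>, and \<open>x * y'\<close> is the number of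
  \<open>u < x * p\<close> with \<open>u mod p < y'\<close>.\<close>

lemma definable_times: "definable (\<lambda>w L e. e i * e j = e k)"
proof (rule definable_cong)
  show "definable (\<lambda>w L e. (e j = 0 \<and> e k = 0) \<or>
     (\<exists>p<2 ^ L. \<exists>s<2 ^ L. \<exists>c<2 ^ L. \<exists>y'<2 ^ L.
       p + y' = e j \<and> y' < p \<and> pow2_dvd p s \<and> card {u. u < 2 ^ L \<and> (u < s \<and> pow2_dvd p u)} = e i \<and>
       s + c = e k \<and>
       card {u. u < 2 ^ L \<and> (u < s \<and> (\<exists>d<2 ^ L. \<exists>t<2 ^ L. pow2_dvd p d \<and> t < y' \<and> d + t = u))} = c))"
    by (intro definable_basic definable_0 definable_plus)
  fix w L and e :: "nat \<Rightarrow> nat" assume e: "\<And>i. e i < 2 ^ L"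
  let ?F = "\<lambda>p s c y'. p + y' = e j \<and> y' < p \<and> pow2_dvd p s \<and>
       card {u. u < 2 ^ L \<and> (u < s \<and> pow2_dvd p u)} = e i \<and> s + c = e k \<and>
       card {u. u < 2 ^ L \<and> (u < s \<and> (\<exists>d<2 ^ L. \<exists>t<2 ^ L. pow2_dvd p d \<and> t < y' \<and> d + t = u))} = c"
  have F: "?F p s c y' \<longleftrightarrow> p + y' = e j \<and> y' < p \<and> s = e i * p \<and> s + c = e k \<and> e i * y' = c"
    if ps: "p = 2 ^ K" "s < 2 ^ L" for p s c y' K
  proof (cases "y' < p")
    case yp: True
    have p0: "0 < p" using ps by simp
    have dvd: "pow2_dvd p z \<longleftrightarrow> p dvd z" for z using ps by (auto simp: pow2_dvd_def)
    have low: "(\<exists>d<2 ^ L. \<exists>t<2 ^ L. p dvd d \<and> t < y' \<and> d + t = u) \<longleftrightarrow> u mod p < y'" if "u < s" for u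
    proof
      assume "\<exists>d<2 ^ L. \<exists>t<2 ^ L. p dvd d \<and> t < y' \<and> d + t = u"
      then obtain d t where "p dvd d" "t < y'" "d + t = u" by blast
      then show "u mod p < y'" using yp by (auto simp: dvd_def)
    next
      assume "u mod p < y'"
      moreover have "u - u mod p + u mod p = u" by simp
      moreover have "p dvd u - u mod p" by (simp add: dvd_minus_mod)
      moreover have "u < 2 ^ L" using that ps(2) by simp
      then have "u - u mod p < 2 ^ L" "u mod p < 2 ^ L"
        by (meson diff_le_self le_less_trans mod_less_eq_dividend)+
      ultimately show "\<exists>d<2 ^ L. \<exists>t<2 ^ L. p dvd d \<and> t < y' \<and> d + t = u" by blast
    qed
    have c1: "card {u. u < 2 ^ L \<and> (u < s \<and> p dvd u)} = e i \<longleftrightarrow> s = e i * p" if "p dvd s"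
    proof -
      obtain z where z: "s = z * p" using \<open>p dvd s\<close> by (metis dvdE mult.commute)
      have "{u. u < 2 ^ L \<and> (u < s \<and> p dvd u)} = {u. u < z * p \<and> p dvd u}" using z ps(2) by auto
      then show ?thesis using card_multiples_less[OF p0, of z] z p0 by simp
    qed
    have c2: "card {u. u < 2 ^ L \<and> (u < s \<and> (\<exists>d<2 ^ L. \<exists>t<2 ^ L. p dvd d \<and> t < y' \<and> d + t = u))} = x * y'"
      if "s = x * p" for x
    proof -
      have "{u. u < 2 ^ L \<and> (u < s \<and> (\<exists>d<2 ^ L. \<exists>t<2 ^ L. p dvd d \<and> t < y' \<and> d + t = u))} =
        {u. u < x * p \<and> u mod p < y'}" using low ps(2) that by (auto simp del: less_mult_imp_div_less)
      then show ?thesis using card_low_residues[of y' p x] yp by simp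
    qed
    show ?thesis
    proof
      assume F: "?F p s c y'"
      then have "p dvd s" unfolding dvd by (elim conjE)
      moreover have "card {u. u < 2 ^ L \<and> (u < s \<and> p dvd u)} = e i"
        using F unfolding dvd by (elim conjE)
      ultimately have s: "s = e i * p" using c1 by simp
      show "p + y' = e j \<and> y' < p \<and> s = e i * p \<and> s + c = e k \<and> e i * y' = c"
        using F c2[OF s] s unfolding dvd by (elim conjE) (simp only: simp_thms)
    next
      assume G: "p + y' = e j \<and> y' < p \<and> s = e i * p \<and> s + c = e k \<and> e i * y' = c"
      then have s: "s = e i * p" and "p dvd s" by simp_all
      show "?F p s c y'"
        unfolding dvd using G c1[OF \<open>p dvd s\<close>] c2[OF s] \<open>p dvd s\<close> by (elim conjE) (simp only: simp_thms)
    qed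
  qed simp
  show "(e i * e j = e k) = ((e j = 0 \<and> e k = 0) \<or>
     (\<exists>p<2 ^ L. \<exists>s<2 ^ L. \<exists>c<2 ^ L. \<exists>y'<2 ^ L. ?F p s c y'))"
  proof
    assume prod: "e i * e j = e k"
    show "(e j = 0 \<and> e k = 0) \<or> (\<exists>p<2 ^ L. \<exists>s<2 ^ L. \<exists>c<2 ^ L. \<exists>y'<2 ^ L. ?F p s c y')"
    proof (cases "e j = 0")
      case False
      then obtain K where K: "2 ^ K \<le> e j" "e j < 2 ^ (K + 1)"
        using ex_power_ivl1[of 2 "e j"] by auto
      define p y' where "p = (2 :: nat) ^ K" and "y' = e j - p"
      have py: "p + y' = e j" "y' < p" using K by (auto simp: p_def y'_def)
      have "e i * p + e i * y' = e k" unfolding prod[symmetric] py(1)[symmetric] by (simp add: algebra_simps)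
      moreover from this have "e i * p < 2 ^ L" "e i * y' < 2 ^ L" using e[of k] by linarith+
      moreover have "p < 2 ^ L" "y' < 2 ^ L" using py e[of j] by linarith+
      ultimately show ?thesis using F[OF p_def, of "e i * p" y' "e i * y'"] py by blast
    qed (use prod in simp)
  next
    assume "(e j = 0 \<and> e k = 0) \<or> (\<exists>p<2 ^ L. \<exists>s<2 ^ L. \<exists>c<2 ^ L. \<exists>y'<2 ^ L. ?F p s c y')"
    then consider "e j = 0 \<and> e k = 0" | p s c y' where "s < 2 ^ L" "?F p s c y'" by blast
    then show "e i * e j = e k"
    proof cases
      case 2
      then obtain K where "p = 2 ^ K" unfolding pow2_dvd_def by blast
      then have "p + y' = e j \<and> y' < p \<and> s = e i * p \<and> s + c = e k \<and> e i * y' = c"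
        using F[of p K s y' c] 2 by blast
      then show ?thesis by (metis distrib_left)
    qed simp
  qed
qed

lemma definable_dvd: "definable (\<lambda>w L e. e i dvd e j)"
proof (rule definable_cong)
  show "definable (\<lambda>w L e. \<exists>c<2 ^ L. e i * c = e j)" (is "definable ?Q")
    by (intro definable_basic definable_times)
  fix w L and e :: "nat \<Rightarrow> nat" assume e: "\<And>i. e i < 2 ^ L"
  show "(e i dvd e j) = ?Q w L e"
  proof
    assume "e i dvd e j"
    then obtain c where c: "e j = e i * c" by (auto simp: dvd_def)
    show "\<exists>c<2 ^ L. e i * c = e j"
    proof (cases "e i = 0")
      case False
      then have "c \<le> e j" using c by simp
      then show ?thesis using c le_less_trans[OF _ e[of j]] by (intro exI[of _ c]) auto
    qed (use c in \<open>auto intro: exI[of _ 0]\<close>)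
  next
    assume "\<exists>c<2 ^ L. e i * c = e j"
    then show "e i dvd e j" by (metis dvd_triv_left)
  qed
qed

lemma definable_prime: "definable (\<lambda>w L e. prime (e i))"
proof (rule definable_cong)
  show "definable (\<lambda>w L e. \<not> (e i = 0) \<and> \<not> (e i = 1) \<and>
      (\<forall>d<2 ^ L. d dvd e i \<longrightarrow> d = 1 \<or> d = e i))" (is "definable ?Q")
    by (intro definable_basic definable_0 definable_1 definable_dvd)
  fix w L and e :: "nat \<Rightarrow> nat" assume e: "\<And>i. e i < 2 ^ L"
  have "d < 2 ^ L" if "d dvd e i" "e i \<noteq> 0" for d
    using dvd_imp_le[OF that(1)] that(2) e[of i] by simp
  then show "prime (e i) = ?Q w L e"
    unfolding prime_nat_iff by (auto simp: not_less_eq)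
qed

lemmas definable_intros = definable_basic definable_plus definable_times definable_dvd
  definable_0 definable_1 definable_Suc definable_prime

section \<open>Bounded Bezout coefficients\<close>

text \<open>This expresses that \<open>q\<close> is a positive power of the prime \<open>p\<close>
  by divisibility alone; no exponent has to be quantified.\<close>

definition prime_power_of :: "nat \<Rightarrow> nat \<Rightarrow> bool" where
  "prime_power_of p q \<longleftrightarrow> prime p \<and> 1 < q \<and> (\<forall>d. d dvd q \<longrightarrow> d = 1 \<or> p dvd d)"

lemma prime_power_of_power:
  assumes "prime p" "0 < k"
  shows "prime_power_of p (p ^ k)"
  unfolding prime_power_of_def
proof (intro conjI allI impI)
  show "1 < p ^ k" using assms prime_gt_1_nat by (intro one_less_power) auto
  fix d assume "d dvd p ^ k"
  then obtain j where "d = p ^ j" using divides_primepow_nat[OF assms(1)] by blast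
  then show "d = 1 \<or> p dvd d" by (cases j) auto
qed (fact assms)

text \<open>Since \<open>p\<close> is the only prime factor of \<open>q\<close>, the number
  \<open>q\<close> is a power of \<open>p\<close>, with an exponent bounded by the multiplicity of
  \<open>p\<close> in \<open>m\<close>.\<close>

lemma prime_power_of_dvd:
  assumes "prime_power_of p q" "q dvd m" "0 < m"
  shows "p \<in> prime_factors m" "q dvd p ^ multiplicity p m"
proof -
  have p: "prime p" and q: "1 < q" and d: "\<And>d. d dvd q \<Longrightarrow> d = 1 \<or> p dvd d"
    using assms(1) by (auto simp: prime_power_of_def)
  have "p dvd q" using d[of q] q by simp
  then show "p \<in> prime_factors m"
    using p assms(2,3) by (auto simp: prime_factors_dvd)
  have "r = p" if "r \<in> prime_factors q" for r
  proof -
    have r: "prime r" "r dvd q" using that by (auto simp: prime_factors_dvd)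
    then have "p dvd r" using d[of r] by auto
    then show ?thesis using primes_dvd_imp_eq[OF p r(1)] by simp
  qed
  moreover have "p \<in> prime_factors q" using p \<open>p dvd q\<close> q by (auto simp: prime_factors_dvd)
  ultimately have "prime_factors q = {p}" by blast
  then have "q = p ^ multiplicity p q"
    using prime_factorization_nat[of q] q by simp
  moreover have "multiplicity p q \<le> multiplicity p m"
    using assms(2,3) by (intro dvd_imp_multiplicity_le) auto
  ultimately show "q dvd p ^ multiplicity p m" by (metis le_imp_power_dvd)
qed

lemma coprime_prime_factor_powers:
  assumes "p \<in> prime_factors (m :: nat)" "q \<in> prime_factors m" "p \<noteq> q"
  shows "coprime (p ^ j) (q ^ k)"
  using assms by (auto simp: prime_factors_dvd intro!: coprime_power_left_iff[THEN iffD2] primes_coprime)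

section \<open>Selection by primes and Chinese remaindering\<close>

locale bezout =
  fixes S :: "nat set" and a :: "nat \<Rightarrow> nat" and piv :: nat
  assumes finite: "finite S" and piv: "piv \<in> S" "0 < a piv"
begin

definition "g = Gcd (a ` S)"
definition "b s = a s div g"
abbreviation "m \<equiv> b piv"

definition sel :: "nat \<Rightarrow> nat \<Rightarrow> bool" where
  "sel p s \<longleftrightarrow> s \<in> S \<and> \<not> p * g dvd a s \<and> (\<forall>u\<in>S. u < s \<longrightarrow> p * g dvd a u)"

text \<open>All prime powers dividing \<open>m\<close> are treated alike, so no multiplicity has to
  be expressed; the congruences for the largest powers imply the others.\<close>

definition ok :: "nat \<Rightarrow> nat \<Rightarrow> bool" where
  "ok s x \<longleftrightarrow> (\<forall>p q. prime_power_of p q \<and> q dvd m \<longrightarrow>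
     (if sel p s then [b s * x = 1] (mod q) else q dvd x))"

lemma g_dvd: "s \<in> S \<Longrightarrow> g dvd a s"
  by (simp add: g_def)

lemma g_pos: "0 < g"
  using g_dvd[OF piv(1)] piv(2) by (metis dvd_0_left_iff gr0I less_irrefl)

lemma b_times_g: "s \<in> S \<Longrightarrow> b s * g = a s"
  using g_dvd by (simp add: b_def)

lemma m_pos: "0 < m"
  using b_times_g[OF piv(1)] piv(2) by (cases m) auto

lemma dvd_b_iff: "s \<in> S \<Longrightarrow> p * g dvd a s \<longleftrightarrow> p dvd b s"
  using b_times_g[of s] g_pos by (metis dvd_times_right_cancel_iff less_irrefl)

lemma sel_unique: "sel p s \<Longrightarrow> sel p s' \<Longrightarrow> s = s'"
  unfolding sel_def by (metis linorder_neqE_nat)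

lemma sel_not_dvd: "sel p s \<Longrightarrow> \<not> p dvd b s"
  using dvd_b_iff by (auto simp: sel_def)

text \<open>Otherwise \<open>p * g\<close> would be a common divisor and hence divide
  \<open>g\<close>.\<close>

lemma ex_sel:
  assumes "prime p"
  shows "\<exists>s. sel p s"
proof -
  have "\<exists>s\<in>S. \<not> p * g dvd a s"
  proof (rule ccontr)
    assume "\<not> (\<exists>s\<in>S. \<not> p * g dvd a s)"
    then have "p * g dvd g" unfolding g_def by (intro Gcd_greatest) auto
    then show False using assms g_pos by (auto dest: dvd_imp_le simp: prime_nat_iff)
  qed
  then obtain s where s: "s \<in> S \<and> \<not> p * g dvd a s" by blast
  define s0 where "s0 = (LEAST s. s \<in> S \<and> \<not> p * g dvd a s)"
  have "s0 \<in> S \<and> \<not> p * g dvd a s0" unfolding s0_def by (rule LeastI[of _ s]) (rule s)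
  moreover have "p * g dvd a u" if "u \<in> S" "u < s0" for u
    using that not_less_Least[of u "\<lambda>s. s \<in> S \<and> \<not> p * g dvd a s"] unfolding s0_def by blast
  ultimately show ?thesis unfolding sel_def by blast
qed

text \<open>Chinese remaindering over the largest prime powers in \<open>m\<close>. If
  \<open>p\<close> selects \<open>s\<close>, then \<open>b s\<close> is invertible modulo powers of
  \<open>p\<close>. Each \<open>q\<close> in \<open>ok\<close> divides one of these moduli, so it
  inherits the congruence.\<close>

lemma ex_ok:
  assumes "s \<in> S"
  shows "\<exists>x<m. ok s x"
proof -
  let ?A = "prime_factors m" and ?Q = "\<lambda>p. p ^ multiplicity p m"
  have "\<exists>u. \<forall>p\<in>?A. if sel p s then [b s * u p = 1] (mod ?Q p) else u p = 0"
  proof (rule exI[of _ "\<lambda>p. if sel p s then SOME y. [b s * y = 1] (mod ?Q p) else 0"], intro ballI)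
    fix p assume "p \<in> ?A"
    then have p: "prime p" by (rule in_prime_factors_imp_prime)
    have "\<exists>y. [b s * y = 1] (mod ?Q p)" if "sel p s"
    proof -
      have "coprime p (b s)"
        using p sel_not_dvd[OF that] by (simp add: prime_imp_coprime)
      then have "coprime (b s) (?Q p)" by (simp add: coprime_commute)
      then show ?thesis using cong_solve_coprime_nat[of "b s" "?Q p"] by auto
    qed
    then show "if sel p s
      then [b s * (if sel p s then SOME y. [b s * y = 1] (mod ?Q p) else 0) = 1] (mod ?Q p)
      else (if sel p s then SOME y. [b s * y = 1] (mod ?Q p) else 0) = 0"
      by (auto intro: someI_ex)
  qed
  then obtain u where u: "\<And>p. p \<in> ?A \<Longrightarrow> if sel p s then [b s * u p = 1] (mod ?Q p) else u p = 0"
    by blast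
  have "\<forall>p\<in>?A. \<forall>q\<in>?A. p \<noteq> q \<longrightarrow> coprime (?Q p) (?Q q)"
    using coprime_prime_factor_powers by blast
  then obtain x where x: "\<And>p. p \<in> ?A \<Longrightarrow> [x = u p] (mod ?Q p)"
    using chinese_remainder_nat[of ?A ?Q u, OF finite_set_mset] by blast
  have "ok s (x mod m)"
    unfolding ok_def
  proof (intro allI impI)
    fix p q assume pq: "prime_power_of p q \<and> q dvd m"
    then have p: "p \<in> ?A" and q: "q dvd ?Q p" using prime_power_of_dvd m_pos by auto
    have "[x mod m = x] (mod q)" using pq by (metis cong_def mod_mod_cancel)
    also have "[x = u p] (mod q)" using x[OF p] q by (rule cong_dvd_modulus_nat)
    finally have xq: "[x mod m = u p] (mod q)" .
    show "if sel p s then [b s * (x mod m) = 1] (mod q) else q dvd x mod m"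
    proof (cases "sel p s")
      case True
      then have "[b s * u p = 1] (mod q)" using u[OF p] q cong_dvd_modulus_nat by auto
      then show ?thesis using True cong_scalar_left[OF xq, of "b s"] cong_trans by auto
    next
      case False
      then show ?thesis using u[OF p] xq by (simp add: cong_0_iff)
    qed
  qed
  then show ?thesis using m_pos by (intro exI[of _ "x mod m"]) simp
qed

text \<open>Modulo each largest prime power in \<open>m\<close>, the summand of the selected index
  is 1 and all others vanish.\<close>

lemma sum_cong_1:
  assumes "\<And>s. s \<in> S \<Longrightarrow> s \<noteq> piv \<Longrightarrow> ok s (x s)"
  shows "[(\<Sum>s\<in>S - {piv}. x s * b s) = 1] (mod m)"
proof -
  let ?A = "prime_factors m" and ?Q = "\<lambda>p. p ^ multiplicity p m"
  have "[(\<Sum>s\<in>S - {piv}. x s * b s) = 1] (mod (\<Prod>p\<in>?A. ?Q p))"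
  proof (rule coprime_cong_prod_nat)
    fix p assume "p \<in> ?A"
    then have p: "prime p" "p dvd m" by (auto simp: prime_factors_dvd)
    have mult: "0 < multiplicity p m" using \<open>p \<in> ?A\<close> by (simp add: prime_factors_multiplicity)
    obtain s0 where s0: "sel p s0" using ex_sel[OF p(1)] by blast
    \<comment> \<open>The prime \<open>p\<close> divides \<open>m\<close>, the quotient at the
      pivot, so it cannot select the pivot.\<close>
    then have s0': "s0 \<in> S - {piv}" using p(2) sel_not_dvd by (auto simp: sel_def)
    have sel: "sel p s \<longleftrightarrow> s = s0" for s using s0 sel_unique by blast
    have "[x s * b s = of_bool (s = s0)] (mod ?Q p)" if "s \<in> S - {piv}" for s
    proof -
      have "ok s (x s)" using assms that by blast
      then have "if sel p s then [b s * x s = 1] (mod ?Q p) else ?Q p dvd x s"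
        unfolding ok_def using prime_power_of_power[OF p(1) mult] multiplicity_dvd by blast
      then show ?thesis by (auto simp: sel mult.commute cong_0_iff split: if_splits)
    qed
    then have "[(\<Sum>s\<in>S - {piv}. x s * b s) = (\<Sum>s\<in>S - {piv}. of_bool (s = s0))] (mod ?Q p)"
      by (rule cong_sum)
    also have "(\<Sum>s\<in>S - {piv}. of_bool (s = s0)) = (1 :: nat)"
      using s0' finite by (simp add: of_bool_def sum.delta)
    finally show "[(\<Sum>s\<in>S - {piv}. x s * b s) = 1] (mod ?Q p)" .
  qed (rule coprime_prime_factor_powers)
  then show ?thesis using prime_factorization_nat[OF m_pos] by simp
qed

text \<open>The least solution is a choice that a first-order formula can single out.\<close>

definition "X s = (LEAST x. ok s x)"
definition "T = (\<Sum>s\<in>S - {piv}. X s * b s)"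
definition "z s = (if s = piv then (1 - int T) div int m else int (X s))"

lemma ok_X: "s \<in> S \<Longrightarrow> ok s (X s)" and X_less: "s \<in> S \<Longrightarrow> X s < m"
proof -
  assume "s \<in> S"
  then obtain x where x: "x < m" "ok s x" using ex_ok by blast
  then show "ok s (X s)" unfolding X_def by (intro LeastI)
  have "X s \<le> x" unfolding X_def using x(2) by (rule Least_le)
  then show "X s < m" using x(1) by simp
qed

lemma z_piv: "z piv * int m = 1 - int T"
proof -
  have "[int T = 1] (mod int m)"
    using sum_cong_1[of X] ok_X unfolding T_def[symmetric] by (metis cong_int_iff of_nat_1)
  then have "int m dvd 1 - int T" by (metis cong_iff_dvd_diff cong_sym)
  then show ?thesis by (simp add: z_def)
qed

lemma z_sum: "(\<Sum>s\<in>S. z s * int (a s)) = int g"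
proof -
  have "(\<Sum>s\<in>S. z s * int (b s)) = z piv * int m + (\<Sum>s\<in>S - {piv}. z s * int (b s))"
    using finite piv by (subst sum.remove[of S piv]) auto
  also have "(\<Sum>s\<in>S - {piv}. z s * int (b s)) = int T"
    unfolding T_def of_nat_sum by (intro sum.cong) (auto simp: z_def)
  finally have one: "(\<Sum>s\<in>S. z s * int (b s)) = 1" by (simp add: z_piv)
  have "(\<Sum>s\<in>S. z s * int (a s)) = (\<Sum>s\<in>S. z s * int (b s)) * int g"
    unfolding sum_distrib_right by (intro sum.cong) (simp_all flip: b_times_g)
  then show ?thesis using one by simp
qed

lemma b_le: "s \<in> S \<Longrightarrow> b s \<le> a s"
  by (simp add: b_def)

lemma T_le:
  assumes "\<And>s. s \<in> S \<Longrightarrow> a s \<le> A"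
  shows "T \<le> card S * m * A"
proof -
  have "T \<le> (\<Sum>s\<in>S - {piv}. m * A)"
    unfolding T_def using X_less b_le assms
    by (intro sum_mono mult_le_mono) (auto intro: less_imp_le order.trans)
  also have "\<dots> \<le> card S * (m * A)"
    using finite by (simp add: card_Diff_subset card_mono)
  finally show ?thesis by (simp add: mult.assoc)
qed

text \<open>The equation \<open>z piv * int m = 1 - int T\<close> without signs and subtraction. The
  second alternative is for \<open>T = 0\<close>, which forces \<open>m = 1\<close> and
  \<open>z piv = 1\<close>.\<close>

lemma abs_z_piv_iff: "t = nat \<bar>z piv\<bar> \<longleftrightarrow> T = Suc (t * m) \<or> T + t * m = 1"
proof (cases "T = 0")
  case True
  then have zm: "z piv * int m = 1" using z_piv by simp
  then have "m = 1" "z piv = 1" using m_pos by (auto simp: zmult_eq_1_iff)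
  then show ?thesis using True by auto
next
  case False
  have "z piv * int m \<le> 0" using z_piv False by simp
  then have "z piv \<le> 0" using m_pos by (simp add: mult_le_0_iff)
  then have "\<bar>z piv\<bar> * int m = int T - 1" using z_piv by simp
  then have "int (nat \<bar>z piv\<bar> * m) = int (T - 1)" using False by simp
  then have "nat \<bar>z piv\<bar> * m = T - 1" by (simp only: of_nat_eq_iff)
  then have "t = nat \<bar>z piv\<bar> \<longleftrightarrow> t * m = T - 1"
    using m_pos by (metis mult_right_cancel less_irrefl)
  then show ?thesis using False m_pos by (cases t) auto
qed

lemma z_piv_neg: "z piv < 0 \<longleftrightarrow> 1 < T"
proof -
  have "z piv < 0 \<longleftrightarrow> z piv * int m < 0" using m_pos by (simp add: mult_less_0_iff)
  then show ?thesis using z_piv by simp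
qed

text \<open>At the pivot, \<open>T \<le> card S * m * A\<close>, and cancelling \<open>m\<close>
  leaves \<open>card S * A\<close>. Every other coefficient is below \<open>m \<le> A\<close>. Both
  are within the bound because \<open>A \<le> A\<^sup>2\<close>.\<close>

lemma abs_z_le:
  assumes "s \<in> S" "\<And>s. s \<in> S \<Longrightarrow> a s \<le> A"
  shows "nat \<bar>z s\<bar> \<le> (card S + 1) * A\<^sup>2"
proof -
  have A: "1 \<le> A" using assms(2)[OF piv(1)] piv(2) by simp
  then have AA: "A \<le> A\<^sup>2" by (simp add: power2_eq_square)
  have S: "1 \<le> card S" using finite piv(1) by (metis One_nat_def Suc_leI card_gt_0_iff empty_iff)
  show ?thesis
  proof (cases "s = piv")
    case True
    have "nat \<bar>z piv\<bar> * m \<le> card S * A * m"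
    proof (cases "T = 0")
      case True
      then have "nat \<bar>z piv\<bar> * m = 1" using abs_z_piv_iff[of "nat \<bar>z piv\<bar>"] by simp
      moreover have "1 * 1 * 1 \<le> card S * A * m" using S A m_pos by (intro mult_le_mono) auto
      ultimately show ?thesis by simp
    next
      case False
      then have "nat \<bar>z piv\<bar> * m \<le> T" using abs_z_piv_iff by force
      also have "\<dots> \<le> card S * m * A" by (rule T_le) (rule assms(2))
      finally show ?thesis by (simp add: ac_simps)
    qed
    then have "nat \<bar>z piv\<bar> \<le> card S * A" using m_pos by simp
    also have "\<dots> \<le> (card S + 1) * A\<^sup>2" using AA by (intro mult_le_mono) auto
    finally show ?thesis using True by simp
  next
    case False
    have "X s \<le> A" using X_less[OF assms(1)] b_le[OF piv(1)] assms(2)[OF piv(1)] by simp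
    also have "\<dots> \<le> (card S + 1) * A\<^sup>2" using AA by simp
    finally show ?thesis using False by (simp add: z_def)
  qed
qed

end

section \<open>A first-order description of the coefficients\<close>

text \<open>Signs are the letters whose first code bit is 0, so this finds the bit positions at
  which integers begin. These positions serve as indices throughout, which avoids numbering the
  integers.\<close>

definition start :: "bool list \<Rightarrow> nat \<Rightarrow> bool" where
  "start w s \<longleftrightarrow> even s \<and> s < length w \<and> \<not> w ! s"

definition digit_one :: "bool list \<Rightarrow> nat \<Rightarrow> bool" where
  "digit_one w v \<longleftrightarrow> even v \<and> Suc v < length w \<and> w ! v \<and> w ! Suc v"

definition input_abs :: "bool list \<Rightarrow> nat \<Rightarrow> nat" where
  "input_abs w s = card {v. s < v \<and> digit_one w v \<and> \<not> (\<exists>u. s < u \<and> u < v \<and> start w u)}"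

definition pivot :: "bool list \<Rightarrow> nat \<Rightarrow> bool" where
  "pivot w s \<longleftrightarrow> start w s \<and> 0 < input_abs w s \<and> (\<forall>u<s. \<not> (start w u \<and> 0 < input_abs w u))"

definition input_gcd :: "bool list \<Rightarrow> nat" where
  "input_gcd w = Gcd (input_abs w ` Collect (start w))"

definition input_quotient :: "bool list \<Rightarrow> nat \<Rightarrow> nat \<Rightarrow> bool" where
  "input_quotient w s b \<longleftrightarrow> start w s \<and> b * input_gcd w = input_abs w s"

definition modulus :: "bool list \<Rightarrow> nat \<Rightarrow> bool" where
  "modulus w m \<longleftrightarrow> (\<exists>s. pivot w s \<and> input_quotient w s m)"

text \<open>With \<open>b\<^sub>s = a\<^sub>s / gcd\<close>, the index selected by a prime \<open>p\<close> is the first one with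
  \<open>\<not> p dvd b\<^sub>s\<close>.\<close>

definition selected :: "bool list \<Rightarrow> nat \<Rightarrow> nat \<Rightarrow> bool" where
  "selected w p s \<longleftrightarrow> start w s \<and> \<not> p * input_gcd w dvd input_abs w s \<and>
     (\<forall>u<s. start w u \<longrightarrow> p * input_gcd w dvd input_abs w u)"

text \<open>For \<open>1 < q\<close> the equation \<open>b * x = Suc (q * y)\<close> is congruence
  to 1. Every intermediate value has its own bounded quantifier because the definability lemmas
  relate variables only.\<close>

definition residues_ok :: "bool list \<Rightarrow> nat \<Rightarrow> nat \<Rightarrow> nat \<Rightarrow> bool" where
  "residues_ok w L s x \<longleftrightarrow>
     (\<forall>p<2 ^ L. \<forall>q<2 ^ L. prime_power_of p q \<and> (\<exists>m<2 ^ L. modulus w m \<and> q dvd m) \<longrightarrow>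
        (if selected w p s
         then \<exists>b<2 ^ L. \<exists>c<2 ^ L. \<exists>y<2 ^ L. \<exists>d<2 ^ L.
           input_quotient w s b \<and> b * x = c \<and> q * y = d \<and> c = Suc d
         else q dvd x))"

definition coefficient :: "bool list \<Rightarrow> nat \<Rightarrow> nat \<Rightarrow> nat \<Rightarrow> bool" where
  "coefficient w L s x \<longleftrightarrow> (\<exists>m<2 ^ L. modulus w m \<and> x < m) \<and> residues_ok w L s x \<and>
     (\<forall>z<2 ^ L. z < x \<longrightarrow> \<not> residues_ok w L s z)"

definition summand :: "bool list \<Rightarrow> nat \<Rightarrow> nat \<Rightarrow> nat \<Rightarrow> bool" where
  "summand w L s v \<longleftrightarrow> start w s \<and> \<not> pivot w s \<and>
     (\<exists>x<2 ^ L. \<exists>b<2 ^ L. coefficient w L s x \<and> input_quotient w s b \<and> x * b = v)"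

definition square_length :: "bool list \<Rightarrow> nat \<Rightarrow> nat \<Rightarrow> bool" where
  "square_length w L W \<longleftrightarrow> (\<exists>n<2 ^ L. n = length w \<and> n * n = W)"

text \<open>The sum of the summands is the number of pairs \<open>(s, u)\<close> with \<open>u\<close> less than the summand
  at \<open>s\<close>; the pair is coded by \<open>s * n\<^sup>2 + u\<close>.\<close>

definition total :: "bool list \<Rightarrow> nat \<Rightarrow> nat \<Rightarrow> bool" where
  "total w L T \<longleftrightarrow> card {z. z < 2 ^ L \<and> (\<exists>s<2 ^ L. \<exists>u<2 ^ L. \<exists>v<2 ^ L. \<exists>W<2 ^ L. \<exists>c<2 ^ L.
     summand w L s v \<and> u < v \<and> square_length w L W \<and> s * W = c \<and> c + u = z)} = T"

text \<open>The case of the pivot transcribes \<open>abs_z_piv_iff\<close>.\<close>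

definition output_abs :: "bool list \<Rightarrow> nat \<Rightarrow> nat \<Rightarrow> nat \<Rightarrow> bool" where
  "output_abs w L s t \<longleftrightarrow> start w s \<and>
     (if pivot w s
      then \<exists>T<2 ^ L. \<exists>m<2 ^ L. \<exists>c<2 ^ L. total w L T \<and> modulus w m \<and> t * m = c \<and>
        (T = Suc c \<or> (\<exists>k<2 ^ L. k = 1 \<and> T + c = k))
      else coefficient w L s t)"

text \<open>The coefficients are computed for absolute values, so the output sign combines the input
  sign, stored in bit \<open>Suc s\<close>, with the sign of the coefficient. Only the pivot can
  have a negative one, namely for a sum above 1.\<close>

definition output_negative :: "bool list \<Rightarrow> nat \<Rightarrow> nat \<Rightarrow> bool" where
  "output_negative w L s \<longleftrightarrow>
     ((\<exists>v<2 ^ L. v = Suc s \<and> (v < length w \<and> w ! v)) \<longleftrightarrow>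
      \<not> (pivot w s \<and> (\<exists>T<2 ^ L. total w L T \<and> \<not> T = 0 \<and> \<not> T = 1)))"

text \<open>Scaling the input position by \<open>length w ^ 4\<close> spaces the blocks without
  numbering them. Each gets more than \<open>length w ^ 3\<close> places, the bound of
  \<open>abs_z_bound\<close>.\<close>

definition block :: "bool list \<Rightarrow> nat \<Rightarrow> nat \<Rightarrow> nat \<Rightarrow> bool" where
  "block w L s c \<longleftrightarrow> (\<exists>W<2 ^ L. \<exists>B<2 ^ L. square_length w L W \<and> W * W = B \<and> s * B = c)"

text \<open>The last bit of a block is described instead of the position after it, which for the
  final block would be \<open>2 ^ L\<close> and hence outside the universe.\<close>

definition block_last :: "bool list \<Rightarrow> nat \<Rightarrow> nat \<Rightarrow> nat \<Rightarrow> bool" where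
  "block_last w L s E \<longleftrightarrow>
     (\<exists>u<2 ^ L. \<exists>c<2 ^ L. start w u \<and> s < u \<and> (\<forall>v<2 ^ L. s < v \<and> v < u \<longrightarrow> \<not> start w v) \<and>
        block w L u c \<and> c = Suc E) \<or>
     ((\<forall>u<2 ^ L. s < u \<longrightarrow> \<not> start w u) \<and> (\<forall>v<2 ^ L. v \<le> E))"

text \<open>Letter \<open>k\<close> of a block starts at bit \<open>c + 2 * k\<close>. Letter 0 is
  the sign; \<open>output_digit\<close> excludes it by \<open>c < i\<close>, so the ones are the
  letters 1 to \<open>t\<close>.\<close>

definition unary_digit :: "nat \<Rightarrow> nat \<Rightarrow> nat \<Rightarrow> nat \<Rightarrow> bool" where
  "unary_digit L c i t \<longleftrightarrow> (\<exists>k<2 ^ L. \<exists>d<2 ^ L. k \<le> t \<and> k + k = d \<and> c + d = i)"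

text \<open>The exponent of \<open>p = 2 ^ k\<close> is recovered by counting the powers of two
  below \<open>p\<close>. The digit of weight \<open>p\<close> stands \<open>k\<close> letters
  before the last letter, which occupies the bits \<open>E - 1\<close> and \<open>E\<close>.\<close>

definition binary_digit :: "nat \<Rightarrow> nat \<Rightarrow> nat \<Rightarrow> nat \<Rightarrow> bool" where
  "binary_digit L E i t \<longleftrightarrow> (\<exists>k<2 ^ L. \<exists>d<2 ^ L. \<exists>f<2 ^ L. \<exists>p<2 ^ L.
     k + k = d \<and> i + d = f \<and> E = Suc f \<and> pow2_bit p t \<and>
     card {z. z < 2 ^ L \<and> (z < p \<and> pow2_dvd z z)} = k)"

definition output_digit :: "bool \<Rightarrow> bool list \<Rightarrow> nat \<Rightarrow> nat \<Rightarrow> bool" where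
  "output_digit binary w L i \<longleftrightarrow> (\<exists>s<2 ^ L. \<exists>E<2 ^ L. \<exists>t<2 ^ L. \<exists>c<2 ^ L.
     start w s \<and> block w L s c \<and> c < i \<and> block_last w L s E \<and> i \<le> E \<and> output_abs w L s t \<and>
     (if binary then binary_digit L E i t else unary_digit L c i t))"

text \<open>Even positions carry the first code bit of a letter, which is 0 just for signs; odd
  positions distinguish the two signs and the two digits.\<close>

definition output_bit :: "bool \<Rightarrow> bool list \<Rightarrow> nat \<Rightarrow> nat \<Rightarrow> bool" where
  "output_bit binary w L j \<longleftrightarrow>
     (even j \<and> \<not> (\<exists>s<2 ^ L. start w s \<and> block w L s j)) \<or>
     (\<exists>i<2 ^ L. j = Suc i \<and> even i \<and>
        ((\<exists>s<2 ^ L. start w s \<and> block w L s i \<and> output_negative w L s) \<or> output_digit binary w L i))"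

section \<open>Definability of the description\<close>

lemma large_power:
  assumes "large w L" shows "(2 * length w) ^ 8 \<le> 2 ^ L" "(2 :: nat) ^ 8 \<le> 2 ^ L"
proof -
  let ?l = "lg (length w)"
  have "2 * length w \<le> 2 ^ (?l + 1)" using le_power_lg[of "length w"] by simp
  then have "(2 * length w) ^ 8 \<le> (2 ^ (?l + 1)) ^ 8" by (rule power_mono) simp
  also have "\<dots> = 2 ^ (8 * (?l + 1))" by (simp only: power_mult[symmetric] mult.commute)
  also have "\<dots> \<le> 2 ^ L" using assms unfolding large_def by (intro power_increasing) auto
  finally show "(2 * length w) ^ 8 \<le> 2 ^ L" .
  show "(2 :: nat) ^ 8 \<le> 2 ^ L" using assms unfolding large_def by (intro power_increasing) auto
qed

lemma power_length_less:
  assumes "large w L" "k \<le> 7" shows "length w ^ k < 2 ^ L"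
proof (cases "length w = 0")
  case True
  have "(0 :: nat) ^ k \<le> 1" by (cases k) auto
  then show ?thesis using True large_power(2)[OF assms(1)] by simp
next
  case False
  then have "length w ^ k \<le> length w ^ 8" using assms(2) by (intro power_increasing) (auto simp: Suc_le_eq)
  also have "\<dots> < (2 * length w) ^ 8"
    using False by (simp add: power_mult_distrib)
  finally show ?thesis using large_power(1)[OF assms(1)] by simp
qed

lemma length_less: "large w L \<Longrightarrow> length w < 2 ^ L"
  using power_length_less[of w L 1] by simp

lemma start_less: "large w L \<Longrightarrow> start w s \<Longrightarrow> s < 2 ^ L"
  using length_less[of w L] by (simp add: start_def)

lemma definable_even: "definable (\<lambda>w L e. even (e i))"
proof (rule definable_cong)
  show "definable (\<lambda>w L e. \<exists>h<2 ^ L. h + h = e i)" (is "definable ?Q")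
    by (intro definable_intros)
  fix w L and e :: "nat \<Rightarrow> nat" assume e: "\<And>i. e i < 2 ^ L"
  show "even (e i) = ?Q w L e"
  proof
    assume "even (e i)"
    then obtain h where "e i = 2 * h" by (elim evenE)
    then show "\<exists>h<2 ^ L. h + h = e i" using e[of i] by (intro exI[of _ h]) simp
  next
    assume "\<exists>h<2 ^ L. h + h = e i"
    then obtain h where "e i = h + h" by metis
    then show "even (e i)" by simp
  qed
qed

lemma definable_start: "definable (\<lambda>w L e. start w (e i))"
proof (rule definable_cong)
  show "definable (\<lambda>w L e. even (e i) \<and> e i < length w \<and> \<not> (e i < length w \<and> w ! e i))"
    by (intro definable_intros definable_even)
qed (auto simp: start_def)

lemma definable_digit_one: "definable (\<lambda>w L e. digit_one w (e i))"
proof (rule definable_cong)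
  show "definable (\<lambda>w L e. even (e i) \<and> (e i < length w \<and> w ! e i) \<and>
      (\<exists>v<2 ^ L. v = Suc (e i) \<and> (v < length w \<and> w ! v)))" (is "definable ?Q")
    by (intro definable_intros definable_even)
  fix w L and e :: "nat \<Rightarrow> nat" assume "large w L"
  then show "digit_one w (e i) = ?Q w L e"
    using length_less[of w L] by (auto simp: digit_one_def)
qed

lemma definable_input_abs: "definable (\<lambda>w L e. input_abs w (e i) = e j)"
proof (rule definable_cong)
  show "definable (\<lambda>w L e. card {v. v < 2 ^ L \<and>
     (e i < v \<and> digit_one w v \<and> \<not> (\<exists>u<2 ^ L. e i < u \<and> u < v \<and> start w u))} = e j)" (is "definable ?Q")
    by (intro definable_intros definable_start definable_digit_one)
  fix w L and e :: "nat \<Rightarrow> nat" assume large: "large w L"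
  have "v < 2 ^ L" if "digit_one w v" for v
    using that length_less[OF large] by (simp add: digit_one_def)
  then have "{v. e i < v \<and> digit_one w v \<and> \<not> (\<exists>u. e i < u \<and> u < v \<and> start w u)} =
    {v. v < 2 ^ L \<and> (e i < v \<and> digit_one w v \<and> \<not> (\<exists>u<2 ^ L. e i < u \<and> u < v \<and> start w u))}"
    using start_less[OF large] by blast
  then show "(input_abs w (e i) = e j) = ?Q w L e"
    unfolding input_abs_def by simp
qed

lemma input_abs_le: "input_abs w s \<le> length w"
proof -
  have "{v. s < v \<and> digit_one w v \<and> \<not> (\<exists>u. s < u \<and> u < v \<and> start w u)} \<subseteq> {..<length w}"
    by (auto simp: digit_one_def)
  from card_mono[OF finite_lessThan this] show ?thesis unfolding input_abs_def by simp
qed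

lemma input_abs_less: "large w L \<Longrightarrow> input_abs w s < 2 ^ L"
  using input_abs_le[of w s] length_less[of w L] by simp

lemma definable_input_abs_pos: "definable (\<lambda>w L e. 0 < input_abs w (e i))"
proof (rule definable_cong)
  show "definable (\<lambda>w L e. \<exists>a<2 ^ L. input_abs w (e i) = a \<and> \<not> a = 0)"
    by (intro definable_intros definable_input_abs)
qed (use input_abs_less in auto)

lemma definable_pivot: "definable (\<lambda>w L e. pivot w (e i))"
proof (rule definable_cong)
  show "definable (\<lambda>w L e. start w (e i) \<and> 0 < input_abs w (e i) \<and>
      (\<forall>u<2 ^ L. u < e i \<longrightarrow> \<not> (start w u \<and> 0 < input_abs w u)))" (is "definable ?Q")
    by (intro definable_intros definable_start definable_input_abs_pos)
  fix w L and e :: "nat \<Rightarrow> nat" assume e: "\<And>i. e i < 2 ^ L"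
  have "u < 2 ^ L" if "u < e i" for u using less_trans[OF that e] .
  then show "pivot w (e i) = ?Q w L e"
    unfolding pivot_def by blast
qed

lemma input_gcd_less: "large w L \<Longrightarrow> input_gcd w < 2 ^ L"
proof (cases "\<exists>s. start w s \<and> input_abs w s \<noteq> 0")
  case True
  assume large: "large w L"
  obtain s where s: "start w s" "input_abs w s \<noteq> 0" using True by blast
  then have "input_gcd w dvd input_abs w s" by (auto simp: input_gcd_def)
  then have "input_gcd w \<le> input_abs w s" using s by (intro dvd_imp_le) auto
  then show ?thesis using input_abs_less[OF large, of s] by simp
next
  case False
  then have "input_gcd w = 0" by (auto simp: input_gcd_def Gcd_0_iff)
  then show ?thesis by simp
qed

text \<open>Greatest with respect to divisibility, not size, so all inputs being zero gives 0.
  Bounding \<open>d\<close> loses nothing because the gcd itself lies in the universe.\<close>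

lemma definable_input_gcd: "definable (\<lambda>w L e. e i = input_gcd w)"
proof (rule definable_cong)
  show "definable (\<lambda>w L e. (\<forall>s<2 ^ L. start w s \<longrightarrow> (\<exists>a<2 ^ L. input_abs w s = a \<and> e i dvd a)) \<and>
      (\<forall>d<2 ^ L. (\<forall>s<2 ^ L. start w s \<longrightarrow> (\<exists>a<2 ^ L. input_abs w s = a \<and> d dvd a)) \<longrightarrow> d dvd e i))" (is "definable ?Q")
    by (intro definable_intros definable_start definable_input_abs)
  fix w L and e :: "nat \<Rightarrow> nat" assume large: "large w L" and e: "\<And>i. e i < 2 ^ L"
  have *: "(\<forall>s<2 ^ L. start w s \<longrightarrow> (\<exists>a<2 ^ L. input_abs w s = a \<and> d dvd a)) \<longleftrightarrow> d dvd input_gcd w" for d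
    using start_less[OF large] input_abs_less[OF large] unfolding input_gcd_def dvd_Gcd_iff by auto
  have "e i = input_gcd w \<longleftrightarrow> e i dvd input_gcd w \<and> (\<forall>d<2 ^ L. d dvd input_gcd w \<longrightarrow> d dvd e i)"
    using input_gcd_less[OF large] by (auto intro: dvd_antisym)
  then show "(e i = input_gcd w) = ?Q w L e"
    unfolding * .
qed

lemma definable_input_quotient: "definable (\<lambda>w L e. input_quotient w (e i) (e j))"
proof (rule definable_cong)
  show "definable (\<lambda>w L e. start w (e i) \<and>
      (\<exists>g<2 ^ L. \<exists>a<2 ^ L. g = input_gcd w \<and> input_abs w (e i) = a \<and> e j * g = a))"
    by (intro definable_intros definable_start definable_input_abs definable_input_gcd)
qed (use input_abs_less input_gcd_less in \<open>auto simp: input_quotient_def\<close>)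

lemma definable_modulus: "definable (\<lambda>w L e. modulus w (e i))"
proof (rule definable_cong)
  show "definable (\<lambda>w L e. \<exists>s<2 ^ L. pivot w s \<and> input_quotient w s (e i))" (is "definable ?Q")
    by (intro definable_intros definable_pivot definable_input_quotient)
  fix w L and e :: "nat \<Rightarrow> nat" assume large: "large w L"
  have "s < 2 ^ L" if "pivot w s" for s using that start_less[OF large] by (simp add: pivot_def)
  then show "modulus w (e i) = ?Q w L e"
    unfolding modulus_def by blast
qed

lemma definable_prime_power_of: "definable (\<lambda>w L e. prime_power_of (e i) (e j))"
proof (rule definable_cong)
  show "definable (\<lambda>w L e. prime (e i) \<and> (\<not> e j = 0 \<and> \<not> e j = 1) \<and>
      (\<forall>d<2 ^ L. d dvd e j \<longrightarrow> d = 1 \<or> e i dvd d))" (is "definable ?Q")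
    by (intro definable_intros)
  fix w L and e :: "nat \<Rightarrow> nat" assume e: "\<And>i. e i < 2 ^ L"
  have "d < 2 ^ L" if "d dvd e j" "0 < e j" for d
    using dvd_imp_le[OF that] e[of j] by simp
  moreover have "1 < e j \<longleftrightarrow> \<not> e j = 0 \<and> \<not> e j = 1" by auto
  ultimately show "prime_power_of (e i) (e j) = ?Q w L e"
    unfolding prime_power_of_def by (metis gr0I)
qed

text \<open>The product \<open>e i * e j\<close> may exceed the universe; the cofactor of
  \<open>e j\<close> in \<open>e k\<close> is tested instead.\<close>

lemma definable_times_dvd: "definable (\<lambda>w L e. e i * e j dvd e k)"
proof (rule definable_cong)
  show "definable (\<lambda>w L e. \<exists>v<2 ^ L. v * e j = e k \<and> e i dvd v)" (is "definable ?Q")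
    by (intro definable_intros)
  fix w L and e :: "nat \<Rightarrow> nat" assume e: "\<And>i. e i < 2 ^ L"
  show "(e i * e j dvd e k) = ?Q w L e"
  proof
    assume "e i * e j dvd e k"
    then obtain c where c: "e k = e i * c * e j" by (metis dvdE mult.assoc mult.commute)
    show "\<exists>v<2 ^ L. v * e j = e k \<and> e i dvd v"
    proof (cases "e j = 0")
      case False
      then have "e i * c \<le> e k" using c by simp
      then have "e i * c < 2 ^ L" using e[of k] by (rule le_less_trans)
      then show ?thesis using c by (intro exI[of _ "e i * c"]) auto
    qed (use c in \<open>auto intro: exI[of _ 0]\<close>)
  next
    assume "\<exists>v<2 ^ L. v * e j = e k \<and> e i dvd v"
    then show "e i * e j dvd e k" by (metis dvd_refl mult_dvd_mono)
  qed
qed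

lemma definable_selected: "definable (\<lambda>w L e. selected w (e i) (e j))"
proof (rule definable_cong)
  show "definable (\<lambda>w L e. start w (e j) \<and>
     \<not> (\<exists>g<2 ^ L. \<exists>a<2 ^ L. g = input_gcd w \<and> input_abs w (e j) = a \<and> e i * g dvd a) \<and>
     (\<forall>u<2 ^ L. u < e j \<longrightarrow> start w u \<longrightarrow>
       (\<exists>g<2 ^ L. \<exists>a<2 ^ L. g = input_gcd w \<and> input_abs w u = a \<and> e i * g dvd a)))" (is "definable ?Q")
    by (intro definable_intros definable_start definable_input_abs definable_input_gcd
      definable_times_dvd)
  fix w L and e :: "nat \<Rightarrow> nat" assume large: "large w L"
  have "(\<exists>g<2 ^ L. \<exists>a<2 ^ L. g = input_gcd w \<and> input_abs w u = a \<and> e i * g dvd a) \<longleftrightarrow>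
    e i * input_gcd w dvd input_abs w u" for u
    using input_abs_less[OF large] input_gcd_less[OF large] by auto
  moreover have "(\<forall>u<s. start w u \<longrightarrow> P u) \<longleftrightarrow> (\<forall>u<2 ^ L. u < s \<longrightarrow> start w u \<longrightarrow> P u)" for s P
    using start_less[OF large] by blast
  ultimately show "selected w (e i) (e j) = ?Q w L e"
    unfolding selected_def by simp
qed

lemma definable_residues_ok: "definable (\<lambda>w L e. residues_ok w L (e i) (e j))"
  unfolding residues_ok_def
  by (intro definable_intros definable_prime_power_of definable_modulus definable_selected
    definable_input_quotient)

lemma definable_coefficient: "definable (\<lambda>w L e. coefficient w L (e i) (e j))"
  unfolding coefficient_def
  by (intro definable_intros definable_modulus definable_residues_ok)

lemma definable_summand: "definable (\<lambda>w L e. summand w L (e i) (e j))"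
  unfolding summand_def
  by (intro definable_intros definable_start definable_pivot definable_coefficient
    definable_input_quotient)

lemma definable_length: "definable (\<lambda>w L e. e i = length w)"
proof (rule definable_cong)
  show "definable (\<lambda>w L e. \<not> e i < length w \<and> (\<forall>v<2 ^ L. v < e i \<longrightarrow> v < length w))" (is "definable ?Q")
    by (intro definable_intros)
  fix w L and e :: "nat \<Rightarrow> nat" assume "large w L" "\<And>i. e i < 2 ^ L"
  then show "(e i = length w) = ?Q w L e"
    using length_less[of w L] by (metis less_irrefl less_trans linorder_neqE_nat)
qed

lemma definable_square_length: "definable (\<lambda>w L e. square_length w L (e i))"
  unfolding square_length_def by (intro definable_intros definable_length)

lemma definable_total: "definable (\<lambda>w L e. total w L (e i))"
  unfolding total_def by (intro definable_intros definable_summand definable_square_length)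

lemma definable_output_abs: "definable (\<lambda>w L e. output_abs w L (e i) (e j))"
  unfolding output_abs_def
  by (intro definable_intros definable_start definable_pivot definable_total definable_modulus
    definable_coefficient)

lemma definable_output_negative: "definable (\<lambda>w L e. output_negative w L (e i))"
  unfolding output_negative_def by (intro definable_intros definable_pivot definable_total)

lemma definable_block: "definable (\<lambda>w L e. block w L (e i) (e j))"
  unfolding block_def by (intro definable_intros definable_square_length)

lemma definable_block_last: "definable (\<lambda>w L e. block_last w L (e i) (e j))"
  unfolding block_last_def by (intro definable_intros definable_start definable_block)

lemma definable_unary_digit: "definable (\<lambda>w L e. unary_digit L (e i) (e j) (e k))"
  unfolding unary_digit_def by (intro definable_intros)

lemma definable_binary_digit: "definable (\<lambda>w L e. binary_digit L (e i) (e j) (e k))"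
  unfolding binary_digit_def by (intro definable_intros)

lemma definable_output_digit: "definable (\<lambda>w L e. output_digit binary w L (e i))"
  unfolding output_digit_def
  by (cases binary; simp only: if_True if_False)
    (intro definable_intros definable_start definable_block definable_block_last
      definable_output_abs definable_unary_digit definable_binary_digit)+

lemma definable_output_bit: "definable (\<lambda>w L e. output_bit binary w L (e i))"
  unfolding output_bit_def
  by (intro definable_intros definable_even definable_start definable_block
    definable_output_negative definable_output_digit)

lemma TC0_definable:
  assumes "definable (\<lambda>w L e. P w L (e 0))"
  shows "(\<lambda>w. map (P w (8 * (lg (length w) + 1))) [0..<2 ^ (8 * (lg (length w) + 1))]) \<in> TC0"
proof -
  obtain \<phi> where \<phi>: "\<And>w L e. large w L \<Longrightarrow> (\<forall>i. e i < 2 ^ L) \<Longrightarrow> eval \<phi> w L e = P w L (e 0)"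
    using assms unfolding definable_def by blast
  obtain r where "0 < r" "indices_below r \<phi>" using ex_indices_below by blast
  \<comment> \<open>The parameter 8 makes \<open>len\<close> the smallest length that satisfies
    \<open>large\<close>.\<close>
  then interpret formula_circuit \<phi> r 8 by unfold_locales auto
  have "eval \<phi> w (len (length w)) (\<lambda>s. if s = 0 then j else 0) = P w (len (length w)) j"
    if "j < 2 ^ len (length w)" for w j
    by (subst \<phi>) (use that in \<open>auto simp: large_def len_def\<close>)
  then have "map (\<lambda>j. eval \<phi> w (len (length w)) (\<lambda>s. if s = 0 then j else 0)) [0..<2 ^ len (length w)] =
    map (P w (8 * (lg (length w) + 1))) [0..<2 ^ (8 * (lg (length w) + 1))]" for w
    unfolding len_def by (intro map_cong refl) auto
  then show ?thesis using in_TC0 by simp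
qed

section \<open>Correctness of the description\<close>

lemma finite_starts: "finite (Collect (start w))"
  by (rule finite_subset[of _ "{..<length w}"]) (auto simp: start_def)

lemma card_starts: "card (Collect (start w)) \<le> length w"
proof -
  have "Collect (start w) \<subseteq> {..<length w}" by (auto simp: start_def)
  from card_mono[OF finite_lessThan this] show ?thesis by simp
qed

lemma square_length_iff: "large w L \<Longrightarrow> square_length w L W \<longleftrightarrow> W = length w * length w"
  using length_less[of w L] by (auto simp: square_length_def)

lemma block_iff:
  assumes "large w L" "s \<le> length w"
  shows "block w L s c \<longleftrightarrow> c = s * length w ^ 4"
proof -
  have "length w * length w < 2 ^ L" "length w * length w * (length w * length w) < 2 ^ L"
    using power_length_less[OF assms(1), of 2] power_length_less[OF assms(1), of 4]
    by (simp_all add: power2_eq_square power4_eq_xxxx mult.assoc)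
  then show ?thesis
    by (auto simp: block_def square_length_iff[OF assms(1)] power4_eq_xxxx mult.assoc)
qed

locale nonzero_input =
  fixes w :: "bool list" and L p0 :: nat
  assumes large: "large w L" and pivot: "pivot w p0"
begin

sublocale bezout "Collect (start w)" "input_abs w" p0
  using pivot finite_starts by unfold_locales (auto simp: pivot_def)

lemma input_gcd_eq: "input_gcd w = g"
  by (simp add: input_gcd_def g_def)

lemma pivot_iff: "pivot w s \<longleftrightarrow> s = p0"
  using pivot unfolding pivot_def by (metis linorder_neqE_nat)

lemma input_quotient_iff: "input_quotient w s c \<longleftrightarrow> start w s \<and> c = b s"
proof -
  have "start w s \<Longrightarrow> c * g = input_abs w s \<longleftrightarrow> c = b s"
    using b_times_g[of s] g_pos by (metis mem_Collect_eq mult_right_cancel less_irrefl)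
  then show ?thesis by (auto simp: input_quotient_def input_gcd_eq)
qed

lemma modulus_iff: "modulus w c \<longleftrightarrow> c = b p0"
  unfolding modulus_def pivot_iff input_quotient_iff using pivot by (auto simp: pivot_def)

lemma selected_iff: "selected w p s \<longleftrightarrow> sel p s"
  by (auto simp: selected_def sel_def input_gcd_eq)

lemma b_le_length: "start w s \<Longrightarrow> b s \<le> length w"
  using b_le[of s] input_abs_le[of w s] by simp

lemma start_p0: "start w p0"
  using piv(1) by simp

lemma b_less: "start w s \<Longrightarrow> b s < 2 ^ L"
  using b_le_length[of s] length_less[OF large] by simp

lemma residues_ok_iff:
  assumes "start w s" "x < b p0"
  shows "residues_ok w L s x \<longleftrightarrow> ok s x"
proof -
  have mod: "(\<exists>m<2 ^ L. modulus w m \<and> q dvd m) \<longleftrightarrow> q dvd b p0" for q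
    using b_less[OF start_p0] by (auto simp: modulus_iff)
  have less: "p < 2 ^ L \<and> q < 2 ^ L" if "prime_power_of p q" "q dvd b p0" for p q
  proof -
    have "q \<le> b p0" using that(2) m_pos by (rule dvd_imp_le)
    moreover have "p dvd q" "0 < q" using that(1) unfolding prime_power_of_def by (auto dest: spec[of _ q])
    then have "p \<le> q" by (rule dvd_imp_le)
    ultimately show ?thesis using b_less[OF start_p0] by simp
  qed
  have inner: "(\<exists>c<2 ^ L. \<exists>d<2 ^ L. \<exists>y<2 ^ L. \<exists>e<2 ^ L.
           input_quotient w s c \<and> c * x = d \<and> q * y = e \<and> d = Suc e) \<longleftrightarrow> [b s * x = 1] (mod q)"
      (is "?A \<longleftrightarrow> _")
    if "1 < q" for q
  proof
    assume ?A
    then obtain y where "b s * x = Suc (q * y)" by (auto simp: input_quotient_iff)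
    then show "[b s * x = 1] (mod q)" by (simp add: cong_def mod_Suc)
  next
    assume cong: "[b s * x = 1] (mod q)"
    define y where "y = b s * x div q"
    have "b s * x mod q = 1" using cong that by (simp add: cong_def)
    then have y: "b s * x = Suc (q * y)"
      using mult_div_mod_eq[of q "b s * x"] by (simp add: y_def)
    \<comment> \<open>Here \<open>x < b p0\<close> is what keeps the product inside the
      universe.\<close>
    have "b s * x \<le> length w * length w"
      using b_le_length[OF assms(1)] b_le_length[OF start_p0] assms(2) by (intro mult_le_mono) auto
    also have "\<dots> < 2 ^ L" using power_length_less[OF large, of 2] by (simp add: power2_eq_square)
    finally have less: "b s * x < 2 ^ L" .
    then have "q * y < 2 ^ L" using y by simp
    moreover have "y \<le> q * y" using that by (cases q) auto
    ultimately have "y < 2 ^ L" "q * y < 2 ^ L" using le_less_trans by blast+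
    with less show ?A
      using y b_less[OF assms(1)] assms(1) unfolding input_quotient_iff by blast
  qed
  have "1 < q" if "prime_power_of p q" for p q using that by (simp add: prime_power_of_def)
  then show ?thesis
    unfolding residues_ok_def ok_def mod selected_iff using inner less by (smt (verit))
qed

text \<open>The condition \<open>x < m\<close> in \<open>coefficient\<close> confines all candidates
  to the range where \<open>residues_ok\<close> agrees with \<open>ok\<close>.\<close>

lemma coefficient_iff:
  assumes "start w s"
  shows "coefficient w L s x \<longleftrightarrow> x = X s"
proof -
  have mod: "(\<exists>m<2 ^ L. modulus w m \<and> x < m) \<longleftrightarrow> x < b p0" for x
    using b_less[OF start_p0] by (auto simp: modulus_iff)
  have "coefficient w L s x \<longleftrightarrow> x < b p0 \<and> ok s x \<and> (\<forall>z<x. \<not> ok s z)"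
    unfolding coefficient_def mod
    using residues_ok_iff[OF assms] b_less[OF start_p0] by (meson less_trans)
  also have "\<dots> \<longleftrightarrow> x = X s"
    using ok_X[of s] X_less[of s] assms not_less_Least[of _ "ok s"]
    unfolding X_def by (metis linorder_neqE_nat mem_Collect_eq)
  finally show ?thesis .
qed

lemma summand_bound: "start w s \<Longrightarrow> X s * b s \<le> length w * length w"
  using X_less[of s] b_le_length[of s] b_le_length[OF start_p0]
  by (intro mult_le_mono) auto

lemma summand_iff: "summand w L s v \<longleftrightarrow> start w s \<and> s \<noteq> p0 \<and> v = X s * b s"
proof -
  have "X s < 2 ^ L" if "start w s"
    using X_less[of s] that b_less[OF start_p0] by simp
  then show ?thesis
    using b_less[of s] by (auto simp: summand_def pivot_iff coefficient_iff input_quotient_iff)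
qed

lemma summand_less: "start w s \<Longrightarrow> X s * b s < 2 ^ L"
  using summand_bound[of s] power_length_less[OF large, of 2] by (simp add: power2_eq_square)

lemma total_iff: "total w L t \<longleftrightarrow> t = T"
proof -
  let ?W = "length w * length w"
  let ?A = "SIGMA s:Collect (start w) - {p0}. {..<X s * b s}"
  let ?f = "\<lambda>(s, u). s * ?W + u"
  have W: "?W < 2 ^ L" using power_length_less[OF large, of 2] by (simp add: power2_eq_square)
  have less: "s * ?W + u < 2 ^ L" if "start w s" "u < X s * b s" for s u
  proof -
    have "s * ?W + u < Suc s * ?W" using summand_bound[OF that(1)] that(2) by simp
    also have "\<dots> \<le> length w * ?W" using that(1) by (intro mult_le_mono) (auto simp: start_def)
    also have "\<dots> < 2 ^ L" using power_length_less[OF large, of 3] by (simp add: power3_eq_cube mult.assoc)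
    finally show ?thesis .
  qed
  have "{z. z < 2 ^ L \<and> (\<exists>s<2 ^ L. \<exists>u<2 ^ L. \<exists>v<2 ^ L. \<exists>W<2 ^ L. \<exists>c<2 ^ L.
     summand w L s v \<and> u < v \<and> square_length w L W \<and> s * W = c \<and> c + u = z)} = ?f ` ?A" (is "?Z = _")
  proof (intro set_eqI iffI)
    fix z assume "z \<in> ?Z"
    then show "z \<in> ?f ` ?A" by (auto simp: summand_iff square_length_iff[OF large])
  next
    fix z assume "z \<in> ?f ` ?A"
    then obtain s u where su: "start w s" "s \<noteq> p0" "u < X s * b s" "z = s * ?W + u" by auto
    have z: "z < 2 ^ L" using less[OF su(1,3)] su(4) by simp
    moreover have "u < 2 ^ L" using su(3) summand_less[OF su(1)] by simp
    moreover have "s * ?W < 2 ^ L" using z su(4) by simp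
    ultimately show "z \<in> ?Z"
      using su start_less[OF large su(1)] summand_less[OF su(1)] W
      unfolding mem_Collect_eq summand_iff square_length_iff[OF large] by blast
  qed
  moreover have "inj_on ?f ?A"
  proof (rule inj_onI)
    fix p q assume pq: "p \<in> ?A" "q \<in> ?A" "?f p = ?f q"
    obtain s u s' u' where [simp]: "p = (s, u)" "q = (s', u')" by fastforce
    have u: "u < ?W" "u' < ?W" using pq summand_bound[of s] summand_bound[of s'] by auto
    \<comment> \<open>Every summand is at most \<open>?W\<close>, so \<open>u < ?W\<close> and
      division by \<open>?W\<close> recovers the index.\<close>
    have "(c * k + d) div k = c" if "d < k" for c d k :: nat
      using that by (cases "k = 0") auto
    then have "(s * ?W + u) div ?W = s" "(s' * ?W + u') div ?W = s'" using u by blast+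
    then have "s = s'" using pq(3) by simp
    then show "p = q" using pq(3) by simp
  qed
  moreover have "card ?A = T"
    using finite_starts by (subst card_SigmaI) (auto simp: T_def)
  ultimately show ?thesis unfolding total_def by (auto simp: card_image)
qed

lemma T_bound: "T \<le> length w ^ 3"
proof -
  have "T \<le> card (Collect (start w)) * b p0 * length w"
    by (rule T_le) (rule input_abs_le)
  also have "\<dots> \<le> length w * length w * length w"
    using card_starts b_le_length[OF start_p0] by (intro mult_le_mono) auto
  finally show ?thesis by (simp add: power3_eq_cube)
qed

lemma T_less: "T < 2 ^ L"
  using T_bound power_length_less[OF large, of 3] by simp

lemma output_abs_iff:
  assumes "start w s"
  shows "output_abs w L s t \<longleftrightarrow> t = nat \<bar>z s\<bar>"
proof (cases "s = p0")
  case True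
  have one: "1 < (2 :: nat) ^ L" using large_power(2)[OF large] by simp
  have "output_abs w L s t \<longleftrightarrow> (\<exists>c<2 ^ L. t * b p0 = c \<and> (T = Suc c \<or> T + c = 1))"
    using True assms T_less b_less[OF start_p0] one
    by (auto simp: output_abs_def pivot_iff total_iff modulus_iff)
  also have "\<dots> \<longleftrightarrow> T = Suc (t * b p0) \<or> T + t * b p0 = 1"
    using T_less one by auto
  also have "\<dots> \<longleftrightarrow> t = nat \<bar>z s\<bar>" using abs_z_piv_iff[of t] True by simp
  finally show ?thesis .
next
  case False
  then show ?thesis using assms by (simp add: output_abs_def pivot_iff coefficient_iff z_def)
qed

lemma output_negative_iff:
  assumes "start w s"
  shows "output_negative w L s \<longleftrightarrow> (Suc s < length w \<and> w ! Suc s) \<noteq> (z s < 0)"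
proof -
  have "(\<exists>v<2 ^ L. v = Suc s \<and> (v < length w \<and> w ! v)) \<longleftrightarrow> Suc s < length w \<and> w ! Suc s"
    using length_less[OF large] by auto
  moreover have "(\<exists>t<2 ^ L. total w L t \<and> \<not> t = 0 \<and> \<not> t = 1) \<longleftrightarrow> 1 < T"
    using T_less by (auto simp: total_iff)
  moreover have "z s < 0 \<longleftrightarrow> s = p0 \<and> 1 < T"
    using z_piv_neg by (auto simp: z_def)
  ultimately show ?thesis unfolding output_negative_def pivot_iff by auto
qed

text \<open>Unlike \<open>abs_z_le\<close>, this depends on the input length alone, so it can
  determine the block size.\<close>

lemma abs_z_bound: "start w s \<Longrightarrow> nat \<bar>z s\<bar> \<le> length w ^ 3"
proof -
  assume s: "start w s"
  then have n: "1 \<le> length w" by (cases w) (auto simp: start_def)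
  show ?thesis
  proof (cases "s = p0")
    case True
    have "T = Suc (nat \<bar>z p0\<bar> * b p0) \<or> T + nat \<bar>z p0\<bar> * b p0 = 1"
      using abs_z_piv_iff[of "nat \<bar>z p0\<bar>"] by blast
    then have le: "nat \<bar>z p0\<bar> * b p0 \<le> max T 1" by auto
    have "nat \<bar>z p0\<bar> \<le> nat \<bar>z p0\<bar> * b p0" using m_pos by (cases "b p0") auto
    also note le
    also have "max T 1 \<le> length w ^ 3" using T_bound n by simp
    finally show ?thesis using True by simp
  next
    case False
    have "X s \<le> length w" using X_less[of s] s b_le_length[OF start_p0] by simp
    also have "\<dots> \<le> length w ^ 3" using n by (simp add: power3_eq_cube)
    finally show ?thesis using False by (simp add: z_def)
  qed
qed

end

text \<open>If all inputs are zero, there is no pivot, hence no modulus, and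
  \<open>output_abs\<close> never holds. The third property is restricted to positive
  \<open>t\<close> so that this case is included, with all coefficients 0.\<close>

lemma ex_bezout:
  assumes large: "large w L"
  obtains z :: "nat \<Rightarrow> int"
  where "(\<Sum>s | start w s. z s * int (input_abs w s)) = int (input_gcd w)"
    and "\<And>s A. start w s \<Longrightarrow> (\<And>u. start w u \<Longrightarrow> input_abs w u \<le> A) \<Longrightarrow>
       nat \<bar>z s\<bar> \<le> (card (Collect (start w)) + 1) * A\<^sup>2"
    and "\<And>s t. start w s \<Longrightarrow> 0 < t \<Longrightarrow> output_abs w L s t \<longleftrightarrow> t = nat \<bar>z s\<bar>"
    and "\<And>s. start w s \<Longrightarrow> z s \<noteq> 0 \<Longrightarrow>
       output_negative w L s \<longleftrightarrow> (Suc s < length w \<and> w ! Suc s) \<noteq> (z s < 0)"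
    and "\<And>s. start w s \<Longrightarrow> nat \<bar>z s\<bar> \<le> length w ^ 3"
proof (cases "\<exists>s. pivot w s")
  case True
  then obtain p0 where "pivot w p0" by blast
  then interpret nonzero_input w L p0 using large by unfold_locales
  show ?thesis
    by (rule that[of z])
      (use z_sum abs_z_le output_abs_iff output_negative_iff abs_z_bound in \<open>auto simp: input_gcd_eq\<close>)
next
  case False
  have zero: "input_abs w s = 0" if "start w s" for s
  proof (rule ccontr)
    assume "input_abs w s \<noteq> 0"
    then have ex: "start w s \<and> 0 < input_abs w s" using that by simp
    define s0 where "s0 = (LEAST s. start w s \<and> 0 < input_abs w s)"
    have "start w s0 \<and> 0 < input_abs w s0" unfolding s0_def by (rule LeastI[of _ s]) (rule ex)
    moreover have "\<not> (start w u \<and> 0 < input_abs w u)" if "u < s0" for u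
      using that not_less_Least unfolding s0_def by blast
    ultimately have "pivot w s0" by (simp add: pivot_def)
    then show False using False by blast
  qed
  have "input_gcd w = 0" using zero by (auto simp: input_gcd_def Gcd_0_iff)
  moreover have "\<not> output_abs w L s t" for s t
    using False by (auto simp: output_abs_def coefficient_def modulus_def)
  ultimately show ?thesis
    using zero by (intro that[of "\<lambda>_. 0"]) auto
qed

lemma card_powers_less: "card {z. z < 2 ^ L \<and> (z < (2 :: nat) ^ k \<and> pow2_dvd z z)} = k" if "k < L"
proof -
  have "(2 :: nat) ^ j < 2 ^ L" if "j < k" for j
    using that \<open>k < L\<close> by (intro power_strict_increasing) auto
  then have "{z. z < 2 ^ L \<and> (z < (2 :: nat) ^ k \<and> pow2_dvd z z)} = (\<lambda>j. 2 ^ j) ` {..<k}"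
    by (auto simp: pow2_dvd_def)
  moreover have "inj_on (\<lambda>j. (2 :: nat) ^ j) {..<k}" by (auto simp: inj_on_def)
  ultimately show ?thesis by (simp add: card_image)
qed

lemma binary_digit_iff:
  assumes "E < 2 ^ L" "t < 2 ^ L" "i \<le> E"
  shows "binary_digit L E i t \<longleftrightarrow> (\<exists>k. i + 2 * k + 1 = E \<and> bit t k)"
proof
  assume "binary_digit L E i t"
  then obtain k d f p where *: "k + k = d" "i + d = f" "E = Suc f" "pow2_bit p t" "p < 2 ^ L"
     "card {z. z < 2 ^ L \<and> (z < p \<and> pow2_dvd z z)} = k" unfolding binary_digit_def by blast
  obtain j where j: "p = 2 ^ j" "bit t j" using *(4) by (auto simp: pow2_bit_def)
  then have "j < L" using *(5) by simp
  then have "k = j" using *(6) card_powers_less[of j L] j(1) by simp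
  then show "\<exists>k. i + 2 * k + 1 = E \<and> bit t k" using * j by (intro exI[of _ j]) auto
next
  assume "\<exists>k. i + 2 * k + 1 = E \<and> bit t k"
  then obtain k where k: "i + 2 * k + 1 = E" "bit t k" by blast
  have "k < L" using k(2) assms(2) not_bit_ge[of t L k] by (meson not_le)
  then have "card {z. z < 2 ^ L \<and> (z < (2 :: nat) ^ k \<and> pow2_dvd z z)} = k" "(2 :: nat) ^ k < 2 ^ L"
    by (auto intro: card_powers_less)
  moreover have "pow2_bit (2 ^ k) t" using k(2) by (auto simp: pow2_bit_def)
  ultimately show "binary_digit L E i t"
    unfolding binary_digit_def using k assms(1)
    by (intro exI[of _ k] exI[of _ "k + k"] exI[of _ "i + (k + k)"] exI[of _ "2 ^ k"] conjI) auto
qed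

lemma unary_digit_iff:
  assumes "i < 2 ^ L"
  shows "unary_digit L c i t \<longleftrightarrow> (\<exists>k\<le>t. c + 2 * k = i)"
proof
  assume "\<exists>k\<le>t. c + 2 * k = i"
  then obtain k where "k \<le> t" "c + 2 * k = i" by blast
  then show "unary_digit L c i t"
    unfolding unary_digit_def using assms by (intro exI[of _ k] exI[of _ "k + k"]) auto
qed (force simp: unary_digit_def)

section \<open>Words and positions\<close>

definition hi :: "letter \<Rightarrow> bool" where "hi l \<longleftrightarrow> l \<in> {Digit0, Digit1}"
definition lo :: "letter \<Rightarrow> bool" where "lo l \<longleftrightarrow> l \<in> {Minus, Digit1}"

definition letter_of :: "bool \<Rightarrow> bool \<Rightarrow> letter" where
  "letter_of h l = (if h then if l then Digit1 else Digit0 else if l then Minus else Plus)"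

lemma letter_code_hi_lo: "letter_code l = [hi l, lo l]"
  by (cases l) (auto simp: hi_def lo_def)

lemma letter_code_letter_of: "letter_code (letter_of h l) = [h, l]"
  by (auto simp: letter_of_def)

definition encode :: "letter list \<Rightarrow> bool list" where
  "encode w = concat (map letter_code w)"

lemma length_encode: "length (encode w) = 2 * length w"
  by (induction w) (auto simp: encode_def letter_code_hi_lo)

lemma nth_encode: "i < length w \<Longrightarrow> encode w ! (2 * i) = hi (w ! i) \<and> encode w ! Suc (2 * i) = lo (w ! i)"
proof (induction w arbitrary: i)
  case (Cons l w)
  have "encode (l # w) = hi l # lo l # encode w" by (simp add: encode_def letter_code_hi_lo)
  then show ?case using Cons by (cases i) auto
qed simp

lemma encode_letters:
  "encode (map (\<lambda>j. letter_of (f (2 * j)) (f (Suc (2 * j)))) [0..<n]) = map f [0..<2 * n]"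
  by (induction n) (auto simp: encode_def letter_code_letter_of)

definition pos :: "'a list list \<Rightarrow> nat \<Rightarrow> nat" where
  "pos ws k = length (concat (take k ws))"

lemma pos_0: "pos ws 0 = 0"
  by (simp add: pos_def)

lemma pos_Suc: "k < length ws \<Longrightarrow> pos ws (Suc k) = pos ws k + length (ws ! k)"
  by (simp add: pos_def take_Suc_conv_app_nth)

lemma pos_length: "pos ws (length ws) = length (concat ws)"
  by (simp add: pos_def)

lemma nth_concat_pos:
  assumes "k < length ws" "r < length (ws ! k)"
  shows "concat ws ! (pos ws k + r) = ws ! k ! r"
proof -
  have "concat ws = concat (take k ws @ ws ! k # drop (Suc k) ws)"
    using assms(1) by (simp add: id_take_nth_drop[symmetric])
  then have "concat ws = concat (take k ws) @ ws ! k @ concat (drop (Suc k) ws)" by simp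
  then show ?thesis using assms(2) by (simp add: pos_def nth_append)
qed

lemma ex_pos: "n \<le> length ws \<Longrightarrow> i < pos ws n \<Longrightarrow> \<exists>k<n. pos ws k \<le> i \<and> i < pos ws (Suc k)"
proof (induction n)
  case (Suc n)
  then show ?case by (cases "i < pos ws n") (auto intro: less_SucI)
qed (simp add: pos_0)

lemma concat_intervals:
  fixes c :: "nat \<Rightarrow> nat"
  assumes "\<And>k. k < n \<Longrightarrow> c k \<le> c (Suc k)" "c 0 = 0"
  shows "concat (map (\<lambda>k. map f [c k..<c (Suc k)]) [0..<n]) = map f [0..<c n]"
  using assms(1)
proof (induction n)
  case (Suc n)
  then have "c n \<le> c (Suc n)" by simp
  then have "[0..<c (Suc n)] = [0..<c n] @ [c n..<c (Suc n)]"
    using upt_add_eq_append[of 0 "c n" "c (Suc n) - c n"] by simp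
  then show ?case using Suc by simp
qed (simp add: assms(2))

lemma unary_codeE:
  assumes "unary_code a u"
  obtains s r where "u = s # r" "sign_of a s" "set r \<subseteq> {Digit0, Digit1}"
    "length (filter (\<lambda>l. l = Digit1) r) = nat \<bar>a\<bar>"
proof -
  obtain s p q where s: "sign_of a s"
    "u = s # replicate p Digit0 @ replicate (nat \<bar>a\<bar>) Digit1 @ replicate q Digit0"
    using assms unfolding unary_code_def by blast
  show ?thesis by (rule that[OF s(2,1)]) auto
qed

locale coded_list =
  fixes as :: "int list" and ws :: "letter list list"
  assumes codes: "list_all2 unary_code as ws" and nonempty: "as \<noteq> []"
begin

definition "w = concat ws"
definition "v = encode w"

abbreviation "p \<equiv> pos ws"

lemma len: "length ws = length as"
  using codes by (simp add: list_all2_lengthD)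

lemma word_code: "k < length as \<Longrightarrow> unary_code (as ! k) (ws ! k)"
  using codes by (simp add: list_all2_conv_all_nth)

lemma length_word: "k < length as \<Longrightarrow> 0 < length (ws ! k)"
  by (drule word_code) (auto elim!: unary_codeE)

lemma hi_word:
  assumes "k < length as" "r < length (ws ! k)"
  shows "hi (ws ! k ! r) \<longleftrightarrow> r \<noteq> 0"
proof -
  obtain s x where *: "ws ! k = s # x" "sign_of (as ! k) s" "set x \<subseteq> {Digit0, Digit1}"
    using word_code[OF assms(1)] by (elim unary_codeE)
  show ?thesis
  proof (cases r)
    case 0
    then show ?thesis using * by (auto simp: hi_def sign_of_def)
  next
    case (Suc r')
    then have "x ! r' \<in> set x" using assms(2) * by simp
    then show ?thesis using * Suc by (auto simp: hi_def)
  qed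
qed

lemma p_mono: "k < k' \<Longrightarrow> k' \<le> length as \<Longrightarrow> p k < p k'"
proof (induction k')
  case (Suc k')
  then have "p k' < p (Suc k')" using length_word[of k'] by (simp add: pos_Suc len)
  then show ?case using Suc by (cases "k = k'") auto
qed simp

lemma p_mono_le: "k \<le> k' \<Longrightarrow> k' \<le> length as \<Longrightarrow> p k \<le> p k'"
  using p_mono[of k k'] by (cases "k = k'") auto

lemma p_inject: "p k = p k' \<Longrightarrow> k < length as \<Longrightarrow> k' < length as \<Longrightarrow> k = k'"
  using p_mono[of k k'] p_mono[of k' k] by (metis less_imp_le linorder_neqE_nat nat_neq_iff)

lemma p_length: "p (length as) = length w"
  using pos_length[of ws] by (simp add: w_def len)

lemma p_less: "k < length as \<Longrightarrow> p k < length w"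
  using p_mono[of k "length as"] p_length by simp

lemma length_v: "length v = 2 * length w"
  by (simp add: v_def length_encode)

lemma nth_w: "k < length as \<Longrightarrow> r < length (ws ! k) \<Longrightarrow> w ! (p k + r) = ws ! k ! r"
  unfolding w_def by (rule nth_concat_pos) (simp_all add: len)

lemma position:
  assumes "i < length w"
  obtains k r where "k < length as" "r < length (ws ! k)" "i = p k + r"
proof -
  have "i < p (length as)" using assms p_length by simp
  then obtain k where k: "k < length as" "p k \<le> i" "i < p (Suc k)"
    using ex_pos[of "length as" ws i] len by auto
  then have "i - p k < length (ws ! k)" by (simp add: pos_Suc len)
  then show ?thesis using that[OF k(1)] k(2) by simp
qed

lemma start_iff: "start v s \<longleftrightarrow> (\<exists>k<length as. s = 2 * p k)"
proof
  assume s: "start v s"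
  then obtain i where i: "s = 2 * i" by (auto simp: start_def elim: evenE)
  then have il: "i < length w" using s by (simp add: start_def length_v)
  then have "\<not> hi (w ! i)" using s i nth_encode[OF il] by (simp add: start_def v_def)
  moreover obtain k r where kr: "k < length as" "r < length (ws ! k)" "i = p k + r"
    using position[OF il] .
  ultimately have "r = 0" using hi_word[OF kr(1,2)] nth_w[OF kr(1,2)] by simp
  then show "\<exists>k<length as. s = 2 * p k" using kr i by auto
next
  assume "\<exists>k<length as. s = 2 * p k"
  then obtain k where k: "k < length as" "s = 2 * p k" by blast
  have "\<not> hi (w ! p k)" using nth_w[OF k(1) length_word[OF k(1)]] hi_word[OF k(1) length_word[OF k(1)]] by simp
  then show "start v s"
    using k p_less[OF k(1)] nth_encode[OF p_less[OF k(1)]] by (simp add: start_def length_v v_def length_encode)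
qed

lemma digit_one_iff: "digit_one v u \<longleftrightarrow> (\<exists>i<length w. u = 2 * i \<and> w ! i = Digit1)"
proof
  assume u: "digit_one v u"
  then obtain i where i: "u = 2 * i" by (auto simp: digit_one_def elim: evenE)
  then have il: "i < length w" using u by (simp add: digit_one_def length_v)
  then have "hi (w ! i)" "lo (w ! i)" using u i nth_encode[OF il] by (simp_all add: digit_one_def v_def)
  then have "w ! i = Digit1" by (auto simp: hi_def lo_def)
  then show "\<exists>i<length w. u = 2 * i \<and> w ! i = Digit1" using i il by blast
next
  assume "\<exists>i<length w. u = 2 * i \<and> w ! i = Digit1"
  then obtain i where i: "i < length w" "u = 2 * i" "w ! i = Digit1" by blast
  then show "digit_one v u"
    using nth_encode[OF i(1)] by (simp add: digit_one_def length_v v_def length_encode hi_def lo_def)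
qed

lemma input_abs_eq:
  assumes k: "k < length as"
  shows "input_abs v (2 * p k) = nat \<bar>as ! k\<bar>"
proof -
  let ?A = "{r. r < length (ws ! k) \<and> ws ! k ! r = Digit1}"
  have sign: "\<not> hi (w ! p k')" if "k' < length as" for k'
    using nth_w[OF that length_word[OF that]] hi_word[OF that length_word[OF that]] by simp
  have "{u. 2 * p k < u \<and> digit_one v u \<and> \<not> (\<exists>s. 2 * p k < s \<and> s < u \<and> start v s)} =
    (\<lambda>r. 2 * (p k + r)) ` ?A"
  proof (intro set_eqI iffI)
    fix u assume "u \<in> {u. 2 * p k < u \<and> digit_one v u \<and> \<not> (\<exists>s. 2 * p k < s \<and> s < u \<and> start v s)}"
    then have u: "2 * p k < u" "digit_one v u" "\<And>s. 2 * p k < s \<Longrightarrow> s < u \<Longrightarrow> \<not> start v s" by blast+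
    then obtain i where i: "i < length w" "u = 2 * i" "w ! i = Digit1" by (auto simp: digit_one_iff)
    obtain k' r where kr: "k' < length as" "r < length (ws ! k')" "i = p k' + r"
      using position[OF i(1)] .
    have "r \<noteq> 0" using sign[OF kr(1)] i(3) kr(3) by (cases r) (auto simp: hi_def)
    \<comment> \<open>A one of an earlier integer lies before the sign at \<open>2 * p k\<close>; a
      one of a later integer has its own sign in between.\<close>
    have "k' = k"
    proof (rule ccontr)
      assume "k' \<noteq> k"
      then consider "k' < k" | "k < k'" by linarith
      then show False
      proof cases
        case 1
        then have "p (Suc k') \<le> p k" using k by (intro p_mono_le) auto
        then show False using u(1) i(2) kr by (simp add: pos_Suc len)
      next
        case 2
        then have "2 * p k < 2 * p k'" using p_mono[of k k'] kr(1) by simp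
        moreover have "2 * p k' < u" using i(2) kr(3) \<open>r \<noteq> 0\<close> by simp
        moreover have "start v (2 * p k')" using kr(1) by (auto simp: start_iff)
        ultimately show False using u(3) by blast
      qed
    qed
    then have "r \<in> ?A" using i(3) kr nth_w[of k r] by simp
    then show "u \<in> (\<lambda>r. 2 * (p k + r)) ` ?A" using i(2) kr(3) \<open>k' = k\<close> by blast
  next
    fix u assume "u \<in> (\<lambda>r. 2 * (p k + r)) ` ?A"
    then obtain r where r: "r < length (ws ! k)" "ws ! k ! r = Digit1" "u = 2 * (p k + r)" by blast
    have "r \<noteq> 0" using hi_word[OF k r(1)] r(2) by (auto simp: hi_def)
    have "p k + r < p (Suc k)" using r(1) k by (simp add: pos_Suc len)
    also have "\<dots> \<le> length w" using p_mono_le[of "Suc k" "length as"] k p_length by simp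
    finally have "digit_one v u" using r nth_w[OF k r(1)] by (auto simp: digit_one_iff)
    moreover have "\<not> start v s" if s: "2 * p k < s" "s < u" for s
    proof
      assume "start v s"
      then obtain k' where k': "k' < length as" "s = 2 * p k'" by (auto simp: start_iff)
      then have "p k < p k'" "p k' < p (Suc k)" using s r(3) \<open>p k + r < p (Suc k)\<close> by auto
      then have "k < k'" "k' < Suc k" 
        using p_mono_le[of k' k] p_mono_le[of "Suc k" k'] k k'(1) by (auto simp: not_le[symmetric])
      then show False by simp
    qed
    ultimately show "u \<in> {u. 2 * p k < u \<and> digit_one v u \<and> \<not> (\<exists>s. 2 * p k < s \<and> s < u \<and> start v s)}"
      using r(3) \<open>r \<noteq> 0\<close> by auto
  qed
  moreover have "inj_on (\<lambda>r. 2 * (p k + r)) ?A" by (auto simp: inj_on_def)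
  ultimately have "input_abs v (2 * p k) = card ?A" unfolding input_abs_def by (simp add: card_image)
  also have "\<dots> = length (filter (\<lambda>l. l = Digit1) (ws ! k))" by (simp add: length_filter_conv_card)
  also have "\<dots> = nat \<bar>as ! k\<bar>"
  proof -
    obtain s x where "ws ! k = s # x" "sign_of (as ! k) s" "length (filter (\<lambda>l. l = Digit1) x) = nat \<bar>as ! k\<bar>"
      using word_code[OF k] by (elim unary_codeE)
    then show ?thesis by (auto simp: sign_of_def)
  qed
  finally show ?thesis .
qed

definition negative :: "nat \<Rightarrow> bool" where
  "negative k \<longleftrightarrow> Suc (2 * p k) < length v \<and> v ! Suc (2 * p k)"

text \<open>A zero may carry a minus sign; both branches then agree.\<close>

lemma nth_as: "k < length as \<Longrightarrow> as ! k = (if negative k then - int (input_abs v (2 * p k)) else int (input_abs v (2 * p k)))"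
proof -
  assume k: "k < length as"
  obtain s x where *: "ws ! k = s # x" "sign_of (as ! k) s"
    using word_code[OF k] by (elim unary_codeE)
  have "w ! p k = s" using nth_w[OF k length_word[OF k]] * by simp
  then have "negative k \<longleftrightarrow> lo s"
    using p_less[OF k] nth_encode[OF p_less[OF k]] by (simp add: negative_def length_v v_def length_encode)
  then show ?thesis using * input_abs_eq[OF k] by (auto simp: sign_of_def lo_def)
qed

lemma starts: "Collect (start v) = (\<lambda>k. 2 * p k) ` {..<length as}" 
  by (auto simp: start_iff)

lemma inj_starts: "inj_on (\<lambda>k. 2 * p k) {..<length as}"
  using p_inject by (auto simp: inj_on_def)

lemma input_gcd_eq: "int (input_gcd v) = Gcd (set as)"
proof -
  have "input_abs v ` Collect (start v) = (\<lambda>k. nat \<bar>k\<bar>) ` set as"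
    unfolding starts set_conv_nth by (force simp: input_abs_eq image_iff)
  then show ?thesis by (simp add: input_gcd_def Gcd_nat_abs_eq)
qed

section \<open>Layout of the output blocks\<close>

definition "L = 8 * (lg (length v) + 1)"
definition "N = (2 :: nat) ^ (L - 1)"
definition "B = length v ^ 4"
text \<open>Positions are counted in letters. The sentinel \<open>N\<close> at
  \<open>length as\<close> makes the final block end with the output.\<close>

definition "c k = (if k < length as then p k * B else N)"

lemma large: "large v L"
  by (simp add: large_def L_def)

lemma twice_N: "2 * N = 2 ^ L"
proof -
  have "L = Suc (L - 1)" by (simp add: L_def)
  then show ?thesis unfolding N_def by (metis power_Suc)
qed

lemma length_v_ge: "2 \<le> length v"
  using p_less[of 0] nonempty by (simp add: length_v)

lemma B_ge: "length v ^ 3 + 2 \<le> B"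
proof -
  have 2: "2 ^ 3 \<le> length v ^ 3" using length_v_ge by (intro power_mono) auto
  have "length v ^ 3 * 2 \<le> length v ^ 3 * length v" using length_v_ge by simp
  also have "\<dots> = B" by (simp add: B_def power_Suc2[symmetric] eval_nat_numeral)
  finally show ?thesis using 2 by simp
qed

text \<open>The universe is large enough for a full block of \<open>B\<close> letters after any
  possible start: twice the left side is at most \<open>4 * length v ^ 5\<close>, which the exponent
  8 covers.\<close>

lemma N_ge: "length w * B + B \<le> N"
proof -
  have "2 * (length w * B + B) \<le> 4 * (length v * B)"
    using length_v_ge by (simp add: length_v algebra_simps)
  also have "\<dots> = 4 * length v ^ 5" by (simp add: B_def eval_nat_numeral)
  also have "\<dots> \<le> 2 ^ 8 * length v ^ 8"
    using length_v_ge by (intro mult_le_mono power_increasing) auto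
  also have "\<dots> \<le> 2 ^ L" using large_power(1)[OF large] by (simp only: power_mult_distrib)
  finally show ?thesis unfolding twice_N[symmetric] by simp
qed

lemma c_step: "k < length as \<Longrightarrow> c k + length v ^ 3 + 2 \<le> c (Suc k)"
proof (cases "Suc k < length as")
  case True
  assume "k < length as"
  have "Suc (p k) \<le> p (Suc k)" using p_mono[of k "Suc k"] True by simp
  then have "Suc (p k) * B \<le> p (Suc k) * B" by (intro mult_le_mono) auto
  then show ?thesis using True B_ge by (simp add: c_def)
next
  case False
  assume k: "k < length as"
  then have "p k * B \<le> length w * B" using p_less by (intro mult_le_mono) (auto simp: less_imp_le)
  moreover have "c k = p k * B" "c (Suc k) = N" using False k by (simp_all add: c_def)
  ultimately show ?thesis using N_ge B_ge by linarith
qed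

lemma c_step': "k < length as \<Longrightarrow> c k < c (Suc k)"
  using c_step[of k] by simp

lemma c_mono: "k < k' \<Longrightarrow> k' \<le> length as \<Longrightarrow> c k < c k'"
proof (induction k')
  case (Suc k')
  then have "c k' < c (Suc k')" using c_step' by simp
  then show ?case using Suc by (cases "k = k'") auto
qed simp

lemma c_0: "c 0 = 0" using nonempty by (simp add: c_def pos_0)

lemma c_length: "c (length as) = N" by (simp add: c_def)

lemma c_less: "k < length as \<Longrightarrow> c k < N"
  using c_mono[of k "length as"] c_length by simp

lemma block_c: "k < length as \<Longrightarrow> block v L (2 * p k) d \<longleftrightarrow> d = 2 * c k"
proof -
  assume k: "k < length as"
  then have "2 * p k \<le> length v" using p_less[OF k] by (simp add: length_v)
  from block_iff[OF large this] show ?thesis using k by (simp add: c_def B_def mult.assoc)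
qed

lemma less_U: "j < N \<Longrightarrow> 2 * j < 2 ^ L" "j < N \<Longrightarrow> Suc (2 * j) < 2 ^ L"
  using twice_N by auto

lemma block_last_iff:
  assumes k: "k < length as" and E: "E < 2 ^ L"
  shows "block_last v L (2 * p k) E \<longleftrightarrow> Suc E = 2 * c (Suc k)"
proof (cases "Suc k < length as")
  case True
  have nxt: "(\<exists>u<2 ^ L. \<exists>d<2 ^ L. start v u \<and> 2 * p k < u \<and>
        (\<forall>x<2 ^ L. 2 * p k < x \<and> x < u \<longrightarrow> \<not> start v x) \<and> block v L u d \<and> d = Suc E) \<longleftrightarrow>
      Suc E = 2 * c (Suc k)" (is "?A \<longleftrightarrow> _")
  proof
    assume ?A
    then obtain u d where u: "start v u" "2 * p k < u" "block v L u d" "d = Suc E" "u < 2 ^ L"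
      "\<And>x. x < 2 ^ L \<Longrightarrow> 2 * p k < x \<Longrightarrow> x < u \<Longrightarrow> \<not> start v x" by blast
    obtain k' where k': "k' < length as" "u = 2 * p k'" using u(1) by (auto simp: start_iff)
    have "k < k'" using u(2) k'(2) p_mono_le[of k' k] k by (auto simp: not_le[symmetric])
    moreover have "\<not> Suc k < k'"
    proof
      assume "Suc k < k'"
      then have "p (Suc k) < p k'" using k'(1) by (intro p_mono) auto
      moreover have "p k < p (Suc k)" using True by (intro p_mono) auto
      ultimately have "\<not> start v (2 * p (Suc k))" using u(5,6) k'(2) by simp
      then show False using True by (auto simp: start_iff)
    qed
    ultimately have "k' = Suc k" by simp
    then show "Suc E = 2 * c (Suc k)" using u(3,4) k' block_c[of k' d] by simp
  next
    assume E': "Suc E = 2 * c (Suc k)"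
    have s: "start v (2 * p (Suc k))" using True by (auto simp: start_iff)
    moreover have "2 * p k < 2 * p (Suc k)" using True by (simp add: p_mono)
    moreover have "\<not> start v x" if x: "2 * p k < x" "x < 2 * p (Suc k)" for x
    proof
      assume "start v x"
      then obtain k' where "k' < length as" "x = 2 * p k'" by (auto simp: start_iff)
      then have "k < k'" "k' < Suc k"
        using x p_mono_le[of k' k] p_mono_le[of "Suc k" k'] k by (auto simp: not_le[symmetric])
      then show False by simp
    qed
    moreover have "block v L (2 * p (Suc k)) (Suc E)" using block_c[OF True] E' by simp
    moreover have "Suc E < 2 ^ L" using E' less_U(1)[OF c_less[OF True]] by simp
    moreover have "2 * p (Suc k) < 2 ^ L" using start_less[OF large s] .
    ultimately show ?A
      by blast
  qed
  have "start v (2 * p (Suc k))" "2 * p k < 2 * p (Suc k)"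
    using True by (auto simp: start_iff p_mono)
  then have "\<not> (\<forall>u<2 ^ L. 2 * p k < u \<longrightarrow> \<not> start v u)" using start_less[OF large] by blast
  then show ?thesis unfolding block_last_def nxt by blast
next
  case False
  have none: "\<not> start v u" if "2 * p k < u" for u
  proof
    assume "start v u"
    then obtain k' where "k' < length as" "u = 2 * p k'" by (auto simp: start_iff)
    then show False using that p_mono_le[of k' k] k False by auto
  qed
  \<comment> \<open>Only the greatest number of the universe bounds all others.\<close>
  have "(\<forall>x<2 ^ L. x \<le> E) \<longleftrightarrow> Suc E = 2 ^ L"
  proof
    assume "\<forall>x<2 ^ L. x \<le> E"
    then have "\<not> Suc E < 2 ^ L" by (metis not_less_eq_eq order_refl)
    then show "Suc E = 2 ^ L" using E by simp
  qed auto
  then show ?thesis unfolding block_last_def using none False twice_N by (auto simp: c_def)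
qed

lemma block_index:
  assumes "k < length as" "k' < length as" "c k \<le> j" "j < c (Suc k)" "c k' \<le> j" "j < c (Suc k')"
  shows "k' = k"
proof (rule ccontr)
  assume "k' \<noteq> k"
  then consider "Suc k \<le> k'" | "Suc k' \<le> k" by linarith
  then show False
  proof cases
    case 1
    then have "c (Suc k) \<le> c k'" using c_mono[of "Suc k" k'] assms(2) by (cases "Suc k = k'") auto
    then show False using assms by simp
  next
    case 2
    then have "c (Suc k') \<le> c k" using c_mono[of "Suc k'" k] assms(1) by (cases "Suc k' = k") auto
    then show False using assms by simp
  qed
qed

lemma output_digit_iff:
  assumes k: "k < length as" and j: "c k \<le> j" "j < c (Suc k)"
  shows "output_digit binary v L (2 * j) \<longleftrightarrow> c k < j \<and> (\<exists>t<2 ^ L. output_abs v L (2 * p k) t \<and>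
    (if binary then binary_digit L (2 * c (Suc k) - 1) (2 * j) t else unary_digit L (2 * c k) (2 * j) t))"
    (is "_ \<longleftrightarrow> c k < j \<and> (\<exists>t<2 ^ L. _ \<and> ?D t)")
proof -
  have cN: "c (Suc k) \<le> N" using c_mono[of "Suc k" "length as"] c_length k by (cases "Suc k = length as") auto
  show ?thesis
  proof
    assume "output_digit binary v L (2 * j)"
    then obtain s E t d where *: "E < 2 ^ L" "t < 2 ^ L" "start v s" "block v L s d" "d < 2 * j"
       "block_last v L s E" "2 * j \<le> E" "output_abs v L s t"
       "if binary then binary_digit L E (2 * j) t else unary_digit L d (2 * j) t"
      unfolding output_digit_def by blast
    obtain k' where k': "k' < length as" "s = 2 * p k'" using *(3) by (auto simp: start_iff)
    have d: "d = 2 * c k'" using *(4) block_c[OF k'(1)] k'(2) by simp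
    have E: "Suc E = 2 * c (Suc k')" using *(1,6) block_last_iff[OF k'(1)] k'(2) by simp
    have "k' = k" by (rule block_index[OF k k'(1) j]) (use d E * in auto)
    then show "c k < j \<and> (\<exists>t<2 ^ L. output_abs v L (2 * p k) t \<and> ?D t)"
      using * d k' E by (metis diff_Suc_1 nat_mult_less_cancel_disj)
  next
    assume "c k < j \<and> (\<exists>t<2 ^ L. output_abs v L (2 * p k) t \<and> ?D t)"
    then obtain t where t: "c k < j" "t < 2 ^ L" "output_abs v L (2 * p k) t" "?D t" by blast
    have s: "start v (2 * p k)" using k by (auto simp: start_iff)
    have E: "2 * c (Suc k) - 1 < 2 ^ L" using cN twice_N j by simp
    have "block_last v L (2 * p k) (2 * c (Suc k) - 1)"
      using block_last_iff[OF k E] j by simp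
    moreover have "block v L (2 * p k) (2 * c k)" using block_c[OF k] by simp
    moreover have "2 * c k < 2 ^ L" using less_U(1)[OF c_less[OF k]] .
    moreover have "2 * c k < 2 * j" "2 * j \<le> 2 * c (Suc k) - 1" using t(1) j by auto
    ultimately show "output_digit binary v L (2 * j)"
      unfolding output_digit_def using t s E start_less[OF large s] by blast
  qed
qed

definition out_letter :: "bool \<Rightarrow> nat \<Rightarrow> letter" where
  "out_letter binary j = letter_of (output_bit binary v L (2 * j)) (output_bit binary v L (Suc (2 * j)))"

lemma ex_block_iff: "(\<exists>s<2 ^ L. start v s \<and> block v L s (2 * j) \<and> P s) \<longleftrightarrow> (\<exists>k<length as. c k = j \<and> P (2 * p k))"
proof
  assume "\<exists>s<2 ^ L. start v s \<and> block v L s (2 * j) \<and> P s"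
  then obtain s where s: "start v s" "block v L s (2 * j)" "P s" by blast
  obtain k where "k < length as" "s = 2 * p k" using s(1) by (auto simp: start_iff)
  then show "\<exists>k<length as. c k = j \<and> P (2 * p k)" using s block_c[of k] by auto
next
  assume "\<exists>k<length as. c k = j \<and> P (2 * p k)"
  then obtain k where k: "k < length as" "c k = j" "P (2 * p k)" by blast
  have "start v (2 * p k)" using k by (auto simp: start_iff)
  then show "\<exists>s<2 ^ L. start v s \<and> block v L s (2 * j) \<and> P s"
    using start_less[OF large] block_c[OF k(1)] k by blast
qed

lemma output_bit_even: "output_bit binary v L (2 * j) \<longleftrightarrow> \<not> (\<exists>k<length as. c k = j)"
proof -
  have "2 * j \<noteq> Suc i" if "even i" for i using that by presburger
  then show ?thesis unfolding output_bit_def using ex_block_iff[of j "\<lambda>_. True"] by auto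
qed

lemma output_bit_odd:
  assumes "j < N"
  shows "output_bit binary v L (Suc (2 * j)) \<longleftrightarrow>
    (\<exists>k<length as. c k = j \<and> output_negative v L (2 * p k)) \<or> output_digit binary v L (2 * j)"
  unfolding output_bit_def using ex_block_iff[of j "output_negative v L"] less_U(1)[OF assms] by auto

lemma out_letter_sign:
  assumes k: "k < length as"
  shows "out_letter binary (c k) = (if output_negative v L (2 * p k) then Minus else Plus)"
proof -
  have "\<not> output_digit binary v L (2 * c k)"
    using output_digit_iff[OF k order.refl c_step'[OF k]] by simp
  moreover have "c k' = c k \<longleftrightarrow> k' = k" if "k' < length as" for k'
    using c_mono[of k k'] c_mono[of k' k] k that by (cases k k' rule: linorder_cases) auto
  ultimately show ?thesis
    unfolding out_letter_def output_bit_even output_bit_odd[OF c_less[OF k]] letter_of_def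
    using k by auto
qed

lemma out_letter_digit:
  assumes k: "k < length as" and j: "c k < j" "j < c (Suc k)"
  shows "out_letter binary j = (if output_digit binary v L (2 * j) then Digit1 else Digit0)"
proof -
  have no: "\<not> (\<exists>k'<length as. c k' = j)"
  proof
    assume "\<exists>k'<length as. c k' = j"
    then obtain k' where k': "k' < length as" "c k' = j" by blast
    then have "k' = k" using c_step'[OF k'(1)] j by (intro block_index[OF k k'(1), of j]) auto
    then show False using k' j by simp
  qed
  have "c (Suc k) \<le> N" using c_mono[of "Suc k" "length as"] c_length k by (cases "Suc k = length as") auto
  then have "j < N" using j by simp
  from output_bit_odd[OF this] show ?thesis
    unfolding out_letter_def output_bit_even letter_of_def using no by auto
qed

end

section \<open>The output as a code of the coefficients\<close>

lemma horner_sum_bits: "t < 2 ^ n \<Longrightarrow> horner_sum of_bool 2 (map (bit t) [0..<n]) = (int t)"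
proof -
  assume "t < 2 ^ n"
  have "horner_sum of_bool 2 (map (bit (int t)) [0..<n]) = take_bit n (int t)"
    by (rule horner_sum_bit_eq_take_bit)
  moreover have "bit (int t) = bit t" by (auto simp: fun_eq_iff bit_of_nat_iff_bit)
  moreover have "take_bit n (int t) = int t"
    using \<open>t < 2 ^ n\<close> by (simp add: take_bit_int_eq_self)
  ultimately show ?thesis by simp
qed

lemma unary_code_digits:
  assumes "sign_of x s" "nat \<bar>x\<bar> \<le> n"
  shows "unary_code x (s # map (\<lambda>i. if i < nat \<bar>x\<bar> then Digit1 else Digit0) [0..<n])"
proof -
  have "map (\<lambda>i. if i < t then Digit1 else Digit0) [0..<n] = replicate t Digit1 @ replicate (n - t) Digit0"
    if "t \<le> n" for t
    using that by (intro nth_equalityI) (auto simp: nth_append)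
  then show ?thesis unfolding unary_code_def using assms
    by (intro exI[of _ s] exI[of _ 0] exI[of _ "n - nat \<bar>x\<bar>"]) auto
qed

lemma binary_code_digits:
  assumes "sign_of x s" "nat \<bar>x\<bar> < 2 ^ n" "0 < n"
  shows "binary_code x (s # map (\<lambda>i. if bit (nat \<bar>x\<bar>) (n - 1 - i) then Digit1 else Digit0) [0..<n])"
proof -
  let ?bs = "rev (map (bit (nat \<bar>x\<bar>)) [0..<n])"
  have "map (\<lambda>i. if bit (nat \<bar>x\<bar>) (n - 1 - i) then Digit1 else Digit0) [0..<n] =
    map (\<lambda>b. if b then Digit1 else Digit0) ?bs"
    by (intro nth_equalityI) (auto simp: rev_nth)
  then show ?thesis unfolding binary_code_def using assms horner_sum_bits[OF assms(2)]
    by (intro exI[of _ s] exI[of _ ?bs]) auto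
qed

context coded_list
begin

lemma output_correct:
  assumes code: "code = (if binary then binary_code else unary_code)"
  shows "\<exists>xs :: int list. length xs = length as \<and> list_code code xs (map (out_letter binary) [0..<N]) \<and>
     (\<Sum>i<length as. xs ! i * as ! i) = Gcd (set as) \<and>
     (\<forall>i<length as. \<bar>xs ! i\<bar> \<le> int (length as + 1) * (Max (abs ` set as))\<^sup>2)"
proof (rule ex_bezout[OF large])
  fix z :: "nat \<Rightarrow> int"
  assume z_sum: "(\<Sum>s | start v s. z s * int (input_abs v s)) = int (input_gcd v)"
    and z_le: "\<And>s A. start v s \<Longrightarrow> (\<And>u. start v u \<Longrightarrow> input_abs v u \<le> A) \<Longrightarrow>
       nat \<bar>z s\<bar> \<le> (card (Collect (start v)) + 1) * A\<^sup>2"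
    and z_abs: "\<And>s t. start v s \<Longrightarrow> 0 < t \<Longrightarrow> output_abs v L s t \<longleftrightarrow> t = nat \<bar>z s\<bar>"
    and z_neg: "\<And>s. start v s \<Longrightarrow> z s \<noteq> 0 \<Longrightarrow>
       output_negative v L s \<longleftrightarrow> (Suc s < length v \<and> v ! Suc s) \<noteq> (z s < 0)"
    and z_small: "\<And>s. start v s \<Longrightarrow> nat \<bar>z s\<bar> \<le> length v ^ 3"
  \<comment> \<open>The signs of the inputs are moved into the coefficients.\<close>
  define x where "x k = (if negative k then - z (2 * p k) else z (2 * p k))" for k
  define xs where "xs = map x [0..<length as]"
  have st: "start v (2 * p k)" if "k < length as" for k using that by (auto simp: start_iff)
  have "(\<Sum>i<length as. xs ! i * as ! i) =
      (\<Sum>k<length as. z (2 * p k) * int (input_abs v (2 * p k)))"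
    by (intro sum.cong) (auto simp: xs_def x_def nth_as)
  also have "\<dots> = (\<Sum>s\<in>Collect (start v). z s * int (input_abs v s))"
    unfolding starts by (subst sum.reindex[OF inj_starts]) simp
  finally have sum: "(\<Sum>i<length as. xs ! i * as ! i) = Gcd (set as)"
    using z_sum input_gcd_eq by simp
  have bound: "\<bar>xs ! k\<bar> \<le> int (length as + 1) * (Max (abs ` set as))\<^sup>2" if k: "k < length as" for k
  proof -
    define A where "A = Max (abs ` set as)"
    have A: "\<bar>as ! i\<bar> \<le> A" if "i < length as" for i
      unfolding A_def using that by (intro Max_ge) auto
    then have A0: "0 \<le> A" using k abs_ge_zero order.trans by blast
    have "input_abs v u \<le> nat A" if "start v u" for u
    proof -
      obtain i where "i < length as" "u = 2 * p i" using \<open>start v u\<close> by (auto simp: start_iff)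
      then show ?thesis using A[of i] input_abs_eq[of i] by simp
    qed
    then have "nat \<bar>z (2 * p k)\<bar> \<le> (card (Collect (start v)) + 1) * (nat A)\<^sup>2"
      by (intro z_le st k)
    moreover have "card (Collect (start v)) = length as"
      unfolding starts using card_image[OF inj_starts] by simp
    ultimately have "nat \<bar>z (2 * p k)\<bar> \<le> (length as + 1) * (nat A)\<^sup>2" by simp
    then have "int (nat \<bar>z (2 * p k)\<bar>) \<le> int ((length as + 1) * (nat A)\<^sup>2)"
      by (simp only: of_nat_le_iff)
    then have "\<bar>z (2 * p k)\<bar> \<le> int (length as + 1) * A\<^sup>2" using A0 by (simp add: distrib_right)
    then show ?thesis using k by (simp add: xs_def x_def A_def)
  qed
  have word: "code (x k) (map (out_letter binary) [c k..<c (Suc k)])" if k: "k < length as" for k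
  proof -
    define t n where "t = nat \<bar>x k\<bar>" and "n = c (Suc k) - Suc (c k)"
    have t: "t = nat \<bar>z (2 * p k)\<bar>" by (simp add: t_def x_def)
    \<comment> \<open>This suffices for both codes: \<open>t\<close> ones fit into \<open>n\<close>
      places, and \<open>t < n\<close> implies \<open>t < 2 ^ n\<close>.\<close>
    have tn: "t < n" using z_small[OF st[OF k]] c_step[OF k] by (simp add: t n_def)
    have cs: "c (Suc k) = Suc (c k) + n" using c_step'[OF k] by (simp add: n_def)
    have tU: "t < 2 ^ L"
    proof -
      have "t \<le> length v ^ 3" using z_small[OF st[OF k]] by (simp add: t)
      then show ?thesis using power_length_less[OF large, of 3] by simp
    qed
    have cN: "c (Suc k) \<le> N" using c_mono[of "Suc k" "length as"] c_length k by (cases "Suc k = length as") auto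
    have digit: "output_digit binary v L (2 * (Suc (c k) + i)) \<longleftrightarrow>
      (if binary then bit t (n - 1 - i) else i < t)" if i: "i < n" for i
    proof -
      let ?j = "Suc (c k) + i" and ?E = "2 * c (Suc k) - 1"
      have j: "c k < ?j" "?j < c (Suc k)" using i cs by auto
      have jU: "2 * ?j < 2 ^ L" using j(2) cN by (intro less_U) simp
      have E: "?E < 2 ^ L" "2 * ?j \<le> ?E" using cN twice_N j by auto
      have b: "binary_digit L ?E (2 * ?j) t' \<longleftrightarrow> bit t' (n - 1 - i)" if "t' < 2 ^ L" for t'
      proof -
        have "2 * ?j + 2 * q + 1 = ?E \<longleftrightarrow> q = n - 1 - i" for q using i cs by auto
        then show ?thesis using binary_digit_iff[OF E(1) that E(2)] by auto
      qed
      have u: "unary_digit L (2 * c k) (2 * ?j) t' \<longleftrightarrow> i < t'" for t'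
      proof -
        have "2 * c k + 2 * q = 2 * ?j \<longleftrightarrow> q = Suc i" for q by auto
        then show ?thesis unfolding unary_digit_iff[OF jU] by (auto simp: Suc_le_eq)
      qed
      have D: "(if binary then binary_digit L ?E (2 * ?j) t' else unary_digit L (2 * c k) (2 * ?j) t') \<longleftrightarrow>
        (if binary then bit t' (n - 1 - i) else i < t')" if "t' < 2 ^ L" for t'
        using b[OF that] u by simp
      have "output_digit binary v L (2 * ?j) \<longleftrightarrow>
        (\<exists>t'<2 ^ L. output_abs v L (2 * p k) t' \<and> (if binary then bit t' (n - 1 - i) else i < t'))"
        using output_digit_iff[OF k less_imp_le[OF j(1)] j(2)] j(1) D by auto
      also have "\<dots> \<longleftrightarrow> (if binary then bit t (n - 1 - i) else i < t)"
      proof -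
        \<comment> \<open>A digit 1 forces a positive value, so knowing \<open>output_abs\<close>
          for positive arguments is enough.\<close>
        have "0 < t'" if "if binary then bit t' (n - 1 - i) else i < t'" for t' :: nat
          using that by (cases "t' = 0") (auto split: if_splits)
        then show ?thesis using z_abs[OF st[OF k]] tU t by metis
      qed
      finally show ?thesis .
    qed
    \<comment> \<open>If the coefficient is 0, either sign is admissible, whatever
      \<open>output_negative\<close> says.\<close>
    have sign: "sign_of (x k) (out_letter binary (c k))"
      using z_neg[OF st[OF k]] unfolding out_letter_sign[OF k] negative_def[symmetric]
      by (cases "z (2 * p k) = 0") (auto simp: sign_of_def x_def)
    have "[c k..<c (Suc k)] = c k # [Suc (c k)..<Suc (c k) + n]"
      using c_step'[OF k] cs by (simp add: upt_conv_Cons)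
    moreover have "map (out_letter binary) [Suc (c k)..<Suc (c k) + n] =
        map (\<lambda>i. out_letter binary (Suc (c k) + i)) [0..<n]"
      by (intro nth_equalityI) (simp_all del: upt_Suc)
    moreover have "\<dots> = map (\<lambda>i. if (if binary then bit t (n - 1 - i) else i < t) then Digit1 else Digit0) [0..<n]"
      by (intro map_cong refl) (use out_letter_digit[OF k] digit cs in auto)
    ultimately have "map (out_letter binary) [c k..<c (Suc k)] = out_letter binary (c k) #
        map (\<lambda>i. if (if binary then bit t (n - 1 - i) else i < t) then Digit1 else Digit0) [0..<n]"
      by simp
    moreover have "t < 2 ^ n" by (rule less_trans[OF tn less_exp])
    ultimately show ?thesis
      using unary_code_digits[OF sign, of n] binary_code_digits[OF sign, of n] tn
      unfolding code by (cases binary) (simp_all add: t_def)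
  qed
  have "map (out_letter binary) [0..<N] =
      concat (map (\<lambda>k. map (out_letter binary) [c k..<c (Suc k)]) [0..<length as])"
    using concat_intervals[of "length as" c "out_letter binary"] c_step' c_0 c_length
    by (simp add: less_imp_le)
  moreover have "list_all2 code xs (map (\<lambda>k. map (out_letter binary) [c k..<c (Suc k)]) [0..<length as])"
    using word by (simp add: list_all2_conv_all_nth xs_def)
  ultimately have "list_code code xs (map (out_letter binary) [0..<N])"
    unfolding list_code_def by blast
  then show ?thesis using sum bound by (intro exI[of _ xs]) (auto simp: xs_def)
qed

end

text \<open>The output is defined for all words, coded or not, and its length depends only on the
  input length, as circuits demand.\<close>

definition output_word :: "bool \<Rightarrow> letter list \<Rightarrow> letter list" where
  "output_word binary w = (let v = encode w; L = 8 * (lg (length v) + 1) in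
     map (\<lambda>j. letter_of (output_bit binary v L (2 * j)) (output_bit binary v L (Suc (2 * j)))) [0..<2 ^ (L - 1)])"

lemma output_word_TC0: "output_word binary \<in> TC0_letters"
proof -
  let ?F = "\<lambda>v. map (output_bit binary v (8 * (lg (length v) + 1))) [0..<2 ^ (8 * (lg (length v) + 1))]"
  have "?F \<in> TC0"
    by (rule TC0_definable[OF definable_output_bit])
  moreover have "?F (encode w) = encode (output_word binary w)" for w
  proof -
    \<comment> \<open>With two bits per letter, half as many letters as elements of the universe
      fill the circuit output exactly.\<close>
    have "2 * 2 ^ (8 * (l + 1) - 1) = (2 :: nat) ^ (8 * (l + 1))" for l
      by (subst power_Suc[symmetric]) simp
    then show ?thesis unfolding output_word_def Let_def encode_letters by simp
  qed
  ultimately show ?thesis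
    unfolding TC0_letters_def mem_Collect_eq encode_def by (intro bexI[of _ ?F] allI) simp_all
qed

theorem theorem9:
  shows "\<forall>code \<in> {unary_code, binary_code}.
    \<exists>f \<in> TC0_letters.
      \<forall>(as :: int list) w. as \<noteq> [] \<and> list_code unary_code as w \<longrightarrow>
        (\<exists>xs :: int list. length xs = length as \<and> list_code code xs (f w) \<and>
           (\<Sum>i<length as. xs ! i * as ! i) = Gcd (set as) \<and>
           (\<forall>i<length as. \<bar>xs ! i\<bar> \<le> int (length as + 1) * (Max (abs ` set as))\<^sup>2))"
proof (rule ballI, rule bexI[OF _ output_word_TC0], intro allI impI)
  fix code and as :: "int list" and w
  assume "code \<in> {unary_code, binary_code}"
  then have code: "code = (if code = binary_code then binary_code else unary_code)" by auto
  assume "as \<noteq> [] \<and> list_code unary_code as w"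
  then obtain ws where ws: "as \<noteq> []" "list_all2 unary_code as ws" "w = concat ws"
    by (auto simp: list_code_def)
  interpret coded_list as ws by unfold_locales (use ws in auto)
  have "output_word binary (concat ws) = map (out_letter binary) [0..<N]" for binary
    by (simp add: output_word_def Let_def out_letter_def N_def L_def v_def w_def)
  then show "\<exists>xs :: int list. length xs = length as \<and>
      list_code code xs (output_word (code = binary_code) w) \<and>
      (\<Sum>i<length as. xs ! i * as ! i) = Gcd (set as) \<and>
      (\<forall>i<length as. \<bar>xs ! i\<bar> \<le> int (length as + 1) * (Max (abs ` set as))\<^sup>2)"
    using output_correct[OF code] ws(3) by simp
qed

end
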